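(* Let $2\le p<\infty$, $a>0$, $b\in\mathbb R$, $\beta\in(0,1]$, $d\in\mathbb N$, and let $\mathcal T^d:=\{e^{i(\mathbf k,\mathbf x)}\}_{\mathbf k\in\mathbb Z^d}$ be the trigonometric system on $\mathbb T^d=[0,2\pi)^d$ with the normalized Lebesgue measure. There exist constants $c=c(a,b,\beta,p,d)$ and $C=C(a,b,\beta,p,d)$ such that for every $v\in\mathbb N$ and every $m\in\mathbb N$ satisfying $m\ge c\,v(\log(2v))^3$, $$\varrho_m^o(\mathbf W^{a,b}_{A_\beta}(\mathcal T^d),L_p(\mathbb T^d))\le C\,v^{1-1/p-1/\beta-a}(\log(2v))^{(d-1)(a+b)}.$$ Moreover, this bound is provided by the Weak Orthogonal Matching Pursuit (WOMP) with a fixed weakness parameter $t\in(0,1]$ (in the sense described in the context).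
   Context: Write $\psi_{\mathbf k}(\mathbf x)=e^{i(\mathbf k,\mathbf x)}$, $\Psi=\mathcal T^d$, $\Omega=\mathbb T^d$, $\mu$ = normalized Lebesgue measure on $\mathbb T^d$. Class $\mathbf W^{a,b}_{A_\beta}(\Psi)$. For $\mathbf s=(s_1,\dots,s_d)$ with nonnegative integer coordinates let $\rho(\mathbf s):=\{\mathbf k\in\mathbb Z^d:[2^{s_j-1}]\le|k_j|<2^{s_j},\ j=1,\dots,d\}$, where $[x]$ is the integer part of $x$, and $\|\mathbf s\|_1=s_1+\dots+s_d$. For $f=\sum_{\mathbf k}a_{\mathbf k}(f)\psi_{\mathbf k}$ with $\sum_{\mathbf k}|a_{\mathbf k}(f)|<\infty$ put $\delta_{\mathbf s}(f,\Psi):=\sum_{\mathbf k\in\rho(\mathbf s)}a_{\mathbf k}(f)\psi_{\mathbf k}$, $f_j:=\sum_{\|\mathbf s\|_1=j}\delta_{\mathbf s}(f,\Psi)$ for $j=0,1,2,\dots$, and $$|f_j|_{A_\beta(\Psi)}:=\Big(\sum_{\mathbf k\in\bigcup_{\|\mathbf s\|_1=j}\rho(\mathbf s)}|a_{\mathbf k}(f)|^\beta\Big)^{1/\beta}.$$ $\mathbf W^{a,b}_{A_\beta}(\Psi)$ is the set of functions $f$ having such a representation with $|f_j|_{A_\beta(\Psi)}\le2^{-aj}(\max(j,1))^{(d-1)b}$ for all $j=0,1,2,\dots$. Optimal recovery. For $\mathbf F\subset\mathcal C(\Omega)$, $$\varrho_m^o(\mathbf F,L_p(\Omega,\mu)):=\inf_{\xi}\inf_{\mathcal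 M}\sup_{f\in\mathbf F}\|f-\mathcal M(f(\xi^1),\dots,f(\xi^m))\|_{L_p(\Omega,\mu)},$$ where $\xi=\{\xi^1,\dots,\xi^m\}$ ranges over all sets of $m$ points of $\Omega$ and $\mathcal M$ over all mappings (not necessarily linear) $\mathbb C^m\to L_p(\Omega,\mu)$. WOMP. Let $\mathcal D$ be a system of nonzero elements of norm at most $1$ in a Hilbert space $H$ and $t\in(0,1]$. Given $f_0\in H$, for $k=1,2,\dots$: choose any $g_k\in\mathcal D$ with $|\langle f_{k-1},g_k\rangle|\ge t\sup_{g\in\mathcal D}|\langle f_{k-1},g\rangle|$; let $G_k(f_0,\mathcal D)$ be the orthogonal projection of $f_0$ onto $\operatorname{span}\{g_1,\dots,g_k\}$; put $f_k:=f_0-G_k(f_0,\mathcal D)$. "Provided by the WOMP" means: for a fixed $t\in(0,1]$ (the constant $c$ being allowed to depend also on $t$) and for $v,m$ as in the claim, there exist points $\xi^1,\dots,\xi^m\in\Omega$, a finite set $Q\subset\mathbb Z^d$ and a number $s$ of iterations (none depending on $f$) such that for every $f_0\in\mathbf W^{a,b}_{A_\beta}(\Psi)$, running the WOMP on $f_0$ in the Hilbert space $L_2(\Omega_m,\mu_m)$, where $\Omega_m=\{\xi^1,\dots,\xi^m\}$ and $\mu_m=\frac1m\sum_{j=1}^m\delta_{\xi^j}$, with respect to the restrictions to $\Omega_m$ of the functions $\psi_{\mathbf k}$, $\mathbf k\in Q$ (with any admissible choices of the $g_k$), the residual $f_s$ satisfies $\|f_s\|_{L_p(\Omega,\mu)}\le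 C v^{1-1/p-1/\beta-a}(\log(2v))^{(d-1)(a+b)}$. Here $f_s$ is viewed as a function on $\Omega$ by using, on all of $\Omega$, the linear combination of the selected $\psi_{\mathbf k}$ with the coefficients found by the algorithm. *)

theory Defs
  imports "HOL-Analysis.Analysis"
begin

text \<open>Functions on the torus are identified with 2 pi-periodic functions on the whole space;
  sample points and integrals only see the fundamental domain.\<close>

definition torus :: "(real ^ 'd::finite) set" where
  "torus = {x. \<forall>j. 0 \<le> x $ j \<and> x $ j < 2 * pi}"

definition torus_measure :: "(real ^ 'd::finite) measure" where
  "torus_measure = uniform_measure lborel torus"

definition trig :: "int ^ 'd::finite \<Rightarrow> real ^ 'd \<Rightarrow> complex" where
  "trig k x = exp (\<i> * complex_of_real (\<Sum>j\<in>UNIV. real_of_int (k $ j) * x $ j))"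

definition Lp_space :: "'a measure \<Rightarrow> real \<Rightarrow> ('a \<Rightarrow> complex) set" where
  "Lp_space M p =
    {f. f \<in> borel_measurable M \<and> integrable M (\<lambda>x. norm (f x) powr p)}"

text \<open>The norm is infinite outside the space, so that an upper bound on it always includes
  membership (the Bochner integral alone would return 0 there).\<close>

definition Lp_norm :: "'a measure \<Rightarrow> real \<Rightarrow> ('a \<Rightarrow> complex) \<Rightarrow> ennreal" where
  "Lp_norm M p f =
    (if f \<in> Lp_space M p then ennreal ((\<integral>x. norm (f x) powr p \<partial>M) powr (1 / p)) else \<infinity>)"

definition dyadic_block :: "nat ^ 'd::finite \<Rightarrow> (int ^ 'd) set" where
  "dyadic_block s =
    {k. \<forall>j. \<lfloor>(2::real) powi (int (s $ j) - 1)\<rfloor> \<le> \<bar>k $ j\<bar> \<and> \<bar>k $ j\<bar> < 2 ^ (s $ j)}"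

definition hyperbolic_layer :: "nat \<Rightarrow> (int ^ 'd::finite) set" where
  "hyperbolic_layer j = (\<Union>s\<in>{s. (\<Sum>i\<in>UNIV. s $ i) = j}. dyadic_block s)"

lemma finite_hyperbolic_layer: "finite (hyperbolic_layer j :: (int ^ 'd::finite) set)"
proof -
  have fin: "finite {f :: 'd \<Rightarrow> int. \<forall>i. f i \<in> {- (2 ^ j)..2 ^ j}}"
    using finite_PiE[of "UNIV :: 'd set" "\<lambda>_. {- (2 ^ j)..2 ^ j :: int}"]
    by (simp add: PiE_def Pi_def extensional_def)
  have "hyperbolic_layer j \<subseteq> vec_lambda ` {f :: 'd \<Rightarrow> int. \<forall>i. f i \<in> {- (2 ^ j)..2 ^ j}}"
  proof
    fix k :: "int ^ 'd" assume "k \<in> hyperbolic_layer j"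
    then obtain s :: "nat ^ 'd" where s: "(\<Sum>i\<in>UNIV. s $ i) = j" "k \<in> dyadic_block s"
      by (auto simp: hyperbolic_layer_def)
    have "\<bar>k $ i\<bar> \<le> 2 ^ j" for i
    proof -
      have "s $ i \<le> j" using s(1) member_le_sum[of i UNIV "\<lambda>i. s $ i"] by simp
      then have "(2::int) ^ (s $ i) \<le> 2 ^ j" by (simp add: power_increasing)
      moreover have "\<bar>k $ i\<bar> < 2 ^ (s $ i)" using s(2) by (auto simp: dyadic_block_def)
      ultimately show ?thesis by linarith
    qed
    then have "vec_nth k \<in> {f. \<forall>i. f i \<in> {- (2 ^ j)..2 ^ j}}"
      by (auto simp: abs_le_iff minus_le_iff)
    then show "k \<in> vec_lambda ` {f :: 'd \<Rightarrow> int. \<forall>i. f i \<in> {- (2 ^ j)..2 ^ j}}"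
      by (metis image_eqI vec_nth_inverse)
  qed
  then show ?thesis using fin finite_subset by blast
qed

definition layer_quasinorm :: "real \<Rightarrow> nat \<Rightarrow> (int ^ 'd::finite \<Rightarrow> complex) \<Rightarrow> real" where
  "layer_quasinorm \<beta> j u = (\<Sum>k\<in>hyperbolic_layer j. norm (u k) powr \<beta>) powr (1 / \<beta>)"

definition W_class :: "real \<Rightarrow> real \<Rightarrow> real \<Rightarrow> (real ^ 'd::finite \<Rightarrow> complex) set" where
  "W_class a b \<beta> =
    {f. \<exists>u :: int ^ 'd \<Rightarrow> complex.
          (\<lambda>k. norm (u k)) summable_on UNIV \<and>
          (\<forall>x. f x = (\<Sum>\<^sub>\<infinity>k. u k * trig k x)) \<and>
          (\<forall>j. layer_quasinorm \<beta> j u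
                \<le> 2 powr (- a * real j) * real (max j 1) powr ((real CARD('d) - 1) * b))}"

text \<open>The space of m-tuples of complex numbers is the set of extensional functions
  on the index set \<open>{..<m}\<close>.\<close>

definition optimal_recovery ::
    "nat \<Rightarrow> (real ^ 'd::finite \<Rightarrow> complex) set \<Rightarrow> real \<Rightarrow> ennreal" where
  "optimal_recovery m F p =
    (INF \<xi>\<in>{\<xi> :: nat \<Rightarrow> real ^ 'd. inj_on \<xi> {..<m} \<and> \<xi> ` {..<m} \<subseteq> torus}.
     INF R\<in>({..<m} \<rightarrow>\<^sub>E UNIV) \<rightarrow> Lp_space torus_measure p.
     SUP f\<in>F. Lp_norm torus_measure p (\<lambda>x. f x - R (\<lambda>i\<in>{..<m}. f (\<xi> i)) x))"

text \<open>The inner product of \<open>L\<^sub>2(\<Omega>\<^sub>m, \<mu>\<^sub>m)\<close>, where \<open>\<mu>\<^sub>m\<close> gives mass \<open>1/m\<close> to each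
  of \<open>\<xi> 0, \<dots>, \<xi> (m - 1)\<close>. It is applied to functions on the whole space, on which it is only
  a semi-inner product, and sees just their restrictions to the points.\<close>

definition sample_inner ::
    "nat \<Rightarrow> (nat \<Rightarrow> 'a) \<Rightarrow> ('a \<Rightarrow> complex) \<Rightarrow> ('a \<Rightarrow> complex) \<Rightarrow> complex" where
  "sample_inner m \<xi> f g = (\<Sum>j<m. f (\<xi> j) * cnj (g (\<xi> j))) / of_nat m"

definition lin_span :: "('a \<Rightarrow> complex) set \<Rightarrow> ('a \<Rightarrow> complex) set" where
  "lin_span S = {h. \<exists>T c. finite T \<and> T \<subseteq> S \<and> h = (\<lambda>x. \<Sum>g\<in>T. c g * g x)}"

definition is_orth_proj ::
    "(('a \<Rightarrow> complex) \<Rightarrow> ('a \<Rightarrow> complex) \<Rightarrow> complex) \<Rightarrow> ('a \<Rightarrow> complex) set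
      \<Rightarrow> ('a \<Rightarrow> complex) \<Rightarrow> ('a \<Rightarrow> complex) \<Rightarrow> bool" where
  "is_orth_proj ip V f h \<longleftrightarrow> h \<in> V \<and> (\<forall>w\<in>V. ip (\<lambda>x. f x - h x) w = 0)"

text \<open>\<open>s\<close> iterations of the algorithm for \<open>f0\<close>, with chosen elements \<open>g 1, \<dots>, g s\<close> and
  projections \<open>G 0, \<dots>, G s\<close>. The inner product may be degenerate: each \<open>G k\<close> is a linear
  combination of the chosen functions on their full domain whose class modulo null functions is
  the projection of the class of \<open>f0\<close>, so that the residual \<open>f0 - G k\<close> is also defined on the
  full domain.\<close>

definition womp_run ::
    "(('a \<Rightarrow> complex) \<Rightarrow> ('a \<Rightarrow> complex) \<Rightarrow> complex) \<Rightarrow> real \<Rightarrow> ('a \<Rightarrow> complex) set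
      \<Rightarrow> ('a \<Rightarrow> complex) \<Rightarrow> nat \<Rightarrow> (nat \<Rightarrow> 'a \<Rightarrow> complex) \<Rightarrow> (nat \<Rightarrow> 'a \<Rightarrow> complex) \<Rightarrow> bool" where
  "womp_run ip t D f0 s g G \<longleftrightarrow>
    (\<forall>k\<in>{1..s}. g k \<in> D \<and>
       norm (ip (\<lambda>x. f0 x - G (k - 1) x) (g k))
         \<ge> t * (SUP h\<in>D. norm (ip (\<lambda>x. f0 x - G (k - 1) x) h))) \<and>
    (\<forall>k\<le>s. is_orth_proj ip (lin_span (g ` {1..k})) f0 (G k))"

definition recovery_bound ::
    "'d::finite itself \<Rightarrow> real \<Rightarrow> real \<Rightarrow> real \<Rightarrow> real \<Rightarrow> nat \<Rightarrow> real" where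
  "recovery_bound _ a b \<beta> p v =
    real v powr (1 - 1 / p - 1 / \<beta> - a)
      * ln (2 * real v) powr ((real CARD('d) - 1) * (a + b))"

end

theory Submission
  imports Defs "HOL-Real_Asymp.Real_Asymp"
begin

text \<open>The core is a two-sided comparison, for all trigonometric polynomials with frequencies in a
  hyperbolic cross and coefficient vector \<open>x\<close>, of the mean square over \<open>m\<close> sample points with
  \<open>|x|_2 ^ 2\<close>, up to constant factors and an additive error of order \<open>|x|_1 ^ 2 / K\<close>. It holds for
  suitable points of a grid as soon as \<open>m\<close> is at least a constant times \<open>K log K (log m) ^ 2\<close>. If
  \<open>|x|_1 \<le> 1\<close>, then by Maurey's method the set where the polynomial exceeds \<open>2 ^ (-i)\<close> is, up to a
  factor \<open>2\<close> in the level, one of \<open>exp (C 4 ^ i (log m) ^ 2)\<close> fixed sets. Chernoff bounds for all these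
  sets give errors of order \<open>4 ^ i (log m) ^ 2 / m\<close> for their frequencies; summed with weights \<open>4 ^ (-i)\<close> over
  the \<open>log K\<close> relevant levels they yield the additive error. Both random choices are made greedily by
  means of exponential potentials, so that no probability space is needed.

  For every \<open>l\<close>, a function of the class splits into \<open>C 2 ^ l\<close> terms and a remainder with coefficient
  norms \<open>E l\<close> in \<open>l_1\<close> and \<open>E l / 2 ^ (l/2)\<close> in \<open>l_2\<close>. The comparison makes the sampled norm of the remainder
  of order \<open>E l / 2 ^ (l/2)\<close>, and as long as the residual is larger than this, each step of the algorithm
  reduces its square by the factor \<open>1 - c / 2 ^ l\<close>. As \<open>E l\<close> decays only polynomially in \<open>2 ^ l\<close>,
  \<open>C 2 ^ l\<close> steps for \<open>l = 0, 1, \<dots>, L\<close> suffice. The comparison then bounds the coefficients of the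
  residual in \<open>l_1\<close> and \<open>l_2\<close>, and interpolation between the uniform and the \<open>L_2\<close> norm gives the \<open>L_p\<close> bound.
  Two functions of the class with the same samples are close for the same reason.\<close>

section \<open>Sampling a bounded orthonormal system\<close>

text \<open>The three logarithms in the sample size have separate sources. A level set at height 2 ^
  (-i) is described by a list of about 4 ^ i * ln (card Y) signed frequencies, each entry costs ln
  (card Q), and such a cost arises for each of the \<open>I + 1\<close> levels. Frequencies up to a
  level proportional to L suffice for K of order 2 ^ L, so ln (card Q) is of order L. The grid Y
  needs at least 2 * m ^ 2 points, so that insisting on distinct sample points costs only a bounded
  factor; its logarithm therefore contains ln m, which is absorbed by m itself.

  The additive form of the error lets one inequality serve two kinds of vectors. On at most K / 40
  frequencies, Cauchy-Schwarz bounds the l_1 norm by the l_2 norm, the error is absorbed, and a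
  restricted isometry remains. The remainders of the class are not sparse, but their l_1 norm is
  small, so for them the error is small as it stands.\<close>

lemma exists_le_weighted_mean:
  fixes w \<Phi> :: "'a \<Rightarrow> real"
  assumes "finite S" "\<And>y. y \<in> S \<Longrightarrow> 0 \<le> w y" "0 < sum w S"
    and "(\<Sum>y\<in>S. w y * \<Phi> y) \<le> c * sum w S"
  shows "\<exists>y\<in>S. \<Phi> y \<le> c"
proof (rule ccontr)
  assume "\<not> ?thesis"
  then have gt: "\<And>y. y \<in> S \<Longrightarrow> c < \<Phi> y" by auto
  obtain z where z: "z \<in> S" "w z > 0"
    using assms(2,3) by (metis leD less_eq_real_def sum_nonpos)
  have "(\<Sum>y\<in>S. w y * c) < (\<Sum>y\<in>S. w y * \<Phi> y)"
    using assms(1,2) gt z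
  proof (intro sum_strict_mono_ex1 ballI)
    show "w y * c \<le> w y * \<Phi> y" if "y \<in> S" for y
      using assms(2)[OF that] gt[OF that] by (simp add: mult_left_mono)
    show "\<exists>y\<in>S. w y * c < w y * \<Phi> y" using z gt[OF z(1)] by (intro bexI[of _ z]) auto
  qed (use assms in auto)
  then show False using assms(4) by (simp add: sum_distrib_left mult.commute)
qed

section \<open>Hitting numbers and their exponential moments\<close>

definition hits :: "'a set \<Rightarrow> 'a list \<Rightarrow> nat" where
  "hits B ys = length (filter (\<lambda>y. y \<in> B) ys)"

lemma hits_Cons: "hits B (y # ys) = (if y \<in> B then Suc (hits B ys) else hits B ys)"
  by (simp add: hits_def)

text \<open>On average over \<open>Y\<close>, prepending one point multiplies
  \<open>c ^ hits B ys\<close> by \<open>1 + card B / card Y * (c - 1)\<close>, and the factor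
  \<open>exp s\<close> of the longer list compensates for it: a supermartingale inequality written
  as a sum. It is meant for \<open>c = 2\<close>, which punishes too many hits, and for
  \<open>c = 1/2\<close>, which punishes too few.\<close>

lemma sum_hits_weight:
  fixes c s :: real
  assumes "finite Y" "Y \<noteq> {}" "B \<subseteq> Y"
    and "1 + real (card B) / real (card Y) * (c - 1) \<le> exp (- s)" and "0 \<le> c"
  shows "(\<Sum>y\<in>Y. c ^ hits B (y # ys) * exp (s * real (length (y # ys))))
    \<le> real (card Y) * (c ^ hits B ys * exp (s * real (length ys)))"
proof -
  have Y: "real (card Y) > 0" using assms by (simp add: card_gt_0_iff)
  have "(\<Sum>y\<in>Y. c ^ hits B (y # ys) * exp (s * real (length (y # ys))))
      = (\<Sum>y\<in>Y. c ^ hits B ys * exp (s * real (length ys)) * exp s * (1 + indicator B y * (c - 1)))"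
    by (intro sum.cong) (auto simp: hits_Cons indicator_def algebra_simps exp_add)
  also have "\<dots> = c ^ hits B ys * exp (s * real (length ys)) * exp s *
      (real (card Y) + real (card B) * (c - 1))"
    using assms by (simp add: sum_distrib_left[symmetric] sum.distrib sum_distrib_right[symmetric]
        indicator_def sum.If_cases Int_absorb1 Int_absorb2)
  also have "real (card Y) + real (card B) * (c - 1)
      = real (card Y) * (1 + real (card B) / real (card Y) * (c - 1))"
    using Y by (simp add: field_simps)
  also have "c ^ hits B ys * exp (s * real (length ys)) * exp s * \<dots>
    \<le> c ^ hits B ys * exp (s * real (length ys)) * exp s * (real (card Y) * exp (- s))"
    using assms by (intro mult_left_mono) auto
  also have "\<dots> = real (card Y) * (c ^ hits B ys * exp (s * real (length ys)))"
    by (simp add: exp_minus field_simps)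
  finally show ?thesis .
qed

text \<open>The sample points are picked one at a time so that a sum of normalised exponential moments
  of the hitting numbers does not increase on average.\<close>

lemma exists_sampling_points:
  fixes Y :: "'a set" and F :: "nat \<Rightarrow> 'a set set"
  assumes Y: "finite Y" "Y \<noteq> {}"
    and F: "\<And>i. i \<le> I \<Longrightarrow> finite (F i) \<and> F i \<noteq> {}" "\<And>i B. i \<le> I \<Longrightarrow> B \<in> F i \<Longrightarrow> B \<subseteq> Y"
    and m: "2 * m\<^sup>2 \<le> card Y" "0 < m"
  shows "\<exists>ys. length ys = m \<and> distinct ys \<and> set ys \<subseteq> Y \<and> (\<forall>i\<le>I. \<forall>B\<in>F i.
      real (hits B ys) \<le> 2 * (card B / card Y) * m + 2 * ln (6 * (real I + 1) * card (F i)) \<and>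
      (card B / card Y) * m \<le> 2 * real (hits B ys) + 2 * ln (6 * (real I + 1) * card (F i)))"
proof -
  define \<beta> where "\<beta> B = real (card B) / real (card Y)" for B :: "'a set"
  \<comment> \<open>The first summand has \<open>c = 2\<close> and \<open>s = - \<beta> B\<close>,
    the second \<open>c = 1/2\<close> and \<open>s = \<beta> B / 2\<close>. The condition on
    \<open>c\<close> and \<open>s\<close> is in both cases an instance of
    \<open>1 + x <= exp x\<close>.\<close>
  define W where "W B ys = 2 ^ hits B ys * exp (- \<beta> B * real (length ys))
     + (1/2) ^ hits B ys * exp (\<beta> B / 2 * real (length ys))" for B ys
  \<comment> \<open>Dividing by \<open>card (F i)\<close> lets every family start with the value 2,
    whatever its size. The term of a single set then exceeds the potential by at most the factor
    \<open>card (F i)\<close>, whose logarithm is the price in the conclusion.\<close>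
  define \<Phi> where "\<Phi> ys = (\<Sum>i\<le>I. (\<Sum>B\<in>F i. W B ys) / real (card (F i)))" for ys
  have Ypos: "real (card Y) > 0" using Y by (simp add: card_gt_0_iff)
  have W0: "W B ys \<ge> 0" for B ys by (simp add: W_def)
  have stepW: "(\<Sum>y\<in>Y. W B (y # ys)) \<le> card Y * W B ys" if "B \<subseteq> Y" for B ys
  proof -
    have "\<beta> B \<le> 1" using that Y Ypos by (simp add: \<beta>_def card_mono)
    moreover have "0 \<le> \<beta> B" by (simp add: \<beta>_def)
    moreover have "1 + \<beta> B \<le> exp (\<beta> B)" "1 + (- \<beta> B / 2) \<le> exp (- \<beta> B / 2)"
      by (rule exp_ge_add_one_self)+
    ultimately show ?thesis
      using sum_hits_weight[OF Y that, of 2 "- \<beta> B" ys] sum_hits_weight[OF Y that, of "1/2" "\<beta> B / 2" ys]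
      by (simp add: W_def sum.distrib \<beta>_def[symmetric] algebra_simps)
  qed
  have step\<Phi>: "(\<Sum>y\<in>Y. \<Phi> (y # ys)) \<le> card Y * \<Phi> ys" for ys
  proof -
    have "(\<Sum>y\<in>Y. \<Phi> (y # ys)) = (\<Sum>i\<le>I. (\<Sum>B\<in>F i. \<Sum>y\<in>Y. W B (y # ys)) / real (card (F i)))"
      unfolding \<Phi>_def by (subst sum.swap) (simp add: sum_divide_distrib[symmetric] sum.swap[of _ _ Y])
    also have "\<dots> \<le> (\<Sum>i\<le>I. (\<Sum>B\<in>F i. card Y * W B ys) / real (card (F i)))"
      using stepW F(2) by (intro sum_mono divide_right_mono) auto
    finally show ?thesis by (simp add: \<Phi>_def sum_distrib_left mult_ac sum_divide_distrib)
  qed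
  have \<Phi>0: "\<Phi> ys \<ge> 0" for ys unfolding \<Phi>_def by (intro sum_nonneg divide_nonneg_nonneg) (auto simp: W0)
  \<comment> \<open>Averaging over the points not yet used instead of all of \<open>Y\<close> costs
    a factor \<open>1 + 1 / m\<close> per step, because \<open>Y\<close> has at least
    \<open>2 * m ^ 2\<close> points. Over \<open>m\<close> steps this is at most
    \<open>exp 1 <= 3\<close> and turns the initial \<open>2 * (I + 1)\<close> into
    \<open>6 * (I + 1)\<close>.\<close>
  have build: "\<exists>ys. length ys = l \<and> distinct ys \<and> set ys \<subseteq> Y \<and> \<Phi> ys \<le> 2 * (real I + 1) * (1 + 1 / m) ^ l"
    if "l \<le> m" for l
    using that
  proof (induction l)
    case 0
    have "\<Phi> [] = (\<Sum>i\<le>I. 2)" unfolding \<Phi>_def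
      using F by (intro sum.cong) (auto simp: W_def hits_def card_gt_0_iff)
    then show ?case by (intro exI[of _ "[]"]) auto
  next
    case (Suc l)
    then obtain ys where ys: "length ys = l" "distinct ys" "set ys \<subseteq> Y"
      "\<Phi> ys \<le> 2 * (real I + 1) * (1 + 1 / m) ^ l" by auto
    let ?S = "Y - set ys"
    have cS: "real (card ?S) = real (card Y) - l"
      using ys Y by (subst card_Diff_subset) (auto simp: distinct_card of_nat_diff card_mono
          dest: card_mono[of Y "set ys"])
    have "real m * (real m + 1) \<le> 2 * (real m)\<^sup>2" using m(2) by (simp add: power2_eq_square algebra_simps)
    also have "\<dots> \<le> real (card Y)" using of_nat_mono[OF m(1), where 'a = real] by simp
    finally have mY: "real m * (real m + 1) \<le> real (card Y)" .
    have lm: "real l + 1 \<le> real m" using Suc.prems by simp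
    have "m \<le> real m * (real m + 1)" using m(2) by (simp add: algebra_simps)
    then have Spos: "real (card ?S) > 0" using mY cS lm by linarith
    have r: "real (card Y) \<le> (1 + 1 / m) * real (card ?S)"
    proof -
      have "(real l) * (real m + 1) \<le> real m * (real m + 1)" using lm by (intro mult_right_mono) auto
      then have "real (card Y) * m \<le> (real m + 1) * (real (card Y) - l)"
        using mY by (simp add: algebra_simps)
      then show ?thesis using m(2) unfolding cS by (simp add: field_simps)
    qed
    have "(\<Sum>y\<in>?S. 1 * \<Phi> (y # ys)) \<le> (\<Sum>y\<in>Y. \<Phi> (y # ys))"
      using Y \<Phi>0 by simp (intro sum_mono2, auto)
    also have "\<dots> \<le> card Y * \<Phi> ys" by (rule step\<Phi>)
    also have "\<dots> \<le> ((1 + 1 / m) * real (card ?S)) * (2 * (real I + 1) * (1 + 1 / m) ^ l)"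
      using r ys(4) \<Phi>0 by (intro mult_mono) auto
    also have "\<dots> = 2 * (real I + 1) * (1 + 1 / m) ^ Suc l * sum (\<lambda>_. 1) ?S" by simp
    finally obtain y where "y \<in> ?S" "\<Phi> (y # ys) \<le> 2 * (real I + 1) * (1 + 1 / m) ^ Suc l"
      using exists_le_weighted_mean[of ?S "\<lambda>_. 1"] Y Spos by auto
    then show ?case using ys by (intro exI[of _ "y # ys"]) auto
  qed
  obtain ys where ys: "length ys = m" "distinct ys" "set ys \<subseteq> Y" "\<Phi> ys \<le> 2 * (real I + 1) * (1 + 1 / m) ^ m"
    using build[of m] by auto
  have "(1 + 1 / real m) ^ m \<le> exp (1 / real m) ^ m"
    by (intro power_mono) auto
  also have "\<dots> = exp 1" using m(2) by (simp flip: exp_of_nat_mult)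
  also have "\<dots> \<le> 3" by (rule exp_le)
  finally have "(1 + 1 / real m) ^ m \<le> 3" .
  then have "2 * (real I + 1) * (1 + 1 / m) ^ m \<le> 2 * (real I + 1) * 3" by (intro mult_left_mono) auto
  then have \<Phi>ys: "\<Phi> ys \<le> 6 * (real I + 1)" using ys(4) by simp
  have "real (hits B ys) \<le> 2 * \<beta> B * m + 2 * ln (6 * (real I + 1) * card (F i)) \<and>
      \<beta> B * m \<le> 2 * real (hits B ys) + 2 * ln (6 * (real I + 1) * card (F i))"
    if i: "i \<le> I" and B: "B \<in> F i" for i B
  proof -
    let ?P = "6 * (real I + 1) * card (F i)"
    have cF: "real (card (F i)) > 0" using F(1)[OF i] by (simp add: card_gt_0_iff)
    have Ppos: "?P > 0" using cF by simp
    have "W B ys / real (card (F i)) \<le> (\<Sum>B\<in>F i. W B ys) / real (card (F i))"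
      using F(1)[OF i] B W0 by (intro divide_right_mono member_le_sum) auto
    also have "\<dots> \<le> \<Phi> ys" unfolding \<Phi>_def using i
      by (intro member_le_sum[of i "{..I}" "\<lambda>i. (\<Sum>B\<in>F i. W B ys) / real (card (F i))"])
         (auto intro!: divide_nonneg_nonneg sum_nonneg W0)
    finally have "W B ys / real (card (F i)) \<le> 6 * (real I + 1)" using \<Phi>ys by linarith
    then have "W B ys \<le> ?P" using cF by (simp only: pos_divide_le_eq)
    moreover have p1: "2 ^ hits B ys * exp (- \<beta> B * m) \<ge> (0::real)"
      "(1/2) ^ hits B ys * exp (\<beta> B / 2 * m) \<ge> (0::real)" by auto
    ultimately have "2 ^ hits B ys * exp (- \<beta> B * m) \<le> ?P" "(1/2) ^ hits B ys * exp (\<beta> B / 2 * m) \<le> ?P"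
      unfolding W_def ys(1) by linarith+
    then have "ln (2 ^ hits B ys * exp (- \<beta> B * m)) \<le> ln ?P" "ln ((1/2) ^ hits B ys * exp (\<beta> B / 2 * m)) \<le> ln ?P"
      using Ppos by (subst ln_le_cancel_iff; simp)+
    then have "real (hits B ys) * ln 2 - \<beta> B * m \<le> ln ?P" "- (real (hits B ys) * ln 2) + \<beta> B / 2 * m \<le> ln ?P"
      by (simp_all add: ln_mult ln_realpow ln_div)
    moreover have "real (hits B ys) * (1/2) \<le> real (hits B ys) * ln 2" "real (hits B ys) * ln 2 \<le> real (hits B ys) * 1"
      using ln2_ge_two_thirds ln_2_less_1 by (intro mult_left_mono; simp)+
    ultimately show ?thesis by (simp add: algebra_simps)
  qed
  then show ?thesis using ys unfolding \<beta>_def by blast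
qed

section \<open>Maurey's method with the four units as multipliers\<close>

abbreviation units4 :: "complex set" where "units4 \<equiv> {1, -1, \<i>, -\<i>}"

lemma sum_units4: "(\<Sum>z\<in>units4. h z) = h 1 + h (-1) + h \<i> + h (-\<i>)"
  for h :: "complex \<Rightarrow> 'b::comm_monoid_add"
  by (simp add: complex_eq_iff add.assoc)

lemma exp_le_quadratic:
  fixes s :: real assumes "\<bar>s\<bar> \<le> 1" shows "exp s \<le> 1 + s + s\<^sup>2"
proof (cases "0 \<le> s")
  case True
  then show ?thesis using assms exp_bound[of s] by simp
next
  case False
  \<comment> \<open>For negative \<open>s\<close> the Taylor bound is available from below for
    \<open>exp (- s)\<close> and has to be inverted: it suffices that its product with
    \<open>1 + s + s ^ 2\<close> is at least 1.\<close>
  have 1: "1 + (-s) + (-s)\<^sup>2 / 2 \<le> exp (-s)" using False by (intro exp_lower_Taylor_quadratic) auto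
  have pos: "0 < 1 + (-s) + (-s)\<^sup>2 / 2" using False zero_le_power2[of s] by (simp add: add_pos_nonneg)
  have "(1 + s + s\<^sup>2) * (1 + (-s) + (-s)\<^sup>2 / 2) = 1 + s\<^sup>2 / 2 - s^3 / 2 + s^4 / 2"
    by (simp add: field_simps power2_eq_square power3_eq_cube power4_eq_xxxx)
  moreover have "s^3 \<le> 0" using False by (simp add: power_le_zero_eq)
  moreover have "0 \<le> s\<^sup>2" "0 \<le> s^4" by auto
  ultimately have "1 \<le> (1 + s + s\<^sup>2) * (1 + (-s) + (-s)\<^sup>2 / 2)" by linarith
  moreover have "0 \<le> 1 + s + s\<^sup>2" using assms zero_le_power2[of s] by linarith
  ultimately have "1 \<le> (1 + s + s\<^sup>2) * exp (-s)"
    by (meson 1 mult_left_mono order_trans)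
  then show ?thesis by (simp add: exp_minus field_simps)
qed

text \<open>With weights \<open>(|x| + Re (x cnj z)) / 4\<close> on the four units, a complex number \<open>x\<close> is
  \<open>2 |x|\<close> times the mean of \<open>z\<close>.\<close>

definition unit_weight :: "complex \<Rightarrow> complex \<Rightarrow> real" where
  "unit_weight x z = (norm x + Re (x * cnj z)) / 4"

lemma unit_weight_nonneg: "norm z = 1 \<Longrightarrow> 0 \<le> unit_weight x z"
  using abs_Re_le_cmod[of "x * cnj z"] by (simp add: unit_weight_def norm_mult)

lemma sum_unit_weight: "(\<Sum>z\<in>units4. unit_weight x z) = norm x"
  unfolding sum_units4 by (simp add: unit_weight_def field_simps)

lemma sum_unit_weight_mult: "(\<Sum>z\<in>units4. of_real (unit_weight x z) * z) = x / 2"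
  unfolding sum_units4 by (simp add: unit_weight_def complex_eq_iff field_simps)

text \<open>The variable \<open>Re (cnj z * (\<alpha> a - \<mu>))\<close> is centred and bounded by
  2, so the linear term of the exponential averages out and only the quadratic term
  \<open>(2 * \<theta>) ^ 2\<close> is left.\<close>

lemma exp_moment_step:
  fixes p :: "'a \<Rightarrow> real" and \<alpha> :: "'a \<Rightarrow> complex"
  assumes "finite A" "\<And>a. a \<in> A \<Longrightarrow> 0 \<le> p a" "sum p A = 1"
    and "(\<Sum>a\<in>A. of_real (p a) * \<alpha> a) = \<mu>"
    and "\<And>a. a \<in> A \<Longrightarrow> norm (\<alpha> a) \<le> 1" "norm \<mu> \<le> 1" "norm z = 1" "0 \<le> \<theta>" "2 * \<theta> \<le> 1"
  shows "(\<Sum>a\<in>A. p a * exp (\<theta> * Re (cnj z * (\<alpha> a - \<mu>)))) \<le> exp (4 * \<theta>\<^sup>2)"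
proof -
  have s: "\<bar>\<theta> * Re (cnj z * (\<alpha> a - \<mu>))\<bar> \<le> 2 * \<theta>" if "a \<in> A" for a
  proof -
    have "\<bar>Re (cnj z * (\<alpha> a - \<mu>))\<bar> \<le> norm (cnj z * (\<alpha> a - \<mu>))" by (rule abs_Re_le_cmod)
    also have "\<dots> \<le> norm (\<alpha> a) + norm \<mu>" using assms(7) by (simp add: norm_mult norm_triangle_ineq4)
    also have "\<dots> \<le> 2" using assms(5)[OF that] assms(6) by simp
    finally show ?thesis using assms(8) by (simp add: abs_mult mult.commute[of 2] mult_left_mono)
  qed
  have "(\<Sum>a\<in>A. p a * exp (\<theta> * Re (cnj z * (\<alpha> a - \<mu>))))
      \<le> (\<Sum>a\<in>A. p a * (1 + \<theta> * Re (cnj z * (\<alpha> a - \<mu>)) + 4 * \<theta>\<^sup>2))"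
  proof (intro sum_mono mult_left_mono assms)
    fix a assume a: "a \<in> A"
    have "exp (\<theta> * Re (cnj z * (\<alpha> a - \<mu>)))
        \<le> 1 + \<theta> * Re (cnj z * (\<alpha> a - \<mu>)) + (\<theta> * Re (cnj z * (\<alpha> a - \<mu>)))\<^sup>2"
      using s[OF a] assms(9) by (intro exp_le_quadratic) linarith
    also have "(\<theta> * Re (cnj z * (\<alpha> a - \<mu>)))\<^sup>2 \<le> (2 * \<theta>)\<^sup>2"
      using s[OF a] assms(8) by (intro power2_le_iff_abs_le[THEN iffD2]) auto
    finally show "exp (\<theta> * Re (cnj z * (\<alpha> a - \<mu>))) \<le> 1 + \<theta> * Re (cnj z * (\<alpha> a - \<mu>)) + 4 * \<theta>\<^sup>2"
      by (simp add: power_mult_distrib)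
  qed
  also have "\<dots> = 1 + 4 * \<theta>\<^sup>2 + \<theta> * Re (cnj z * ((\<Sum>a\<in>A. of_real (p a) * \<alpha> a) - of_real (sum p A) * \<mu>))"
  proof -
    have "Re (cnj z * ((\<Sum>a\<in>A. of_real (p a) * \<alpha> a) - of_real (sum p A) * \<mu>))
      = Re (\<Sum>a\<in>A. of_real (p a) * (cnj z * (\<alpha> a - \<mu>)))"
      by (simp add: sum_subtractf[symmetric] sum_distrib_left sum_distrib_right algebra_simps)
    also have "\<dots> = (\<Sum>a\<in>A. p a * Re (cnj z * (\<alpha> a - \<mu>)))" by (simp only: Re_sum Re_complex_of_real times_complex.sel Im_complex_of_real mult_zero_left diff_zero)
    finally show ?thesis using assms(3)
      by (simp add: distrib_left sum.distrib sum_distrib_left mult_ac flip: sum_distrib_right)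
  qed
  also have "\<dots> = 1 + 4 * \<theta>\<^sup>2" using assms(3,4) by simp
  also have "\<dots> \<le> exp (4 * \<theta>\<^sup>2)" by (rule exp_ge_add_one_self)
  finally show ?thesis .
qed

definition signed_sum :: "('k \<Rightarrow> 'a \<Rightarrow> complex) \<Rightarrow> ('k \<times> complex) list \<Rightarrow> 'a \<Rightarrow> complex" where
  "signed_sum \<phi> as y = (\<Sum>(k, z)\<leftarrow>as. z * \<phi> k y)"

text \<open>Maurey's empirical method, derandomised: the terms are picked greedily.\<close>

lemma maurey:
  fixes \<phi> :: "'k \<Rightarrow> 'a \<Rightarrow> complex" and x :: "'k \<Rightarrow> complex"
  assumes Q: "finite Q" and Y: "finite Y" "Y \<noteq> {}"
    and \<phi>: "\<And>k y. k \<in> Q \<Longrightarrow> y \<in> Y \<Longrightarrow> norm (\<phi> k y) \<le> 1"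
    and x: "(\<Sum>k\<in>Q. norm (x k)) = 1" and \<epsilon>: "0 < \<epsilon>" "\<epsilon> \<le> 1"
    and n: "256 * ln (4 * real (card Y)) / \<epsilon>\<^sup>2 \<le> real n"
  shows "\<exists>as. length as = n \<and> set as \<subseteq> Q \<times> units4 \<and>
    (\<forall>y\<in>Y. norm ((\<Sum>k\<in>Q. x k * \<phi> k y) - 2 / of_nat n * signed_sum \<phi> as y) \<le> \<epsilon>)"
proof -
  define f where "f y = (\<Sum>k\<in>Q. x k * \<phi> k y)" for y
  \<comment> \<open>This choice balances the final estimate: \<open>ln (4 * card Y)\<close> is at
    most \<open>n * \<epsilon> ^ 2 / 256\<close> by hypothesis, and
    \<open>4 * \<theta> ^ 2 * n\<close> equals that value; the two bounds add up to exactly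
    \<open>\<theta> * (n * \<epsilon> / 4)\<close>.\<close>
  define \<theta> where "\<theta> = \<epsilon> / 32"
  \<comment> \<open>The real parts against the four units are \<open>Re\<close>,
    \<open>- Re\<close>, \<open>Im\<close> and \<open>- Im\<close> of the deviation, so a bound on
    the sum over \<open>units4\<close> controls its modulus. The deviation is measured from
    \<open>f y / 2\<close> because a single term has this mean, which is also why the approximant
    carries the factor \<open>2 / n\<close>.\<close>
  define \<Phi> where "\<Phi> as = (\<Sum>y\<in>Y. \<Sum>z\<in>units4.
     exp (\<theta> * Re (cnj z * (signed_sum \<phi> as y - of_nat (length as) * (f y / 2)))))" for as
  have cY: "real (card Y) \<ge> 1" using Y by (metis One_nat_def Suc_leI card_gt_0_iff of_nat_1 of_nat_le_iff)
  have lnY: "ln (4 * real (card Y)) > 0" using cY by simp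
  have npos: "real n > 0" 
  proof -
    have "0 < 256 * ln (4 * real (card Y)) / \<epsilon>\<^sup>2" using lnY \<epsilon> by (intro divide_pos_pos) auto
    then show ?thesis using n by linarith
  qed
  define A where "A = Q \<times> units4"
  define p where "p a = unit_weight (x (fst a)) (snd a)" for a
  have A: "finite A" using Q by (simp add: A_def)
  have p0: "0 \<le> p a" if "a \<in> A" for a using that unit_weight_nonneg by (auto simp: A_def p_def)
  have sum_A: "sum h A = (\<Sum>k\<in>Q. \<Sum>z\<in>units4. h (k, z))" for h :: "_ \<Rightarrow> 'c::comm_monoid_add"
    by (simp only: A_def sum.cartesian_product case_prod_eta)
  have p1: "sum p A = 1" unfolding sum_A p_def fst_conv snd_conv sum_unit_weight by (rule x)
  have mean: "(\<Sum>a\<in>A. of_real (p a) * (snd a * \<phi> (fst a) y)) = f y / 2" for y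
  proof -
    have "(\<Sum>a\<in>A. of_real (p a) * (snd a * \<phi> (fst a) y))
      = (\<Sum>k\<in>Q. (\<Sum>z\<in>units4. of_real (unit_weight (x k) z) * z) * \<phi> k y)"
      unfolding sum_A p_def fst_conv snd_conv by (simp only: sum_distrib_right mult.assoc)
    then show ?thesis unfolding sum_unit_weight_mult f_def by (simp add: sum_divide_distrib)
  qed
  have fy: "norm (f y) \<le> 1" if "y \<in> Y" for y
  proof -
    have "norm (f y) \<le> (\<Sum>k\<in>Q. norm (x k) * 1)" unfolding f_def
      using \<phi> that by (intro sum_norm_le) (simp add: norm_mult mult_left_le)
    then show ?thesis using x by simp
  qed
  have cons: "signed_sum \<phi> (a # as) y = snd a * \<phi> (fst a) y + signed_sum \<phi> as y" for a as y
    by (simp add: signed_sum_def case_prod_beta)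
  have step: "(\<Sum>a\<in>A. p a * \<Phi> (a # as)) \<le> exp (4 * \<theta>\<^sup>2) * \<Phi> as" for as
  proof -
    define e where "e y z = exp (\<theta> * Re (cnj z * (signed_sum \<phi> as y - of_nat (length as) * (f y / 2))))" for y z
    have "\<Phi> (a # as) = (\<Sum>y\<in>Y. \<Sum>z\<in>units4.
        e y z * exp (\<theta> * Re (cnj z * (snd a * \<phi> (fst a) y - f y / 2))))" for a
    proof -
      have "cnj z * (signed_sum \<phi> (a # as) y - of_nat (length (a # as)) * (f y / 2))
          = cnj z * (signed_sum \<phi> as y - of_nat (length as) * (f y / 2))
            + cnj z * (snd a * \<phi> (fst a) y - f y / 2)" for y z
        by (simp add: cons algebra_simps)
      then show ?thesis unfolding \<Phi>_def e_def by (simp only: plus_complex.sel distrib_left exp_add)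
    qed
    then have "(\<Sum>a\<in>A. p a * \<Phi> (a # as)) = (\<Sum>a\<in>A. \<Sum>y\<in>Y. \<Sum>z\<in>units4.
        e y z * (p a * exp (\<theta> * Re (cnj z * (snd a * \<phi> (fst a) y - f y / 2)))))"
      by (simp only: sum_distrib_left mult_ac)
    also have "\<dots> = (\<Sum>y\<in>Y. \<Sum>a\<in>A. \<Sum>z\<in>units4.
        e y z * (p a * exp (\<theta> * Re (cnj z * (snd a * \<phi> (fst a) y - f y / 2)))))" by (rule sum.swap)
    also have "\<dots> = (\<Sum>y\<in>Y. \<Sum>z\<in>units4. \<Sum>a\<in>A.
        e y z * (p a * exp (\<theta> * Re (cnj z * (snd a * \<phi> (fst a) y - f y / 2)))))"
      by (intro sum.cong refl sum.swap)
    also have "\<dots> = (\<Sum>y\<in>Y. \<Sum>z\<in>units4. e y z *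
        (\<Sum>a\<in>A. p a * exp (\<theta> * Re (cnj z * (snd a * \<phi> (fst a) y - f y / 2)))))"
      by (simp only: sum_distrib_left)
    also have "\<dots> \<le> (\<Sum>y\<in>Y. \<Sum>z\<in>units4. e y z * exp (4 * \<theta>\<^sup>2))"
    proof (intro sum_mono mult_left_mono exp_moment_step A p0 p1 mean)
      fix y z a assume *: "y \<in> Y" "z \<in> units4"
      show "norm z = 1" "0 \<le> e y z" using * by (auto simp: e_def)
      show "norm (f y / 2) \<le> 1" using fy[OF *(1)] by (simp add: norm_divide)
      show "norm (snd a * \<phi> (fst a) y) \<le> 1" if "a \<in> A"
        using that \<phi>[OF _ *(1)] by (auto simp: A_def norm_mult)
    qed (use \<epsilon> in \<open>auto simp: \<theta>_def\<close>)
    also have "\<dots> = exp (4 * \<theta>\<^sup>2) * \<Phi> as"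
      by (simp only: \<Phi>_def e_def sum_distrib_left mult.commute)
    finally show ?thesis .
  qed
  have build: "\<exists>as. length as = l \<and> set as \<subseteq> A \<and> \<Phi> as \<le> 4 * real (card Y) * exp (4 * \<theta>\<^sup>2 * real l)" for l
  proof (induction l)
    case 0
    have "\<Phi> [] = 4 * real (card Y)" unfolding \<Phi>_def sum_units4 by (simp add: signed_sum_def)
    then show ?case by (intro exI[of _ "[]"]) simp
  next
    case (Suc l)
    then obtain as where as: "length as = l" "set as \<subseteq> A" "\<Phi> as \<le> 4 * real (card Y) * exp (4 * \<theta>\<^sup>2 * real l)"
      by blast
    have "(\<Sum>a\<in>A. p a * \<Phi> (a # as)) \<le> exp (4 * \<theta>\<^sup>2) * (4 * real (card Y) * exp (4 * \<theta>\<^sup>2 * real l))"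
      using step as(3) by (meson exp_ge_zero mult_left_mono order_trans)
    also have "\<dots> = 4 * real (card Y) * exp (4 * \<theta>\<^sup>2 * real (Suc l)) * sum p A"
      unfolding p1 by (simp add: exp_add[symmetric] algebra_simps)
    finally have le: "(\<Sum>a\<in>A. p a * \<Phi> (a # as)) \<le> 4 * real (card Y) * exp (4 * \<theta>\<^sup>2 * real (Suc l)) * sum p A" .
    have "\<exists>a\<in>A. \<Phi> (a # as) \<le> 4 * real (card Y) * exp (4 * \<theta>\<^sup>2 * real (Suc l))"
      by (rule exists_le_weighted_mean[OF A p0 _ le]) (simp_all add: p1)
    then obtain a where "a \<in> A" "\<Phi> (a # as) \<le> 4 * real (card Y) * exp (4 * \<theta>\<^sup>2 * real (Suc l))"
      by blast
    then show ?case using as by (intro exI[of _ "a # as"]) auto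
  qed
  obtain as where as: "length as = n" "set as \<subseteq> A" "\<Phi> as \<le> 4 * real (card Y) * exp (4 * \<theta>\<^sup>2 * real n)"
    using build by blast
  have close: "norm (f y - 2 / of_nat n * signed_sum \<phi> as y) \<le> \<epsilon>" if y: "y \<in> Y" for y
  proof -
    define d where "d = signed_sum \<phi> as y - of_nat n * (f y / 2)"
    have Re_d: "Re (cnj z * d) \<le> real n * \<epsilon> / 4" if z: "z \<in> units4" for z
    proof -
      have "exp (\<theta> * Re (cnj z * d)) \<le> (\<Sum>z\<in>units4. exp (\<theta> * Re (cnj z * d)))"
        using z by (intro member_le_sum[of z units4 "\<lambda>z. exp (\<theta> * Re (cnj z * d))"]) auto
      also have "\<dots> \<le> \<Phi> as" unfolding \<Phi>_def d_def as(1)[symmetric] using y Y(1)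
        by (intro member_le_sum[of y Y "\<lambda>y. \<Sum>z\<in>units4. exp (\<theta> * Re (cnj z * (signed_sum \<phi> as y - of_nat (length as) * (f y / 2))))"])
           (auto intro!: sum_nonneg)
      also have "\<dots> \<le> exp (ln (4 * real (card Y)) + 4 * \<theta>\<^sup>2 * real n)"
        using as(3) cY by (simp add: exp_add)
      finally have "\<theta> * Re (cnj z * d) \<le> ln (4 * real (card Y)) + 4 * \<theta>\<^sup>2 * real n" by simp
      also have "ln (4 * real (card Y)) \<le> real n * \<epsilon>\<^sup>2 / 256" using n \<epsilon> by (simp add: field_simps)
      finally have "\<theta> * Re (cnj z * d) \<le> \<theta> * (real n * \<epsilon> / 4)"
        by (simp add: \<theta>_def power2_eq_square field_simps)
      then show ?thesis using \<epsilon> by (simp add: \<theta>_def)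
    qed
    have "\<bar>Re d\<bar> \<le> real n * \<epsilon> / 4" "\<bar>Im d\<bar> \<le> real n * \<epsilon> / 4"
      using Re_d[of 1] Re_d[of "-1"] Re_d[of \<i>] Re_d[of "-\<i>"] by (auto simp: abs_le_iff)
    then have "norm d \<le> real n * \<epsilon> / 2" using cmod_le[of d] by linarith
    moreover have "f y - 2 / of_nat n * signed_sum \<phi> as y = - (2 / of_nat n * d)"
      using npos by (simp add: d_def field_simps)
    ultimately show ?thesis using npos
      by (simp only: norm_minus_cancel norm_mult norm_divide) (simp add: field_simps)
  qed
  show ?thesis using as close unfolding A_def f_def by blast
qed

section \<open>Level sets and the two-sided comparison\<close>

lemma sum_dyadic_below:
  fixes s :: real assumes "0 \<le> s"
  shows "(\<Sum>i\<le>I. if (1/2) ^ i < s then (1/4) ^ i else 0) \<le> 2 * s\<^sup>2"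
proof -
  \<comment> \<open>The subtracted term is what makes the induction on \<open>d\<close>
    close.\<close>
  have *: "(\<Sum>i\<in>{n..n+d}. (1/4::real) ^ i) \<le> 2 * (1/4) ^ n - (1/4) ^ (n+d) / 3" for n d
  proof (induction d)
    case (Suc d)
    define q where "q = (1/4::real) ^ (n + d)"
    have "(\<Sum>i\<in>{n..n + Suc d}. (1/4::real) ^ i) = (\<Sum>i\<in>{n..n+d}. (1/4) ^ i) + q / 4"
      by (simp add: q_def)
    moreover have "(1/4) ^ (n + Suc d) = q / 4" "q \<ge> 0" by (simp_all add: q_def)
    ultimately show ?case using Suc unfolding q_def[symmetric] by linarith
  qed simp
  show ?thesis
  proof (cases "\<exists>i. (1/2) ^ i < s")
    case True
    define n where "n = (LEAST i. (1/2) ^ i < s)"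
    have n: "(1/2) ^ n < s" unfolding n_def using True by (rule LeastI_ex)
    have ge: "n \<le> i" if "(1/2) ^ i < s" for i unfolding n_def using that by (rule Least_le)
    have "(\<Sum>i\<le>I. if (1/2) ^ i < s then (1/4) ^ i else 0) \<le> (\<Sum>i\<in>{n..n+I}. (1/4::real) ^ i)"
      unfolding sum.inter_filter[OF finite_atMost, symmetric]
      by (rule sum_mono2) (auto dest: ge)
    also have "\<dots> \<le> 2 * ((1/2) ^ n)\<^sup>2"
    proof -
      have "((1/2) ^ n)\<^sup>2 = (1/4 :: real) ^ n" by (simp add: power2_eq_square flip: power_mult_distrib)
      moreover have "0 \<le> (1/4 :: real) ^ (n + I)" by simp
      ultimately show ?thesis using *[of n I] by linarith
    qed
    also have "\<dots> \<le> 2 * s\<^sup>2" using n by (intro mult_left_mono power_mono) auto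
    finally show ?thesis .
  qed (simp add: sum.neutral)
qed

text \<open>The weights \<open>(1/4) ^ i\<close> of the levels below \<open>s\<close> add up to
  about \<open>s ^ 2\<close>. The flags \<open>b i\<close> are left free when \<open>s\<close> lies
  between \<open>(1/2) ^ i\<close> and \<open>2 * (1/2) ^ i\<close>: this slack allows exact level
  sets to be replaced by those of an approximant, and it costs only constants. Stopping at level
  \<open>I\<close> leaves the error \<open>4 * (1/4) ^ I\<close>.\<close>

lemma dyadic_layer_cake:
  fixes s :: real and b :: "nat \<Rightarrow> bool"
  assumes s: "0 \<le> s" "s \<le> 1"
    and b: "\<And>i. i \<le> I \<Longrightarrow> 2 * (1/2) ^ i < s \<Longrightarrow> b i" "\<And>i. i \<le> I \<Longrightarrow> b i \<Longrightarrow> (1/2) ^ i < s"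
  shows "(\<Sum>i\<le>I. (1/4) ^ i * of_bool (b i)) \<le> 2 * s\<^sup>2"
    and "s\<^sup>2 \<le> 16 * (\<Sum>i\<le>I. (1/4) ^ i * of_bool (b i)) + 4 * (1/4) ^ I"
proof -
  have "(\<Sum>i\<le>I. (1/4 :: real) ^ i * of_bool (b i)) \<le> (\<Sum>i\<le>I. if (1/2) ^ i < s then (1/4) ^ i else 0)"
    by (intro sum_mono) (auto dest: b(2))
  also have "\<dots> \<le> 2 * s\<^sup>2" using s(1) by (rule sum_dyadic_below)
  finally show "(\<Sum>i\<le>I. (1/4) ^ i * of_bool (b i)) \<le> 2 * s\<^sup>2" .
  have nn: "0 \<le> (\<Sum>i\<le>I. (1/4) ^ i * of_bool (b i) :: real)" by (intro sum_nonneg) auto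
  have sq: "((1/2) ^ i)\<^sup>2 = (1/4 :: real) ^ i" for i
    by (simp add: power2_eq_square flip: power_mult_distrib)
  show "s\<^sup>2 \<le> 16 * (\<Sum>i\<le>I. (1/4) ^ i * of_bool (b i)) + 4 * (1/4) ^ I"
  proof (cases "s \<le> 2 * (1/2) ^ I")
    case True
    then have "s\<^sup>2 \<le> (2 * (1/2) ^ I)\<^sup>2" using s(1) by (rule power_mono)
    then show ?thesis unfolding power_mult_distrib sq using nn by simp
  next
    case False
    define n where "n = (LEAST i. 2 * (1/2) ^ i < s)"
    have n: "2 * (1/2) ^ n < s" unfolding n_def by (rule LeastI[where k = I]) (use False in simp)
    have nI: "n \<le> I" unfolding n_def by (rule Least_le) (use False in simp)
    have n0: "n \<noteq> 0" using n s(2) by (cases n) auto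
    then have "\<not> 2 * (1/2) ^ (n - 1) < s" unfolding n_def using not_less_Least[of "n - 1" "\<lambda>i. 2 * (1/2) ^ i < s"]
      by (simp add: n_def)
    then have "s \<le> 4 * (1/2) ^ n" using n0 by (cases n) auto
    then have "s\<^sup>2 \<le> (4 * (1/2) ^ n)\<^sup>2" using s(1) by (rule power_mono)
    also have "\<dots> = 16 * ((1/4) ^ n * of_bool (b n))" unfolding power_mult_distrib sq using b(1)[OF nI n] by simp
    also have "(1/4) ^ n * of_bool (b n) \<le> (\<Sum>i\<le>I. (1/4) ^ i * of_bool (b i) :: real)"
      using nI by (intro member_le_sum[of n "{..I}" "\<lambda>i. (1/4) ^ i * of_bool (b i)"]) auto
    finally have "s\<^sup>2 \<le> 16 * (\<Sum>i\<le>I. (1/4) ^ i * of_bool (b i))" by simp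
    moreover have "0 \<le> 4 * (1/4 :: real) ^ I" by simp
    ultimately show ?thesis by linarith
  qed
qed

lemma hits_eq_sum: "distinct ys \<Longrightarrow> real (hits B ys) = (\<Sum>y\<in>set ys. of_bool (y \<in> B))"
  by (simp add: hits_def distinct_length_filter Int_def conj_commute)

lemma sampled_isometry:
  fixes \<phi> :: "'k \<Rightarrow> 'a \<Rightarrow> complex"
  assumes Q: "finite Q" "Q \<noteq> {}" and Y: "finite Y" "Y \<noteq> {}"
    and \<phi>: "\<And>k y. k \<in> Q \<Longrightarrow> y \<in> Y \<Longrightarrow> norm (\<phi> k y) \<le> 1"
    and orth: "\<And>x. (\<Sum>y\<in>Y. (norm (\<Sum>k\<in>Q. x k * \<phi> k y))\<^sup>2) = real (card Y) * (\<Sum>k\<in>Q. (norm (x k))\<^sup>2)"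
    and K: "0 < K" "K \<le> 4 ^ I" and m: "2 * m\<^sup>2 \<le> card Y"
    and mK: "3200 * K * (real I + 1) * ln (4 * real (card Y)) * ln (4 * real (card Q)) \<le> real m"
  shows "\<exists>ys. length ys = m \<and> distinct ys \<and> set ys \<subseteq> Y \<and> (\<forall>x.
      (\<Sum>y\<in>set ys. (norm (\<Sum>k\<in>Q. x k * \<phi> k y))\<^sup>2) / m
        \<le> 64 * (\<Sum>k\<in>Q. (norm (x k))\<^sup>2) + 20 * (\<Sum>k\<in>Q. norm (x k))\<^sup>2 / K \<and>
      (\<Sum>k\<in>Q. (norm (x k))\<^sup>2)
        \<le> 64 * ((\<Sum>y\<in>set ys. (norm (\<Sum>k\<in>Q. x k * \<phi> k y))\<^sup>2) / m) + 20 * (\<Sum>k\<in>Q. norm (x k))\<^sup>2 / K)"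
proof -
  define LY where "LY = ln (4 * real (card Y))"
  define LQ where "LQ = ln (4 * real (card Q))"
  have cY: "real (card Y) \<ge> 1" using Y by (metis One_nat_def Suc_leI card_gt_0_iff of_nat_1 of_nat_le_iff)
  have cQ: "real (card Q) \<ge> 1" using Q by (metis One_nat_def Suc_leI card_gt_0_iff of_nat_1 of_nat_le_iff)
  have ln4: "1 \<le> ln (4::real)" using exp_le by (subst ln_ge_iff) auto
  then have LY: "1 \<le> LY" using cY unfolding LY_def by (smt (verit) ln_le_cancel_iff)
  have LQ: "1 \<le> LQ" using ln4 cQ unfolding LQ_def by (smt (verit) ln_le_cancel_iff)
  have "0 < 3200 * K * (real I + 1) * LY * LQ" using K(1) LY LQ by (intro mult_pos_pos) auto
  then have m0: "0 < m" using mK unfolding LY_def LQ_def by (meson less_le_trans of_nat_0_less_iff)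
  \<comment> \<open>The length that Maurey's method needs for the accuracy
    \<open>(1/2) ^ i / 2\<close>, since
    \<open>256 / ((1/2) ^ i / 2) ^ 2 = 1024 * 4 ^ i\<close>.\<close>
  define n where "n i = nat \<lceil>1024 * 4 ^ i * LY\<rceil>" for i :: nat
  have n_ge: "1024 * 4 ^ i * LY \<le> real (n i)" for i unfolding n_def by (rule real_nat_ceiling_ge)
  have n_le: "real (n i) \<le> 1025 * 4 ^ i * LY" for i
  proof -
    have "1 * 1 \<le> 4 ^ i * LY" using LY by (intro mult_mono) auto
    moreover have "real (n i) \<le> 1024 * 4 ^ i * LY + 1"
    proof -
      have "0 \<le> 1024 * 4 ^ i * LY" using LY by simp
      then show ?thesis unfolding n_def using of_int_ceiling_le_add_one[of "1024 * 4 ^ i * LY"] by simp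
    qed
    ultimately show ?thesis by linarith
  qed
  \<comment> \<open>The threshold \<open>3/2 * (1/2) ^ i\<close> is half a level away from both
    \<open>(1/2) ^ i\<close> and \<open>2 * (1/2) ^ i\<close>, so an approximation error of
    \<open>(1/2) ^ i / 2\<close> is just tolerated on either side. The sets depend on the list only;
    hence all coefficient vectors share the finite families \<open>F i\<close>.\<close>
  define B where "B i as = {y\<in>Y. 3/2 * (1/2) ^ i < norm (2 / of_nat (n i) * signed_sum \<phi> as y)}" for i as
  define F where "F i = B i ` {as. set as \<subseteq> Q \<times> units4 \<and> length as = n i}" for i
  have fin: "finite {as. set as \<subseteq> Q \<times> units4 \<and> length as = n i}" for i
    using Q by (intro finite_lists_length_eq) auto
  have card_alph: "card (Q \<times> units4) = 4 * card Q"
    using sum_units4[of "\<lambda>_. 1 :: nat"] by (simp add: card_cartesian_product)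
  have card_F: "card (F i) \<le> (4 * card Q) ^ n i" for i
    unfolding F_def using card_image_le[OF fin, of "B i" i] card_lists_length_eq[of "Q \<times> units4" "n i"] Q
    by (simp add: card_alph)
  obtain k0 where "k0 \<in> Q" using Q by auto
  then have F_ne: "F i \<noteq> {}" for i
    by (auto simp: F_def intro!: exI[of _ "replicate (n i) (k0, 1)"])
  have F: "finite (F i) \<and> F i \<noteq> {}" for i using F_ne fin by (simp add: F_def)
  have F_sub: "i \<le> I \<Longrightarrow> C \<in> F i \<Longrightarrow> C \<subseteq> Y" for i C by (auto simp: F_def B_def)
  have "\<exists>ys. length ys = m \<and> distinct ys \<and> set ys \<subseteq> Y \<and> (\<forall>i\<le>I. \<forall>C\<in>F i.
      real (hits C ys) \<le> 2 * (card C / card Y) * m + 2 * ln (6 * (real I + 1) * card (F i)) \<and>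
      (card C / card Y) * m \<le> 2 * real (hits C ys) + 2 * ln (6 * (real I + 1) * card (F i)))"
    by (rule exists_sampling_points[OF Y F _ m m0]) (rule F_sub)
  then obtain ys where ys: "length ys = m" "distinct ys" "set ys \<subseteq> Y"
    and hits: "\<And>i C. i \<le> I \<Longrightarrow> C \<in> F i \<Longrightarrow>
      real (hits C ys) \<le> 2 * (card C / card Y) * m + 2 * ln (6 * (real I + 1) * card (F i)) \<and>
      (card C / card Y) * m \<le> 2 * real (hits C ys) + 2 * ln (6 * (real I + 1) * card (F i))"
    by blast
  define S where "S = set ys"
  \<comment> \<open>The total error of the hitting estimates, weighted as in the layer cake. As
    \<open>ln (card (F i))\<close> is at most \<open>1025 * 4 ^ i * LY * LQ\<close>, the weight
    \<open>(1/4) ^ i\<close> cancels the growth in \<open>i\<close> and each level contributes a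
    bounded multiple of \<open>LY * LQ\<close>; hence the factor \<open>I + 1\<close> in the
    condition on \<open>m\<close>.\<close>
  define \<Theta> where "\<Theta> = (\<Sum>i\<le>I. (1/4) ^ i * (2 * ln (6 * (real I + 1) * card (F i)))) / m"
  have \<Theta>: "\<Theta> \<le> 1 / K"
  proof -
    have geo: "(\<Sum>i\<le>I. (1/4 :: real) ^ i) \<le> 8"
    proof -
      have "(1/2 :: real) ^ i < 2" for i by (rule le_less_trans[OF power_le_one]) auto
      then show ?thesis using sum_dyadic_below[of 2 I] by simp
    qed
    have "(1/4) ^ i * (2 * ln (6 * (real I + 1) * card (F i))) \<le> (1/4) ^ i * (12 * (real I + 1)) + 2050 * LY * LQ" for i
    proof -
      have cF: "0 < real (card (F i))" using F by (simp add: card_gt_0_iff)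
      then have "ln (6 * (real I + 1) * card (F i)) = ln (6 * (real I + 1)) + ln (card (F i))"
        by (intro ln_mult_pos) auto
      also have "ln (6 * (real I + 1)) \<le> 6 * (real I + 1) - 1" by (intro ln_le_minus_one) auto
      also have "ln (card (F i)) \<le> ln ((4 * real (card Q)) ^ n i)"
      proof (rule ln_le_cancel_iff[THEN iffD2])
        show "real (card (F i)) \<le> (4 * real (card Q)) ^ n i"
          using of_nat_mono[OF card_F[of i], where 'a = real] by simp
      qed (use cF cQ in auto)
      also have "\<dots> = real (n i) * LQ" unfolding LQ_def by (rule ln_realpow)
      also have "\<dots> \<le> 1025 * 4 ^ i * LY * LQ" using n_le LQ by (intro mult_right_mono) auto
      finally have "(1/4) ^ i * (2 * ln (6 * (real I + 1) * card (F i)))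
         \<le> (1/4) ^ i * (12 * (real I + 1) + 4 ^ i * (2050 * LY * LQ))"
        by (intro mult_left_mono) auto
      also have "\<dots> = (1/4) ^ i * (12 * (real I + 1)) + ((1/4) ^ i * 4 ^ i) * (2050 * LY * LQ)"
        by (simp add: algebra_simps)
      also have "(1/4 :: real) ^ i * 4 ^ i = 1" by (simp flip: power_mult_distrib)
      finally show ?thesis by simp
    qed
    then have "(\<Sum>i\<le>I. (1/4) ^ i * (2 * ln (6 * (real I + 1) * card (F i))))
        \<le> (\<Sum>i\<le>I. (1/4) ^ i * (12 * (real I + 1)) + 2050 * LY * LQ)" by (intro sum_mono) auto
    also have "\<dots> = (\<Sum>i\<le>I. (1/4) ^ i) * (12 * (real I + 1)) + (real I + 1) * (2050 * LY * LQ)"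
      by (simp add: sum.distrib sum_distrib_right)
    also have "\<dots> \<le> 8 * (12 * (real I + 1)) + (real I + 1) * (2050 * LY * LQ)"
      using geo by (intro add_right_mono mult_right_mono) auto
    also have "8 * (12 * (real I + 1)) + (real I + 1) * (2050 * LY * LQ) \<le> 3200 * ((real I + 1) * LY * LQ)"
    proof -
      have "1 * 1 \<le> LY * LQ" using LY LQ by (intro mult_mono) auto
      then have "(real I + 1) * 1 \<le> (real I + 1) * (LY * LQ)" by (intro mult_left_mono) auto
      then show ?thesis by (simp add: algebra_simps)
    qed
    also have "\<dots> \<le> real m / K" using mK K(1) by (simp add: LY_def LQ_def field_simps)
    finally show ?thesis using m0 K(1) by (simp add: \<Theta>_def field_simps)
  qed
  have K4: "(1/4) ^ I \<le> 1 / K" using K by (simp add: field_simps)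
  \<comment> \<open>Both inequalities are homogeneous of degree two, so they may be proved under the
    normalisation that Maurey's method requires.\<close>
  have unit: "(\<Sum>y\<in>S. (norm (\<Sum>k\<in>Q. x k * \<phi> k y))\<^sup>2) / m \<le> 64 * (\<Sum>k\<in>Q. (norm (x k))\<^sup>2) + 20 / K
      \<and> (\<Sum>k\<in>Q. (norm (x k))\<^sup>2) \<le> 64 * ((\<Sum>y\<in>S. (norm (\<Sum>k\<in>Q. x k * \<phi> k y))\<^sup>2) / m) + 20 / K"
    if x: "(\<Sum>k\<in>Q. norm (x k)) = 1" for x
  proof -
    define f where "f y = norm (\<Sum>k\<in>Q. x k * \<phi> k y)" for y
    have f1: "f y \<le> 1" if "y \<in> Y" for y
    proof -
      have "f y \<le> (\<Sum>k\<in>Q. norm (x k) * 1)" unfolding f_def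
        using \<phi> that by (intro sum_norm_le) (simp add: norm_mult mult_left_le)
      then show ?thesis using x by simp
    qed
    have "\<exists>C\<in>F i. \<forall>y\<in>Y. (2 * (1/2) ^ i < f y \<longrightarrow> y \<in> C) \<and> (y \<in> C \<longrightarrow> (1/2) ^ i < f y)" for i
    proof -
      let ?\<epsilon> = "(1/2) ^ i / 2 :: real"
      have \<epsilon>: "0 < ?\<epsilon>" "?\<epsilon> \<le> 1" using power_le_one[of "1/2 :: real" i] by auto
      have "?\<epsilon>\<^sup>2 = 1 / (4 * 4 ^ i)" by (simp add: power2_eq_square power_divide flip: power_mult_distrib)
      then have n: "256 * ln (4 * real (card Y)) / ?\<epsilon>\<^sup>2 \<le> real (n i)"
        using n_ge[of i] by (simp add: LY_def mult_ac)
      have "\<exists>as. length as = n i \<and> set as \<subseteq> Q \<times> units4 \<and>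
        (\<forall>y\<in>Y. norm ((\<Sum>k\<in>Q. x k * \<phi> k y) - 2 / of_nat (n i) * signed_sum \<phi> as y) \<le> ?\<epsilon>)"
        by (rule maurey[OF Q(1) Y _ x \<epsilon> n]) (rule \<phi>)
      then obtain as where as: "length as = n i" "set as \<subseteq> Q \<times> units4"
        "\<And>y. y \<in> Y \<Longrightarrow> norm ((\<Sum>k\<in>Q. x k * \<phi> k y) - 2 / of_nat (n i) * signed_sum \<phi> as y) \<le> ?\<epsilon>"
        by blast
      have "\<bar>f y - norm (2 / of_nat (n i) * signed_sum \<phi> as y)\<bar> \<le> ?\<epsilon>" if "y \<in> Y" for y
        using as(3)[OF that] norm_triangle_ineq3 order_trans unfolding f_def by blast
      note close = this
      have "\<forall>y\<in>Y. (2 * (1/2) ^ i < f y \<longrightarrow> y \<in> B i as) \<and> (y \<in> B i as \<longrightarrow> (1/2) ^ i < f y)"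
      proof
        fix y assume "y \<in> Y"
        then show "(2 * (1/2) ^ i < f y \<longrightarrow> y \<in> B i as) \<and> (y \<in> B i as \<longrightarrow> (1/2) ^ i < f y)"
          using close[of y] unfolding B_def mem_Collect_eq abs_le_iff by linarith
      qed
      then show ?thesis using as(1,2) by (auto simp: F_def)
    qed
    then obtain C where C: "\<And>i. C i \<in> F i" "\<And>i y. y \<in> Y \<Longrightarrow> 2 * (1/2) ^ i < f y \<Longrightarrow> y \<in> C i"
        "\<And>i y. y \<in> Y \<Longrightarrow> y \<in> C i \<Longrightarrow> (1/2) ^ i < f y" by metis
    define Z where "Z y = (\<Sum>i\<le>I. (1/4) ^ i * of_bool (y \<in> C i) :: real)" for y
    have Z: "Z y \<le> 2 * (f y)\<^sup>2" "(f y)\<^sup>2 \<le> 16 * Z y + 4 * (1/4) ^ I" if "y \<in> Y" for y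
      using dyadic_layer_cake[of "f y" I "\<lambda>i. y \<in> C i"] f1[OF that] C(2,3)[OF that]
      by (auto simp: Z_def f_def)
    define aY where "aY = (\<Sum>y\<in>Y. Z y) / card Y"
    define aS where "aS = (\<Sum>y\<in>S. Z y) / m"
    have aY: "aY = (\<Sum>i\<le>I. (1/4) ^ i * (card (C i) / card Y))"
    proof -
      have "(\<Sum>y\<in>Y. of_bool (y \<in> C i)) = real (card (C i))" if "i \<le> I" for i
        using Y F_sub[OF that C(1)] by (simp add: Int_absorb1)
      then show ?thesis unfolding aY_def Z_def
        by (subst sum.swap) (simp add: sum_distrib_left[symmetric] sum_divide_distrib)
    qed
    have aS: "aS = (\<Sum>i\<le>I. (1/4) ^ i * (hits (C i) ys / m))"
      unfolding aS_def Z_def S_def hits_eq_sum[OF ys(2)]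
      by (subst sum.swap) (simp add: sum_distrib_left[symmetric] sum_divide_distrib)
    have "aS \<le> 2 * aY + \<Theta>"
    proof -
      have "aS \<le> (\<Sum>i\<le>I. (1/4) ^ i * ((2 * (card (C i) / card Y) * m + 2 * ln (6 * (real I + 1) * card (F i))) / m))"
        unfolding aS using hits C(1) by (intro sum_mono mult_left_mono divide_right_mono) auto
      also have "\<dots> = 2 * aY + \<Theta>" unfolding aY \<Theta>_def using m0
        by (simp add: sum.distrib sum_distrib_left sum_divide_distrib add_divide_distrib distrib_left mult_ac)
      finally show ?thesis .
    qed
    moreover have "aY \<le> 2 * aS + \<Theta>"
    proof -
      have "aY = (\<Sum>i\<le>I. (1/4) ^ i * ((card (C i) / card Y) * m / m))" unfolding aY using m0 by simp
      also have "\<dots> \<le> (\<Sum>i\<le>I. (1/4) ^ i * ((2 * real (hits (C i) ys) + 2 * ln (6 * (real I + 1) * card (F i))) / m))"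
        using hits C(1) by (intro sum_mono mult_left_mono divide_right_mono) auto
      also have "\<dots> = 2 * aS + \<Theta>" unfolding aS \<Theta>_def using m0
        by (simp add: sum.distrib sum_distrib_left sum_divide_distrib add_divide_distrib distrib_left mult_ac)
      finally show ?thesis .
    qed
    moreover have avg: "(\<Sum>y\<in>R. Z y) / card R \<le> 2 * ((\<Sum>y\<in>R. (f y)\<^sup>2) / card R)"
        "(\<Sum>y\<in>R. (f y)\<^sup>2) / card R \<le> 16 * ((\<Sum>y\<in>R. Z y) / card R) + 4 * (1/4) ^ I"
      if R: "R \<subseteq> Y" "R \<noteq> {}" for R
    proof -
      have cR: "real (card R) > 0" using R Y(1) by (meson card_gt_0_iff finite_subset of_nat_0_less_iff)
      have "(\<Sum>y\<in>R. Z y) \<le> (\<Sum>y\<in>R. 2 * (f y)\<^sup>2)" using Z(1) R by (intro sum_mono) auto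
      then show "(\<Sum>y\<in>R. Z y) / card R \<le> 2 * ((\<Sum>y\<in>R. (f y)\<^sup>2) / card R)"
        using cR by (simp add: divide_right_mono flip: sum_distrib_left)
      have "(\<Sum>y\<in>R. (f y)\<^sup>2) \<le> (\<Sum>y\<in>R. 16 * Z y + 4 * (1/4) ^ I)" using Z(2) R by (intro sum_mono) auto
      also have "\<dots> = 16 * (\<Sum>y\<in>R. Z y) + real (card R) * (4 * (1/4) ^ I)"
        by (simp only: sum.distrib sum_distrib_left sum_constant)
      also have "\<dots> = (16 * ((\<Sum>y\<in>R. Z y) / card R) + 4 * (1/4) ^ I) * card R"
        using cR by (simp add: distrib_right)
      finally show "(\<Sum>y\<in>R. (f y)\<^sup>2) / card R \<le> 16 * ((\<Sum>y\<in>R. Z y) / card R) + 4 * (1/4) ^ I"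
        using cR by (simp add: pos_divide_le_eq)
    qed
    moreover have "card S = m" using ys by (simp add: S_def distinct_card)
    moreover have "S \<subseteq> Y" "S \<noteq> {}" using ys m0 by (auto simp: S_def)
    moreover have "(\<Sum>y\<in>Y. (f y)\<^sup>2) / card Y = (\<Sum>k\<in>Q. (norm (x k))\<^sup>2)"
      using cY by (simp add: f_def orth)
    \<comment> \<open>Chaining these gives the constants of the statement:
      \<open>16 * 2 * 2 = 64\<close> for the squares and \<open>16 + 4 = 20\<close> for the error,
      as \<open>\<Theta>\<close> and \<open>(1/4) ^ I\<close> are both at most
      \<open>1 / K\<close>.\<close>
    ultimately have
      "aS \<le> 2 * aY + \<Theta>" "aY \<le> 2 * aS + \<Theta>"
      "aY \<le> 2 * (\<Sum>k\<in>Q. (norm (x k))\<^sup>2)" "(\<Sum>k\<in>Q. (norm (x k))\<^sup>2) \<le> 16 * aY + 4 * (1/4) ^ I"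
      "aS \<le> 2 * ((\<Sum>y\<in>S. (f y)\<^sup>2) / m)" "(\<Sum>y\<in>S. (f y)\<^sup>2) / m \<le> 16 * aS + 4 * (1/4) ^ I"
      using avg[of S] avg[of Y] Y(2) by (simp_all add: aY_def aS_def)
    moreover have "20 / K = 16 * (1 / K) + 4 * (1 / K)" by simp
    ultimately show ?thesis using \<Theta> K4 unfolding f_def by linarith
  qed
  have "(\<Sum>y\<in>S. (norm (\<Sum>k\<in>Q. x k * \<phi> k y))\<^sup>2) / m
      \<le> 64 * (\<Sum>k\<in>Q. (norm (x k))\<^sup>2) + 20 * (\<Sum>k\<in>Q. norm (x k))\<^sup>2 / K \<and>
    (\<Sum>k\<in>Q. (norm (x k))\<^sup>2)
      \<le> 64 * ((\<Sum>y\<in>S. (norm (\<Sum>k\<in>Q. x k * \<phi> k y))\<^sup>2) / m) + 20 * (\<Sum>k\<in>Q. norm (x k))\<^sup>2 / K" for x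
  proof (cases "(\<Sum>k\<in>Q. norm (x k)) = 0")
    case True
    then have "x k = 0" if "k \<in> Q" for k using that Q(1) by (simp add: sum_nonneg_eq_0_iff)
    then show ?thesis by simp
  next
    case False
    define r where "r = (\<Sum>k\<in>Q. norm (x k))"
    have r: "r > 0" using False unfolding r_def by (simp add: less_le sum_nonneg)
    define x' where "x' k = x k / of_real r" for k
    have 1: "(\<Sum>k\<in>Q. norm (x' k)) = 1"
    proof -
      have "(\<Sum>k\<in>Q. norm (x' k)) = (\<Sum>k\<in>Q. norm (x k) / r)" using r by (simp add: x'_def norm_divide)
      also have "\<dots> = 1" unfolding sum_divide_distrib[symmetric] r_def[symmetric] using r by simp
      finally show ?thesis .
    qed
    have xx': "x k = of_real r * x' k" for k using r by (simp add: x'_def)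
    have e: "(\<Sum>y\<in>S. (norm (\<Sum>k\<in>Q. x k * \<phi> k y))\<^sup>2) / m = r\<^sup>2 * ((\<Sum>y\<in>S. (norm (\<Sum>k\<in>Q. x' k * \<phi> k y))\<^sup>2) / m)"
      unfolding xx' using r by (simp add: mult.assoc sum_distrib_left[symmetric] norm_mult power_mult_distrib)
    have s: "(\<Sum>k\<in>Q. (norm (x k))\<^sup>2) = r\<^sup>2 * (\<Sum>k\<in>Q. (norm (x' k))\<^sup>2)"
      unfolding xx' using r by (simp add: norm_mult power_mult_distrib sum_distrib_left[symmetric])
    have "r\<^sup>2 \<ge> 0" by simp
    from mult_left_mono[OF unit[OF 1, THEN conjunct1] this] mult_left_mono[OF unit[OF 1, THEN conjunct2] this]
    show ?thesis unfolding e s r_def[symmetric] by (simp add: algebra_simps)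
  qed
  then show ?thesis using ys unfolding S_def by blast
qed

section \<open>Sparse approximation in the coefficient classes\<close>

text \<open>The binary length of \<open>k\<close> is the index of the unique dyadic range containing
  its modulus. Blocks and layers thus become level sets of functions, which makes them disjoint and
  lets sums be grouped by level.\<close>

definition bit_length :: "int \<Rightarrow> nat" where
  "bit_length k = (LEAST s. \<bar>k\<bar> < 2 ^ s)"

definition freq_level :: "int ^ 'd::finite \<Rightarrow> nat" where
  "freq_level k = (\<Sum>i\<in>UNIV. bit_length (k $ i))"

lemma bit_length_less: "\<bar>k\<bar> < 2 ^ bit_length k"
proof -
  have "\<bar>k\<bar> < 2 ^ nat \<bar>k\<bar>" using of_nat_less_two_power[of "nat \<bar>k\<bar>", where 'a = int] by simp
  then show ?thesis unfolding bit_length_def by (rule LeastI)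
qed

lemma bit_length_le_iff: "bit_length k \<le> s \<longleftrightarrow> \<bar>k\<bar> < 2 ^ s"
proof
  assume "bit_length k \<le> s"
  then have "(2::int) ^ bit_length k \<le> 2 ^ s" by (intro power_increasing) auto
  then show "\<bar>k\<bar> < 2 ^ s" using bit_length_less[of k] by linarith
qed (simp add: bit_length_def Least_le)

lemma bit_length_eq_iff:
  "bit_length k = s \<longleftrightarrow> \<lfloor>(2::real) powi (int s - 1)\<rfloor> \<le> \<bar>k\<bar> \<and> \<bar>k\<bar> < 2 ^ s"
proof (cases s)
  \<comment> \<open>The floor of \<open>2 powi (- 1)\<close> is 0, so the range with index 0
    contains 0 alone.\<close>
  case 0
  then show ?thesis using bit_length_le_iff[of k 0] by (auto simp: power_int_minus)
next
  case (Suc n)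
  have "\<lfloor>(2::real) powi (int s - 1)\<rfloor> = 2 ^ n"
  proof -
    have "(2::real) powi (int s - 1) = of_int (2 ^ n)" using Suc by simp
    then show ?thesis by (simp only: floor_of_int)
  qed
  moreover have "bit_length k = s \<longleftrightarrow> bit_length k \<le> s \<and> \<not> bit_length k \<le> n" using Suc by auto
  ultimately show ?thesis unfolding bit_length_le_iff by auto
qed

lemma dyadic_block_eq: "dyadic_block s = {k. \<forall>j. bit_length (k $ j) = s $ j}"
  by (simp add: dyadic_block_def bit_length_eq_iff)

lemma hyperbolic_layer_eq: "hyperbolic_layer j = {k. freq_level k = j}"
proof -
  have "k \<in> hyperbolic_layer j \<longleftrightarrow> freq_level k = j" for k :: "int ^ 'd"
    unfolding hyperbolic_layer_def dyadic_block_eq freq_level_def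
    by (auto intro!: exI[of _ "\<chi> i. bit_length (k $ i)"])
  then show ?thesis by blast
qed

lemma card_bit_length: "finite {k. bit_length k = s} \<and> card {k. bit_length k = s} \<le> 2 ^ s"
proof (cases s)
  case 0
  have "{k. bit_length k = 0} = {0}" using bit_length_le_iff[of _ 0] by auto
  then show ?thesis using 0 by simp
next
  case (Suc n)
  let ?A = "{- (2 ^ s) <.. - (2 ^ n)} \<union> {2 ^ n ..< 2 ^ s} :: int set"
  have "{k. bit_length k = s} \<subseteq> ?A"
  proof
    fix k assume "k \<in> {k. bit_length k = s}"
    then have "bit_length k \<le> s" "\<not> bit_length k \<le> n" using Suc by auto
    then show "k \<in> ?A" unfolding bit_length_le_iff by (auto simp: abs_if split: if_splits)
  qed
  moreover have "card ?A \<le> 2 ^ s"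
  proof -
    have "card ?A \<le> card {- (2 ^ s) <.. - (2 ^ n) :: int} + card {2 ^ n ..< 2 ^ s :: int}" by (rule card_Un_le)
    also have "\<dots> = 2 ^ n + 2 ^ n" using Suc by (simp add: nat_power_eq)
    finally show ?thesis using Suc by simp
  qed
  ultimately show ?thesis by (meson card_mono finite_Un finite_atLeastLessThan_int finite_greaterThanAtMost_int
        finite_subset order_trans)
qed

lemma card_dyadic_block:
  fixes s :: "nat ^ 'd::finite"
  shows "finite (dyadic_block s)" "card (dyadic_block s) \<le> 2 ^ (\<Sum>i\<in>UNIV. s $ i)"
proof -
  let ?P = "PiE (UNIV :: 'd set) (\<lambda>i. {k. bit_length k = s $ i})"
  have fin: "finite ?P" using card_bit_length by (intro finite_PiE) auto
  have inj: "inj_on vec_nth (dyadic_block s)" by (simp add: inj_on_def vec_nth_inject)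
  have sub: "vec_nth ` dyadic_block s \<subseteq> ?P" by (auto simp: dyadic_block_eq)
  show "finite (dyadic_block s)" using fin inj sub by (meson finite_imageD finite_subset)
  have "card (dyadic_block s) = card (vec_nth ` dyadic_block s)" using inj by (simp add: card_image)
  also have "\<dots> \<le> card ?P" using fin sub by (rule card_mono)
  also have "\<dots> = (\<Prod>i\<in>UNIV. card {k. bit_length k = s $ i})" by (simp add: card_PiE)
  also have "\<dots> \<le> (\<Prod>i\<in>UNIV. 2 ^ (s $ i))" using card_bit_length by (intro prod_mono) auto
  also have "\<dots> = 2 ^ (\<Sum>i\<in>UNIV. s $ i)" by (simp add: power_sum)
  finally show "card (dyadic_block s) \<le> 2 ^ (\<Sum>i\<in>UNIV. s $ i)" .
qed

text \<open>One coordinate, \<open>i0\<close>, is determined by the others and the sum. Leaving it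
  out gives the exponent \<open>CARD('d) - 1\<close>, and with it the power of the logarithm in the
  final rate.\<close>

lemma card_compositions:
  "finite {s :: nat ^ 'd::finite. (\<Sum>i\<in>UNIV. s $ i) = j}"
  "card {s :: nat ^ 'd::finite. (\<Sum>i\<in>UNIV. s $ i) = j} \<le> (j + 1) ^ (CARD('d) - 1)"
proof -
  obtain i0 :: 'd where True by simp
  let ?S = "{s :: nat ^ 'd. (\<Sum>i\<in>UNIV. s $ i) = j}"
  let ?P = "PiE (UNIV - {i0}) (\<lambda>_. {..j})"
  let ?r = "\<lambda>s :: nat ^ 'd. restrict (vec_nth s) (UNIV - {i0})"
  have fin: "finite ?P" by (intro finite_PiE) auto
  have inj: "inj_on ?r ?S"
  proof (rule inj_onI)
    fix s s' :: "nat ^ 'd" assume *: "s \<in> ?S" "s' \<in> ?S" "?r s = ?r s'"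
    have eq: "s $ i = s' $ i" if "i \<noteq> i0" for i using fun_cong[OF *(3), of i] that by simp
    have "s $ i0 + (\<Sum>i\<in>UNIV - {i0}. s $ i) = s' $ i0 + (\<Sum>i\<in>UNIV - {i0}. s' $ i)"
      using *(1,2) by (simp flip: sum.remove)
    moreover have "(\<Sum>i\<in>UNIV - {i0}. s $ i) = (\<Sum>i\<in>UNIV - {i0}. s' $ i)" by (intro sum.cong) (auto simp: eq)
    ultimately have "s $ i0 = s' $ i0" by simp
    then show "s = s'" using eq by (metis vec_eq_iff)
  qed
  have sub: "?r ` ?S \<subseteq> ?P"
  proof -
    have "s $ i \<le> j" if "s \<in> ?S" for s :: "nat ^ 'd" and i using that member_le_sum[of i UNIV "vec_nth s"] by auto
    then show ?thesis by (simp add: image_subset_iff restrict_PiE_iff)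
  qed
  show "finite ?S" using fin inj sub by (meson finite_imageD finite_subset)
  have "card ?S = card (?r ` ?S)" using inj by (simp add: card_image)
  also have "\<dots> \<le> card ?P" using fin sub by (rule card_mono)
  also have "\<dots> = (j + 1) ^ (CARD('d) - 1)" by (simp add: card_PiE card_Diff_singleton)
  finally show "card ?S \<le> (j + 1) ^ (CARD('d) - 1)" .
qed

lemma card_hyperbolic_layer:
  "card (hyperbolic_layer j :: (int ^ 'd::finite) set) \<le> 2 ^ j * (j + 1) ^ (CARD('d) - 1)"
proof -
  let ?S = "{s :: nat ^ 'd. (\<Sum>i\<in>UNIV. s $ i) = j}"
  have "card (hyperbolic_layer j :: (int ^ 'd) set) \<le> (\<Sum>s\<in>?S. card (dyadic_block s))"
    unfolding hyperbolic_layer_def using card_compositions(1) by (rule card_UN_le)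
  also have "\<dots> \<le> (\<Sum>s\<in>?S. 2 ^ j)" by (intro sum_mono) (use card_dyadic_block(2) in force)
  also have "\<dots> \<le> 2 ^ j * (j + 1) ^ (CARD('d) - 1)" using card_compositions(2)[of j] by (simp add: mult.commute)
  finally show ?thesis .
qed

lemma bit_length_component_le: "bit_length (k $ i) \<le> freq_level k"
  unfolding freq_level_def by (rule member_le_sum) auto

lemma finite_freq_level_le: "finite {k :: int ^ 'd::finite. freq_level k \<le> n}"
proof -
  have "{k :: int ^ 'd. freq_level k \<le> n} = (\<Union>j\<le>n. hyperbolic_layer j)" by (auto simp: hyperbolic_layer_eq)
  then show ?thesis by (simp add: finite_hyperbolic_layer)
qed

section \<open>Thresholding and tails of the coefficient classes\<close>

text \<open>Chebyshev's inequality at the height \<open>B * y powr (- 1 / \<beta>)\<close> counts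
  the large coefficients; below it, the \<open>q\<close>-th power of a coefficient is at most the
  height to the power \<open>q - \<beta>\<close> times the \<beta>-th power. The parameter
  \<open>y\<close> is the budget of terms that are kept.\<close>

lemma threshold_split:
  fixes u :: "'k \<Rightarrow> complex"
  assumes S: "finite S" "(\<Sum>k\<in>S. norm (u k) powr \<beta>) \<le> B powr \<beta>"
    and pos: "0 < B" "0 < y" "0 < \<beta>"
  shows "real (card {k\<in>S. B * y powr (- 1 / \<beta>) < norm (u k)}) \<le> y"
    and "\<beta> \<le> q \<Longrightarrow> (\<Sum>k\<in>{k\<in>S. norm (u k) \<le> B * y powr (- 1 / \<beta>)}. norm (u k) powr q)
      \<le> B powr q * y powr (1 - q / \<beta>)"
proof -
  define r where "r = B * y powr (- 1 / \<beta>)"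
  have r: "r > 0" using pos by (simp add: r_def)
  have r_powr: "r powr e = B powr e * y powr (- e / \<beta>)" for e
    using pos by (simp add: r_def powr_mult powr_powr)
  let ?L = "{k\<in>S. r < norm (u k)}" let ?M = "{k\<in>S. norm (u k) \<le> r}"
  have "real (card ?L) * r powr \<beta> = (\<Sum>k\<in>?L. r powr \<beta>)" by simp
  also have "\<dots> \<le> (\<Sum>k\<in>?L. norm (u k) powr \<beta>)" using r pos by (intro sum_mono powr_mono2) auto
  also have "\<dots> \<le> (\<Sum>k\<in>S. norm (u k) powr \<beta>)" using S by (intro sum_mono2) auto
  also have "\<dots> \<le> B powr \<beta>" by (rule S)
  finally have "real (card ?L) * (B powr \<beta> * y powr (- 1)) \<le> B powr \<beta>" using pos by (simp add: r_powr)
  then show "real (card {k\<in>S. B * y powr (- 1 / \<beta>) < norm (u k)}) \<le> y"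
    unfolding r_def[symmetric] using pos by (simp add: powr_minus field_simps)
  assume q: "\<beta> \<le> q"
  have "(\<Sum>k\<in>?M. norm (u k) powr q) = (\<Sum>k\<in>?M. norm (u k) powr (q - \<beta>) * norm (u k) powr \<beta>)"
    by (simp flip: powr_add)
  also have "\<dots> \<le> (\<Sum>k\<in>?M. r powr (q - \<beta>) * norm (u k) powr \<beta>)"
    using r q by (intro sum_mono mult_right_mono powr_mono2) auto
  also have "\<dots> \<le> r powr (q - \<beta>) * (\<Sum>k\<in>S. norm (u k) powr \<beta>)"
    unfolding sum_distrib_left[symmetric] using S r by (intro mult_left_mono sum_mono2) auto
  also have "\<dots> \<le> r powr (q - \<beta>) * B powr \<beta>" using S r by (intro mult_left_mono) auto
  also have "\<dots> = B powr q * y powr (1 - q / \<beta>)"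
  proof -
    have "- (q - \<beta>) / \<beta> = 1 - q / \<beta>" using pos by (simp add: field_simps)
    then have "r powr (q - \<beta>) * B powr \<beta> = (B powr (q - \<beta>) * B powr \<beta>) * y powr (1 - q / \<beta>)"
      by (simp add: r_powr mult_ac)
    then show ?thesis by (simp flip: powr_add)
  qed
  finally show "(\<Sum>k\<in>{k\<in>S. norm (u k) \<le> B * y powr (- 1 / \<beta>)}. norm (u k) powr q)
      \<le> B powr q * y powr (1 - q / \<beta>)" by (simp add: r_def)
qed

lemma powr_le_exp2:
  fixes c h :: real assumes "0 < c"
  shows "\<exists>M>0. \<forall>i::nat. (real i + 1) powr h \<le> M * 2 powr (c * i)"
proof -
  have "(\<lambda>i::nat. (real i + 1) powr h * 2 powr (- c * real i)) \<longlonglongrightarrow> 0"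
    using assms by real_asymp
  then have "Bseq (\<lambda>i::nat. (real i + 1) powr h * 2 powr (- c * real i))"
    by (intro convergent_imp_Bseq convergentI)
  then obtain M where M: "M > 0" "\<And>i::nat. norm ((real i + 1) powr h * 2 powr (- c * real i)) \<le> M"
    by (auto elim: BseqE)
  have "(real i + 1) powr h \<le> M * 2 powr (c * i)" for i :: nat
    using M(2)[of i] by (simp add: powr_minus field_simps)
  then show ?thesis using M(1) by blast
qed

lemma sum_geometric_powr_le:
  fixes c :: real assumes "0 < c"
  shows "(\<Sum>i<N. 2 powr (- c * real i)) \<le> 1 / (1 - 2 powr (- c))"
proof -
  have q: "2 powr (- c) < 1" using assms by (simp add: powr_less_one)
  have "(\<Sum>i<N. 2 powr (- c * real i)) = (\<Sum>i<N. (2 powr (- c)) ^ i)"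
    by (simp add: powr_powr flip: powr_realpow)
  also have "\<dots> \<le> (\<Sum>i. (2 powr (- c)) ^ i)" using q by (intro sum_le_suminf summable_geometric) auto
  also have "\<dots> = 1 / (1 - 2 powr (- c))" using q by (intro suminf_geometric) auto
  finally show ?thesis .
qed

text \<open>The additional weight \<open>2 powr (a / 2 * (j - n))\<close> pays for keeping ever
  fewer coefficients in higher layers. It uses half of the decay \<open>2 powr (- a * j)\<close>; a
  further quarter absorbs the change of the logarithmic factor, and the last quarter makes the
  series converge.\<close>

lemma sum_weighted_tail_le:
  fixes a g :: real assumes "0 < a"
  shows "\<exists>C>0. \<forall>n N. (\<Sum>j\<in>{n<..N}. 2 powr (- a * j) * real (max j 1) powr g * 2 powr (a / 2 * (real j - real n)))
    \<le> C * 2 powr (- a * n) * (real n + 1) powr g"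
proof -
  obtain M where M: "M > 0" "\<And>i::nat. (real i + 1) powr \<bar>g\<bar> \<le> M * 2 powr (a / 4 * i)"
    using powr_le_exp2[of "a / 4" "\<bar>g\<bar>"] assms by auto
  define C where "C = M * (1 / (1 - 2 powr (- (a / 4))))"
  have "2 powr (- (a / 4)) < 1" using assms by (simp add: powr_less_one)
  then have C0: "C > 0" using M(1) by (simp add: C_def)
  have "(\<Sum>j\<in>{n<..N}. 2 powr (- a * j) * real (max j 1) powr g * 2 powr (a / 2 * (real j - real n)))
    \<le> C * 2 powr (- a * n) * (real n + 1) powr g" for n N
  proof -
    define P where "P = 2 powr (- a * n) * (real n + 1) powr g"
    have P: "P \<ge> 0" by (simp add: P_def)
    have summand: "2 powr (- a * j) * real (max j 1) powr g * 2 powr (a / 2 * (real j - real n))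
        \<le> P * (M * 2 powr (- (a / 4) * real (j - n)))" if j: "n < j" for j
    proof -
      define i where "i = j - n"
      have ji: "real j = real n + real i" and i1: "real i \<ge> 1" using j by (auto simp: i_def)
      \<comment> \<open>The ratio of the two bases lies between 1 and \<open>i + 1\<close>, so its
        power is at most \<open>(i + 1) powr \<bar>g\<bar>\<close> for either sign of
        \<open>g\<close>.\<close>
      define q where "q = real j / (real n + 1)"
      have q1: "1 \<le> q" using j by (simp add: q_def)
      have "real j \<le> (real i + 1) * (real n + 1)" using ji by (simp add: algebra_simps)
      then have q2: "q \<le> real i + 1" by (simp add: q_def pos_divide_le_eq)
      have "q powr g \<le> q powr \<bar>g\<bar>" using q1 by (intro powr_mono) auto
      also have "\<dots> \<le> (real i + 1) powr \<bar>g\<bar>" using q1 q2 by (intro powr_mono2) auto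
      also have "\<dots> \<le> M * 2 powr (a / 4 * i)" by (rule M)
      finally have "q powr g \<le> M * 2 powr (a / 4 * i)" .
      moreover have "real (max j 1) powr g = (real n + 1) powr g * q powr g"
        using j by (simp add: q_def powr_divide)
      ultimately have "real (max j 1) powr g \<le> (real n + 1) powr g * (M * 2 powr (a / 4 * i))"
        by (simp add: mult_left_mono)
      then have "2 powr (- a * j) * real (max j 1) powr g * 2 powr (a / 2 * (real j - real n))
          \<le> 2 powr (- a * j) * ((real n + 1) powr g * (M * 2 powr (a / 4 * i))) * 2 powr (a / 2 * (real j - real n))"
        by (intro mult_right_mono mult_left_mono) auto
      also have "\<dots> = (real n + 1) powr g * M * (2 powr (- a * j) * 2 powr (a / 4 * i) * 2 powr (a / 2 * (real j - real n)))"
        by (simp add: mult_ac)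
      also have "2 powr (- a * j) * 2 powr (a / 4 * i) * 2 powr (a / 2 * (real j - real n))
          = 2 powr (- a * n) * 2 powr (- (a / 4) * i)"
        unfolding powr_add[symmetric] ji by (rule arg_cong[of _ _ "\<lambda>e. 2 powr e"]) (simp add: field_simps)
      finally show ?thesis by (simp add: P_def i_def mult_ac)
    qed
    have "(\<Sum>j\<in>{n<..N}. 2 powr (- a * j) * real (max j 1) powr g * 2 powr (a / 2 * (real j - real n)))
      \<le> (\<Sum>j\<in>{n<..N}. P * (M * 2 powr (- (a / 4) * real (j - n))))"
      by (intro sum_mono summand) auto
    also have "\<dots> = (\<Sum>i\<in>(\<lambda>j. j - n) ` {n<..N}. P * (M * 2 powr (- (a / 4) * real i)))"
      by (subst sum.reindex) (auto simp: inj_on_def)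
    also have "\<dots> \<le> (\<Sum>i<Suc N. P * (M * 2 powr (- (a / 4) * real i)))"
      using P M(1) by (intro sum_mono2) auto
    also have "\<dots> = P * M * (\<Sum>i<Suc N. 2 powr (- (a / 4) * real i))" by (simp add: sum_distrib_left mult.assoc distrib_left)
    also have "\<dots> \<le> P * M * (1 / (1 - 2 powr (- (a / 4))))"
      using P M(1) assms by (intro mult_left_mono sum_geometric_powr_le) auto
    finally show ?thesis by (simp add: P_def C_def mult_ac)
  qed
  then show ?thesis using C0 by blast
qed

text \<open>Up to level \<open>n\<close> there are about \<open>2 ^ n * (n + 1) ^ D\<close> frequencies; \<open>n\<close> is chosen to make this \<open>2 ^ l\<close>.\<close>

lemma cut_level:
  fixes a b :: real and D :: nat assumes "0 < a"
  shows "\<exists>C>0. \<forall>l. \<exists>n\<le>l. 2 ^ n * (n + 1) ^ D \<le> (2::nat) ^ l \<and>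
    2 powr (- a * n) * (real n + 1) powr (D * b) \<le> C * 2 powr (- a * l) * (real l + 1) powr (D * (a + b))"
proof -
  obtain M where M: "M > 0" "\<And>i::nat. (real i + 1) powr real D \<le> M * 2 powr (1 * i)"
    using powr_le_exp2[of 1 "real D"] by auto
  \<comment> \<open>Chosen so that \<open>l + 1 <= R * (n + 1)\<close>: the cut level is comparable
    with \<open>l\<close>, which is needed to replace \<open>n + 1\<close> by \<open>l + 1\<close>
    when the exponent \<open>D * b\<close> is negative.\<close>
  define R where "R = 3 + \<bar>log 2 M\<bar>"
  define C1 where "C1 = R powr (\<bar>D * b\<bar>)"
  define C where "C = 2 powr a * 2 powr (a * D) * C1"
  have "C > 0" by (simp add: C_def C1_def R_def)
  moreover have "\<exists>n\<le>l. 2 ^ n * (n + 1) ^ D \<le> (2::nat) ^ l \<and>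
    2 powr (- a * n) * (real n + 1) powr (D * b) \<le> C * 2 powr (- a * l) * (real l + 1) powr (D * (a + b))" for l
  proof -
    define n where "n = (GREATEST n. n \<le> l \<and> 2 ^ n * (n + 1) ^ D \<le> (2::nat) ^ l)"
    have n: "n \<le> l \<and> 2 ^ n * (n + 1) ^ D \<le> (2::nat) ^ l"
      unfolding n_def by (rule GreatestI_nat[where k = 0 and b = l]) auto
    \<comment> \<open>Maximality of \<open>n\<close> gives the reverse estimate with one level lost;
      if the cap \<open>n <= l\<close> is attained instead, it is trivial.\<close>
    have up: "2 ^ l \<le> 2 ^ (n + 1) * (n + 2) ^ D"
    proof (cases "n = l")
      case False
      have "\<not> (Suc n \<le> l \<and> 2 ^ Suc n * (Suc n + 1) ^ D \<le> (2::nat) ^ l)"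
      proof
        assume "Suc n \<le> l \<and> 2 ^ Suc n * (Suc n + 1) ^ D \<le> (2::nat) ^ l"
        then have "Suc n \<le> n" unfolding n_def by (intro Greatest_le_nat[where b = l]) auto
        then show False by simp
      qed
      then show ?thesis using n False by simp
    next
      case True
      have "(1::nat) ^ D \<le> (n + 2) ^ D" by (intro power_mono) auto
      then have "2 ^ n * 1 \<le> 2 ^ (n + 1) * (n + 2) ^ D" by (intro mult_mono) auto
      then show ?thesis using True by simp
    qed
    have "real (2 ^ l) \<le> real (2 ^ (n + 1) * (n + 2) ^ D)" using up by (simp only: of_nat_le_iff)
    then have up': "2 powr real l \<le> 2 powr (real n + 1) * (real n + 2) powr D"
      by (simp add: powr_realpow powr_add add_ac mult_ac)
    \<comment> \<open>Raising \<open>up'\<close> to the power \<open>a\<close> trades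
      \<open>2 powr (- a * n)\<close> for \<open>2 powr (- a * l)\<close> at the price
      \<open>(l + 1) powr (D * a)\<close>. Together with the factor from \<open>b\<close> this is
      the origin of the exponent \<open>D * (a + b)\<close>.\<close>
    have decay: "2 powr (- a * n) \<le> 2 powr a * 2 powr (a * D) * 2 powr (- a * l) * (real l + 1) powr (D * a)"
    proof -
      have "(2 powr real l) powr a \<le> (2 powr (real n + 1) * (real n + 2) powr D) powr a"
        using up' assms by (intro powr_mono2) auto
      then have "2 powr (a * l) \<le> 2 powr (a * n) * 2 powr a * (real n + 2) powr (D * a)"
        by (simp add: powr_powr powr_mult powr_add mult_ac distrib_left)
      also have "(real n + 2) powr (D * a) \<le> (2 * (real l + 1)) powr (D * a)"
        using n assms by (intro powr_mono2) auto
      also have "(2 * (real l + 1)) powr (D * a) = 2 powr (a * D) * (real l + 1) powr (D * a)"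
        using powr_mult[of 2 "real l + 1" "D * a"] by (simp only: mult.commute[of a])
      finally have *: "2 powr (a * l) \<le> 2 powr (a * n) * 2 powr a * (2 powr (a * D) * (real l + 1) powr (D * a))"
        by (simp add: mult_left_mono)
      show ?thesis using * by (simp add: powr_minus field_simps)
    qed
    have "log 2 (2 powr real l) \<le> log 2 (2 powr (real n + 1) * (M * 2 powr (real n + 1)))"
    proof -
      have "(real n + 2) powr D \<le> M * 2 powr (real n + 1)" using M(2)[of "Suc n"] by (simp add: add_ac)
      then have "2 powr real l \<le> 2 powr (real n + 1) * (M * 2 powr (real n + 1))"
        using up' by (meson mult_left_mono order_trans powr_ge_zero)
      then show ?thesis using M(1) by (subst log_le_cancel_iff) auto
    qed
    then have "real l \<le> 2 * real n + 2 + log 2 M" using M(1) by (simp add: log_mult)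
    moreover have "log 2 M \<le> \<bar>log 2 M\<bar> * (real n + 1)" using abs_ge_self[of "log 2 M"]
      by (metis abs_ge_zero add_increasing le_add_same_cancel2 mult.right_neutral mult_left_mono of_nat_0_le_iff order_trans)
    ultimately have lR: "real l + 1 \<le> R * (real n + 1)" by (simp add: R_def algebra_simps)
    have level: "(real n + 1) powr (D * b) \<le> C1 * (real l + 1) powr (D * b)"
    proof (cases "0 \<le> D * b")
      case True
      have "R powr (D * b) \<ge> 1" using True by (intro ge_one_powr_ge_zero) (auto simp: R_def)
      then have "1 * (real n + 1) powr (D * b) \<le> C1 * (real l + 1) powr (D * b)"
        using True n by (intro mult_mono powr_mono2) (auto simp: C1_def)
      then show ?thesis by simp
    next
      case False
      then have "(R * (real n + 1)) powr (D * b) \<le> (real l + 1) powr (D * b)"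
        using lR by (intro powr_mono2') auto
      then have "R powr (D * b) * (real n + 1) powr (D * b) \<le> (real l + 1) powr (D * b)"
        by (simp add: powr_mult R_def)
      moreover have C1: "C1 = 1 / R powr (D * b)" using False by (simp add: C1_def powr_minus_divide[symmetric])
      moreover have "R powr (D * b) > 0" by (simp add: R_def)
      ultimately show ?thesis unfolding C1 by (simp add: pos_le_divide_eq mult.commute)
    qed
    have "2 powr (- a * n) * (real n + 1) powr (D * b)
      \<le> (2 powr a * 2 powr (a * D) * 2 powr (- a * l) * (real l + 1) powr (D * a)) * (C1 * (real l + 1) powr (D * b))"
      using decay level by (intro mult_mono) auto
    also have "\<dots> = C * 2 powr (- a * l) * (real l + 1) powr (D * (a + b))"
      by (simp add: C_def distrib_left powr_add mult_ac)
    finally show ?thesis using n by blast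
  qed
  ultimately show ?thesis by blast
qed

text \<open>This is the sequence \<open>E l\<close> of the overview, with \<open>D\<close> for
  \<open>CARD('d) - 1\<close>. The \<open>L_p\<close> rate arises from it by the factor
  \<open>(2 ^ l) powr (- 1 / p)\<close>.\<close>

definition coeff_rate :: "nat \<Rightarrow> real \<Rightarrow> real \<Rightarrow> real \<Rightarrow> nat \<Rightarrow> real" where
  "coeff_rate D a b \<beta> l = 2 powr (l * (1 - 1 / \<beta> - a)) * (real l + 1) powr (D * (a + b))"

lemma coeff_rate_pos: "0 < coeff_rate D a b \<beta> l"
  by (simp add: coeff_rate_def)

definition layer_bounds :: "real \<Rightarrow> real \<Rightarrow> real \<Rightarrow> (int ^ 'd::finite \<Rightarrow> complex) \<Rightarrow> bool" where
  "layer_bounds a b \<beta> u \<longleftrightarrow> (\<forall>j. (\<Sum>k\<in>hyperbolic_layer j. norm (u k) powr \<beta>)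
     \<le> (2 powr (- a * j) * real (max j 1) powr (real (CARD('d) - 1) * b)) powr \<beta>)"

lemma sum_power2_le:
  fixes f :: "'a \<Rightarrow> real"
  assumes "\<And>i. i \<in> A \<Longrightarrow> 0 \<le> f i"
  shows "(\<Sum>i\<in>A. (f i)\<^sup>2) \<le> (\<Sum>i\<in>A. f i)\<^sup>2"
proof -
  have "sqrt (\<Sum>i\<in>A. (f i)\<^sup>2) \<le> (\<Sum>i\<in>A. f i)"
    using L2_set_le_sum[of A f] assms by (simp add: L2_set_def)
  then show ?thesis by (rule sqrt_le_D)
qed

lemma sum_by_levels_le:
  fixes h :: "int ^ 'd::finite \<Rightarrow> real"
  assumes "finite F" "\<And>k. k \<in> F \<Longrightarrow> n < freq_level k"
    and "\<And>j. n < j \<Longrightarrow> (\<Sum>k\<in>{k\<in>F. freq_level k = j}. h k) \<le> R j"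
  shows "\<exists>N. sum h F \<le> (\<Sum>j\<in>{n<..N}. R j)"
proof -
  define N where "N = Max (insert 0 (freq_level ` F))"
  have "freq_level ` F \<subseteq> {n<..N}" using assms(1,2) by (auto simp: N_def)
  then have "sum h F = (\<Sum>j\<in>{n<..N}. \<Sum>k\<in>{k\<in>F. freq_level k = j}. h k)"
    using assms(1) by (simp add: sum.group)
  also have "\<dots> \<le> (\<Sum>j\<in>{n<..N}. R j)" using assms(3) by (intro sum_mono) auto
  finally show ?thesis by blast
qed

text \<open>The norms off \<open>T\<close> are bounded through all finite sets disjoint from
  \<open>T\<close>. In this form the bounds involve no infinite sums and pass at once to
  \<open>Q - T\<close> and to its subsets.\<close>

definition sparse_part :: "real \<Rightarrow> real \<Rightarrow> nat \<Rightarrow> ('k \<Rightarrow> complex) \<Rightarrow> 'k set \<Rightarrow> bool" where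
  "sparse_part C e l u T \<longleftrightarrow> real (card T) \<le> C * 2 ^ l \<and> (\<forall>F. finite F \<and> F \<inter> T = {} \<longrightarrow>
     (\<Sum>k\<in>F. norm (u k)) \<le> C * e \<and> (\<Sum>k\<in>F. (norm (u k))\<^sup>2) \<le> (C * e)\<^sup>2 / 2 ^ l)"

lemma sparse_part_mono:
  assumes "sparse_part C e l u T" "0 \<le> C" "C \<le> C'" "0 \<le> e"
  shows "sparse_part C' e l u T"
proof -
  have Ce: "0 \<le> C * e" "C * e \<le> C' * e" using assms by (auto intro: mult_right_mono)
  then have "(C * e)\<^sup>2 / 2 ^ l \<le> (C' * e)\<^sup>2 / 2 ^ l" by (intro divide_right_mono power_mono) auto
  moreover have "C * 2 ^ l \<le> C' * 2 ^ l" using assms(3) by (intro mult_right_mono) auto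
  ultimately show ?thesis using assms(1) Ce(2) unfolding sparse_part_def by (meson order_trans)
qed

text \<open>The part kept consists of all frequencies up to a cut level \<open>n\<close> and, in a
  layer \<open>j > n\<close>, of the coefficients above the threshold with budget
  \<open>y j = 2 ^ l * 2 powr (- \<kappa> * (j - n))\<close>. The budgets form a geometric series,
  so a multiple of \<open>2 ^ l\<close> terms suffices. They fall below 1 once \<open>j - n\<close>
  exceeds \<open>l / \<kappa>\<close>, so nothing is kept beyond a level proportional to
  \<open>l\<close>; this is why one finite set of frequencies can contain all the parts.\<close>

lemma sparse_approximation:
  fixes a b \<beta> :: real
  assumes "0 < a" "0 < \<beta>" "\<beta> \<le> 1"
  shows "\<exists>C\<ge>1. \<exists>A::nat. \<forall>u :: int ^ 'd::finite \<Rightarrow> complex. layer_bounds a b \<beta> u \<longrightarrow>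
    (\<forall>l. \<exists>T \<subseteq> {k. freq_level k \<le> A * l}. sparse_part C (coeff_rate (CARD('d) - 1) a b \<beta> l) l u T)"
proof -
  define D where "D = CARD('d) - 1"
  \<comment> \<open>Reducing the budget at the rate \<kappa> raises the \<open>q\<close>-th power
    sum of layer \<open>j\<close> by \<open>2 powr (\<kappa> * (q / \<beta> - 1) * (j - n))\<close>.
    With this \<kappa> the exponent stays below \<open>a / 2 * q * (j - n)\<close>, that is, half of
    the smoothness.\<close>
  define \<kappa> where "\<kappa> = a * \<beta> / 2"
  have \<kappa>: "\<kappa> > 0" using assms by (simp add: \<kappa>_def)
  obtain C1 where C1: "C1 > 0" "\<And>n N. (\<Sum>j\<in>{n<..N}. 2 powr (- a * j) * real (max j 1) powr (D * b) * 2 powr (a / 2 * (real j - real n)))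
    \<le> C1 * 2 powr (- a * n) * (real n + 1) powr (D * b)"
    using sum_weighted_tail_le[OF assms(1), of "D * b"] by blast
  obtain C2 where C2: "C2 > 0" "\<And>l. \<exists>n\<le>l. 2 ^ n * (n + 1) ^ D \<le> (2::nat) ^ l \<and>
    2 powr (- a * n) * (real n + 1) powr (D * b) \<le> C2 * 2 powr (- a * l) * (real l + 1) powr (D * (a + b))"
    using cut_level[OF assms(1), of D b] by blast
  define C where "C = 3 + 1 / (1 - 2 powr (- \<kappa>)) + C1 * C2"
  have q\<kappa>: "2 powr (- \<kappa>) < 1" using \<kappa> by (simp add: powr_less_one)
  then have inv\<kappa>: "1 / (1 - 2 powr (- \<kappa>)) > 0" by simp
  have C_ge: "C \<ge> 1" "C \<ge> C1 * C2" "C \<ge> 2 + 1 / (1 - 2 powr (- \<kappa>))"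
    using C1(1) C2(1) inv\<kappa> mult_pos_pos[OF C1(1) C2(1)] unfolding C_def by linarith+
  define A where "A = Suc (nat \<lceil>1 / \<kappa>\<rceil>)"
  have "\<exists>T \<subseteq> {k. freq_level k \<le> A * l}. sparse_part C (coeff_rate D a b \<beta> l) l u T"
    if u: "layer_bounds a b \<beta> u" for u :: "int ^ 'd \<Rightarrow> complex" and l
  proof -
    obtain n where n: "n \<le> l" "2 ^ n * (n + 1) ^ D \<le> (2::nat) ^ l"
      "2 powr (- a * n) * (real n + 1) powr (D * b) \<le> C2 * 2 powr (- a * l) * (real l + 1) powr (D * (a + b))"
      using C2(2) by blast
    define B where "B j = 2 powr (- a * j) * real (max j 1) powr (D * b)" for j :: nat
    define y where "y j = 2 powr l * 2 powr (- \<kappa> * (real j - real n))" for j :: nat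
    define r where "r j = B j * y j powr (- 1 / \<beta>)" for j
    have B: "B j > 0" and y: "y j > 0" for j by (simp_all add: B_def y_def)
    have uB: "(\<Sum>k\<in>hyperbolic_layer j. norm (u k) powr \<beta>) \<le> B j powr \<beta>" for j
      using u by (simp add: layer_bounds_def B_def D_def)
    have card_big: "real (card {k\<in>hyperbolic_layer j. r j < norm (u k)}) \<le> y j" for j
      unfolding r_def by (rule threshold_split(1)[OF finite_hyperbolic_layer uB B y assms(2)])
    have sum_small: "(\<Sum>k\<in>{k\<in>hyperbolic_layer j. norm (u k) \<le> r j}. norm (u k) powr q) \<le> B j powr q * y j powr (1 - q / \<beta>)"
      if "\<beta> \<le> q" for j q
      unfolding r_def by (rule threshold_split(2)[OF finite_hyperbolic_layer uB B y assms(2) that])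
    have fin_j: "finite {k \<in> hyperbolic_layer j. P k}" for j and P :: "int ^ 'd \<Rightarrow> bool"
      by (rule finite_subset[OF _ finite_hyperbolic_layer]) auto
    define T where "T = {k. freq_level k \<le> n} \<union> {k. n < freq_level k \<and> r (freq_level k) < norm (u k)}"
    have T_level: "freq_level k \<le> A * l" if "k \<in> T" for k
    proof (cases "freq_level k \<le> n")
      case True
      then show ?thesis using n(1) by (simp add: A_def)
    next
      case False
      define j where "j = freq_level k"
      have k: "k \<in> {k\<in>hyperbolic_layer j. r j < norm (u k)}" using False that by (auto simp: T_def j_def hyperbolic_layer_eq)
      moreover have "finite {k\<in>hyperbolic_layer j. r j < norm (u k)}" by (rule fin_j)
      ultimately have "1 \<le> card {k\<in>hyperbolic_layer j. r j < norm (u k)}" by (metis One_nat_def Suc_leI card_gt_0_iff empty_iff)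
      \<comment> \<open>A coefficient that is kept makes an integer count positive, so the budget of
        its layer is at least 1, which bounds the level.\<close>
      then have "1 \<le> y j" using card_big[of j] by linarith
      then have "2 powr 0 \<le> 2 powr (real l - \<kappa> * (real j - real n))" by (simp add: y_def powr_add[symmetric])
      then have "\<kappa> * (real j - real n) \<le> real l" by (subst (asm) powr_le_cancel_iff) auto
      then have "real j - real n \<le> real l * (1 / \<kappa>)" using \<kappa> by (simp add: field_simps)
      also have "\<dots> \<le> real l * real (nat \<lceil>1 / \<kappa>\<rceil>)" by (intro mult_left_mono real_nat_ceiling_ge) auto
      finally have "real j \<le> real l + real l * real (nat \<lceil>1 / \<kappa>\<rceil>)" using n(1) by linarith
      then have "real j \<le> real (A * l)" by (simp add: A_def algebra_simps)
      then show ?thesis unfolding j_def of_nat_le_iff .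
    qed
    have finT: "finite T" by (rule finite_subset[OF _ finite_freq_level_le[of "A * l"]]) (use T_level in blast)
    have card_T: "real (card T) \<le> C * 2 ^ l"
    proof -
      let ?T1 = "{k :: int ^ 'd. freq_level k \<le> n}" let ?T2 = "{k. n < freq_level k \<and> r (freq_level k) < norm (u k)}"
      have fin2: "finite ?T2" using finT by (simp add: T_def)
      have "card ?T1 \<le> 2 * 2 ^ l"
      proof -
        have "?T1 = (\<Union>j\<le>n. hyperbolic_layer j)" by (auto simp: hyperbolic_layer_eq)
        then have "card ?T1 \<le> (\<Sum>j\<le>n. card (hyperbolic_layer j :: (int ^ 'd) set))"
          using card_UN_le[of "{..n}" "\<lambda>j. hyperbolic_layer j :: (int ^ 'd) set"] by simp
        also have "\<dots> \<le> (\<Sum>j\<le>n. 2 ^ j * (n + 1) ^ D)"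
        proof (rule sum_mono)
          fix j assume "j \<in> {..n}"
          then have "2 ^ j * (j + 1) ^ D \<le> 2 ^ j * (n + 1) ^ D" by (intro mult_left_mono power_mono) auto
          then show "card (hyperbolic_layer j :: (int ^ 'd) set) \<le> 2 ^ j * (n + 1) ^ D"
            using card_hyperbolic_layer[of j, where 'd = 'd] unfolding D_def by (rule order_trans[rotated])
        qed
        also have "\<dots> = (\<Sum>j<Suc n. 2 ^ j) * (n + 1) ^ D" by (simp add: sum_distrib_right distrib_right lessThan_Suc_atMost)
        also have "\<dots> = (2 ^ Suc n - 1) * (n + 1) ^ D" by (simp only: sum_power2 lessThan_atLeast0)
        also have "\<dots> \<le> 2 ^ Suc n * (n + 1) ^ D" by (intro mult_right_mono) auto
        also have "\<dots> \<le> 2 * 2 ^ l" using n(2) by simp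
        finally show ?thesis .
      qed
      from of_nat_mono[OF this, where 'a = real] have c1: "real (card ?T1) \<le> 2 * 2 ^ l" by simp
      have "\<exists>N. (\<Sum>k\<in>?T2. 1 :: real) \<le> (\<Sum>j\<in>{n<..N}. y j)"
      proof (rule sum_by_levels_le[OF fin2])
        fix j assume "n < j"
        have "(\<Sum>k\<in>{k\<in>?T2. freq_level k = j}. 1 :: real) \<le> real (card {k\<in>hyperbolic_layer j. r j < norm (u k)})"
          using fin_j[of j "\<lambda>k. r j < norm (u k)"] by (simp add: hyperbolic_layer_eq) (rule card_mono, auto)
        also have "\<dots> \<le> y j" by (rule card_big)
        finally show "(\<Sum>k\<in>{k\<in>?T2. freq_level k = j}. 1 :: real) \<le> y j" .
      qed auto
      then obtain N where "real (card ?T2) \<le> (\<Sum>j\<in>{n<..N}. y j)" by auto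
      also have "\<dots> = (\<Sum>i\<in>(\<lambda>j. j - n) ` {n<..N}. 2 powr l * 2 powr (- \<kappa> * real i))"
        by (subst sum.reindex) (auto simp: inj_on_def y_def of_nat_diff intro!: sum.cong)
      also have "\<dots> \<le> (\<Sum>i<Suc N. 2 powr l * 2 powr (- \<kappa> * real i))" by (intro sum_mono2) auto
      also have "\<dots> = 2 powr l * (\<Sum>i<Suc N. 2 powr (- \<kappa> * real i))" by (simp only: sum_distrib_left)
      also have "\<dots> \<le> 2 powr l * (1 / (1 - 2 powr (- \<kappa>)))" by (intro mult_left_mono sum_geometric_powr_le \<kappa>) auto
      finally have c2: "real (card ?T2) \<le> 2 ^ l * (1 / (1 - 2 powr (- \<kappa>)))" by (simp add: powr_realpow)
      have "real (card T) \<le> real (card ?T1) + real (card ?T2)" unfolding T_def using card_Un_le[of ?T1 ?T2] by linarith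
      also have "\<dots> \<le> (2 + 1 / (1 - 2 powr (- \<kappa>))) * 2 ^ l" using c1 c2 by (simp add: algebra_simps)
      also have "\<dots> \<le> C * 2 ^ l" using C_ge(3) by (intro mult_right_mono) auto
      finally show ?thesis .
    qed
    define X where "X j = B j * 2 powr (a / 2 * (real j - real n))" for j
    have X: "X j > 0" for j using B by (simp add: X_def)
    define G where "G = C1 * C2 * (2 powr (- a * l) * (real l + 1) powr (D * (a + b)))"
    have G0: "0 \<le> G" using C1(1) C2(1) by (simp add: G_def)
    have sumX: "(\<Sum>j\<in>{n<..N}. X j) \<le> G" for N
    proof -
      have "(\<Sum>j\<in>{n<..N}. X j) \<le> C1 * (2 powr (- a * n) * (real n + 1) powr (D * b))"
        unfolding X_def B_def using C1(2)[of n N] by (simp add: mult_ac)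
      also have "\<dots> \<le> C1 * (C2 * 2 powr (- a * l) * (real l + 1) powr (D * (a + b)))"
        using n(3) C1(1) by (intro mult_left_mono) auto
      finally show ?thesis by (simp add: G_def mult_ac)
    qed
    \<comment> \<open>The estimate separates the gain from keeping about \<open>2 ^ l\<close> terms
      from the quantities \<open>X j\<close>, whose sum over the layers is at most
      \<open>G\<close>.\<close>
    have small: "B j powr q * y j powr (1 - q / \<beta>) \<le> 2 powr (l * (1 - q / \<beta>)) * X j powr q"
      if "q \<in> {1, 2}" "n < j" for j q
    proof -
      have "y j powr (1 - q / \<beta>) = 2 powr (l * (1 - q / \<beta>)) * 2 powr (\<kappa> * (q / \<beta> - 1) * (real j - real n))"
      proof -
        define x e where "x = real j - real n" and "e = 1 - q / \<beta>"
        have "(real l + - \<kappa> * x) * e = real l * e + \<kappa> * (q / \<beta> - 1) * x" by (simp add: e_def algebra_simps)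
        then show ?thesis unfolding y_def powr_add[symmetric] powr_powr x_def e_def by (rule arg_cong)
      qed
      moreover have "2 powr (\<kappa> * (q / \<beta> - 1) * (real j - real n)) \<le> 2 powr (a / 2 * q * (real j - real n))"
      proof -
        have "\<kappa> * (q / \<beta> - 1) = a / 2 * q - \<kappa>" using assms(2) by (simp add: \<kappa>_def field_simps)
        then show ?thesis using that(2) \<kappa> by (intro powr_mono mult_right_mono) auto
      qed
      ultimately have "y j powr (1 - q / \<beta>) \<le> 2 powr (l * (1 - q / \<beta>)) * 2 powr (a / 2 * q * (real j - real n))"
        by (simp add: mult_left_mono)
      then have "B j powr q * y j powr (1 - q / \<beta>) \<le> B j powr q * (2 powr (l * (1 - q / \<beta>)) * 2 powr (a / 2 * q * (real j - real n)))"
        by (intro mult_left_mono) auto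
      also have "\<dots> = 2 powr (l * (1 - q / \<beta>)) * X j powr q"
        using B by (simp add: X_def powr_mult powr_powr mult_ac)
      finally show ?thesis .
    qed
    have tail: "\<exists>N. (\<Sum>k\<in>F. norm (u k) powr q) \<le> (\<Sum>j\<in>{n<..N}. 2 powr (l * (1 - q / \<beta>)) * X j powr q)"
      if F: "finite F" "F \<inter> T = {}" and q: "q \<in> {1, 2}" for F q
    proof (rule sum_by_levels_le[OF F(1)])
      show "n < freq_level k" if "k \<in> F" for k using that F(2) by (force simp: T_def)
      fix j assume j: "n < j"
      have "(\<Sum>k\<in>{k\<in>F. freq_level k = j}. norm (u k) powr q)
        \<le> (\<Sum>k\<in>{k\<in>hyperbolic_layer j. norm (u k) \<le> r j}. norm (u k) powr q)"
      proof (rule sum_mono2[OF fin_j])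
        show "{k \<in> F. freq_level k = j} \<subseteq> {k \<in> hyperbolic_layer j. norm (u k) \<le> r j}"
          using F(2) j by (auto simp: T_def hyperbolic_layer_eq disjoint_iff not_less)
      qed auto
      also have "\<dots> \<le> B j powr q * y j powr (1 - q / \<beta>)" using q assms(3) by (intro sum_small) auto
      also have "\<dots> \<le> 2 powr (l * (1 - q / \<beta>)) * X j powr q" using q j by (rule small)
      finally show "(\<Sum>k\<in>{k\<in>F. freq_level k = j}. norm (u k) powr q) \<le> 2 powr (l * (1 - q / \<beta>)) * X j powr q" .
    qed
    have rate: "2 powr (l * (1 - 1 / \<beta>)) * G \<le> C * coeff_rate D a b \<beta> l"
    proof -
      have "2 powr (l * (1 - 1 / \<beta>)) * G = C1 * C2 * coeff_rate D a b \<beta> l"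
      proof -
        have "2 powr (l * (1 - 1 / \<beta>)) * 2 powr (- a * l) = 2 powr (l * (1 - 1 / \<beta> - a))"
          by (simp add: powr_add[symmetric] algebra_simps)
        then show ?thesis unfolding G_def coeff_rate_def by (simp add: mult_ac)
      qed
      also have "\<dots> \<le> C * coeff_rate D a b \<beta> l" by (intro mult_right_mono C_ge(2) less_imp_le coeff_rate_pos)
      finally show ?thesis .
    qed
    have "(\<Sum>k\<in>F. norm (u k)) \<le> C * coeff_rate D a b \<beta> l \<and>
        (\<Sum>k\<in>F. (norm (u k))\<^sup>2) \<le> (C * coeff_rate D a b \<beta> l)\<^sup>2 / 2 ^ l" if F: "finite F" "F \<inter> T = {}" for F
    proof
      obtain N where "(\<Sum>k\<in>F. norm (u k) powr 1) \<le> (\<Sum>j\<in>{n<..N}. 2 powr (l * (1 - 1 / \<beta>)) * X j powr 1)"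
        using tail[OF F, of 1] by auto
      then have "(\<Sum>k\<in>F. norm (u k)) \<le> 2 powr (l * (1 - 1 / \<beta>)) * (\<Sum>j\<in>{n<..N}. X j)"
        using X by (simp add: sum_distrib_left less_imp_le)
      also have "\<dots> \<le> 2 powr (l * (1 - 1 / \<beta>)) * G" using sumX by (intro mult_left_mono) auto
      also note rate
      finally show "(\<Sum>k\<in>F. norm (u k)) \<le> C * coeff_rate D a b \<beta> l" .
      obtain N where "(\<Sum>k\<in>F. norm (u k) powr 2) \<le> (\<Sum>j\<in>{n<..N}. 2 powr (l * (1 - 2 / \<beta>)) * X j powr 2)"
        using tail[OF F, of 2] by auto
      then have "(\<Sum>k\<in>F. (norm (u k))\<^sup>2) \<le> 2 powr (l * (1 - 2 / \<beta>)) * (\<Sum>j\<in>{n<..N}. (X j)\<^sup>2)"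
        using X by (simp add: sum_distrib_left less_imp_le)
      \<comment> \<open>The square of the sum is generous, but it lets the estimate of the sum of
        the \<open>X j\<close> serve for the squares as well.\<close>
      also have "\<dots> \<le> 2 powr (l * (1 - 2 / \<beta>)) * (\<Sum>j\<in>{n<..N}. X j)\<^sup>2"
        using X by (intro mult_left_mono) (simp_all add: sum_power2_le less_imp_le)
      also have "\<dots> \<le> 2 powr (l * (1 - 2 / \<beta>)) * G\<^sup>2"
        using sumX X by (intro mult_left_mono power_mono sum_nonneg) (auto intro: less_imp_le)
      also have "\<dots> = (2 powr (l * (1 - 1 / \<beta>)) * G)\<^sup>2 / 2 ^ l"
      proof -
        have "2 powr (l * (1 - 2 / \<beta>)) = (2 powr (l * (1 - 1 / \<beta>)))\<^sup>2 / 2 powr l"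
          by (simp add: power2_eq_square powr_add[symmetric] powr_diff[symmetric] algebra_simps)
        then show ?thesis by (simp add: power_mult_distrib powr_realpow)
      qed
      also have "\<dots> \<le> (C * coeff_rate D a b \<beta> l)\<^sup>2 / 2 ^ l"
        using rate G0 by (intro divide_right_mono power_mono) auto
      finally show "(\<Sum>k\<in>F. (norm (u k))\<^sup>2) \<le> (C * coeff_rate D a b \<beta> l)\<^sup>2 / 2 ^ l" .
    qed
    then show ?thesis using T_level card_T by (intro exI[of _ T]) (auto simp: sparse_part_def)
  qed
  then show ?thesis using C_ge(1) unfolding D_def by blast
qed

text \<open>Thresholding with the budget \<open>1/2\<close>: a set with at most half an element is
  empty, so all coefficients are below the threshold and the second bound with \<open>q = 1\<close>
  covers the whole layer. This is the embedding of l_\<beta> into l_1, up to a constant.\<close>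

lemma layer_l1_le:
  fixes u :: "int ^ 'd::finite \<Rightarrow> complex"
  assumes "layer_bounds a b \<beta> u" "0 < \<beta>" "\<beta> \<le> 1"
  shows "(\<Sum>k\<in>hyperbolic_layer j. norm (u k))
    \<le> (1/2) powr (1 - 1 / \<beta>) * (2 powr (- a * j) * real (max j 1) powr (real (CARD('d) - 1) * b))"
proof -
  define B where "B = 2 powr (- a * j) * real (max j 1) powr (real (CARD('d) - 1) * b)"
  have B: "B > 0" by (simp add: B_def)
  have uB: "(\<Sum>k\<in>hyperbolic_layer j. norm (u k) powr \<beta>) \<le> B powr \<beta>"
    using assms(1) by (simp add: layer_bounds_def B_def)
  let ?r = "B * (1/2) powr (- 1 / \<beta>)"
  note split = threshold_split[OF finite_hyperbolic_layer uB B _ assms(2), of "1/2"]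
  have "real (card {k\<in>hyperbolic_layer j. ?r < norm (u k)}) \<le> 1/2" by (rule split(1)) simp
  then have "card {k\<in>hyperbolic_layer j. ?r < norm (u k)} = 0" by linarith
  moreover have "finite {k\<in>hyperbolic_layer j. ?r < norm (u k)}"
    by (rule finite_subset[OF _ finite_hyperbolic_layer]) auto
  ultimately have "{k\<in>hyperbolic_layer j. ?r < norm (u k)} = {}" by simp
  then have eq: "{k\<in>hyperbolic_layer j. norm (u k) \<le> ?r} = hyperbolic_layer j" by fastforce
  have "(\<Sum>k\<in>{k\<in>hyperbolic_layer j. norm (u k) \<le> ?r}. norm (u k) powr 1) \<le> B powr 1 * (1/2) powr (1 - 1 / \<beta>)"
    by (rule split(2)) (use assms in auto)
  then show ?thesis unfolding eq using B by (simp add: B_def mult.commute)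
qed

text \<open>Half of the decay in the level absorbs the logarithmic factor, and \<open>A\<close> is
  so large that the other half is at most \<open>2 powr (- (1 / \<beta> + a + 1) * l)\<close>. This
  is smaller than the power of 2 in \<open>coeff_rate\<close> by two factors \<open>2 ^ l\<close>:
  one is the divisor in the claim, the other compensates for the power of \<open>l + 1\<close> in
  \<open>coeff_rate\<close>, which may be small.\<close>

lemma high_frequency_tail:
  fixes a b \<beta> :: real
  assumes "0 < a" "0 < \<beta>" "\<beta> \<le> 1"
  shows "\<exists>C>0. \<exists>A::nat. \<forall>u :: int ^ 'd::finite \<Rightarrow> complex. layer_bounds a b \<beta> u \<longrightarrow>
    (\<forall>L l F. l \<le> L \<and> finite F \<and> (\<forall>k\<in>F. A * (L + 1) < freq_level k) \<longrightarrow>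
      (\<Sum>k\<in>F. norm (u k)) \<le> C * coeff_rate (CARD('d) - 1) a b \<beta> l / 2 ^ l)"
proof -
  define D where "D = CARD('d) - 1"
  obtain C1 where C1: "C1 > 0" "\<And>n N. (\<Sum>j\<in>{n<..N}. 2 powr (- a * j) * real (max j 1) powr (D * b) * 2 powr (a / 2 * (real j - real n)))
    \<le> C1 * 2 powr (- a * n) * (real n + 1) powr (D * b)"
    using sum_weighted_tail_le[OF assms(1), of "D * b"] by blast
  obtain M where M: "M > 0" "\<And>i::nat. (real i + 1) powr (D * b) \<le> M * 2 powr (a / 2 * i)"
    using powr_le_exp2[of "a / 2" "D * b"] assms by auto
  obtain M' where M': "M' > 0" "\<And>i::nat. (real i + 1) powr (- (D * (a + b))) \<le> M' * 2 powr (1 * i)"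
    using powr_le_exp2[of 1 "- (D * (a + b))"] by auto
  define A where "A = nat \<lceil>2 * (1 / \<beta> + a + 1) / a\<rceil>"
  define c where "c = (1/2) powr (1 - 1 / \<beta>)"
  have c: "c > 0" by (simp add: c_def)
  define C where "C = c * C1 * M * M'"
  have "C > 0" using c C1 M M' by (simp add: C_def)
  moreover have "(\<Sum>k\<in>F. norm (u k)) \<le> C * coeff_rate D a b \<beta> l / 2 ^ l"
    if u: "layer_bounds a b \<beta> u" and l: "l \<le> L" and F: "finite F" "\<And>k. k \<in> F \<Longrightarrow> A * (L + 1) < freq_level k"
    for u :: "int ^ 'd \<Rightarrow> complex" and L l F
  proof -
    define n where "n = A * (L + 1)"
    define B where "B j = 2 powr (- a * j) * real (max j 1) powr (D * b)" for j :: nat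
    have "\<exists>N. (\<Sum>k\<in>F. norm (u k)) \<le> (\<Sum>j\<in>{n<..N}. c * B j)"
    proof (rule sum_by_levels_le[OF F(1)])
      show "n < freq_level k" if "k \<in> F" for k using F(2)[OF that] by (simp add: n_def)
      fix j assume "n < j"
      have "(\<Sum>k\<in>{k\<in>F. freq_level k = j}. norm (u k)) \<le> (\<Sum>k\<in>hyperbolic_layer j. norm (u k))"
        by (rule sum_mono2[OF finite_hyperbolic_layer]) (auto simp: hyperbolic_layer_eq)
      also have "\<dots> \<le> c * B j" using layer_l1_le[OF u assms(2,3)] by (simp add: c_def B_def D_def)
      finally show "(\<Sum>k\<in>{k\<in>F. freq_level k = j}. norm (u k)) \<le> c * B j" .
    qed
    then obtain N where "(\<Sum>k\<in>F. norm (u k)) \<le> c * (\<Sum>j\<in>{n<..N}. B j)" by (auto simp: sum_distrib_left)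
    also have "(\<Sum>j\<in>{n<..N}. B j) \<le> (\<Sum>j\<in>{n<..N}. B j * 2 powr (a / 2 * (real j - real n)))"
    proof (rule sum_mono)
      fix j assume "j \<in> {n<..N}"
      then have "1 \<le> 2 powr (a / 2 * (real j - real n))" using assms(1) by (intro ge_one_powr_ge_zero) auto
      then have "B j * 1 \<le> B j * 2 powr (a / 2 * (real j - real n))" by (intro mult_left_mono) (auto simp: B_def)
      then show "B j \<le> B j * 2 powr (a / 2 * (real j - real n))" by simp
    qed
    also have "\<dots> \<le> C1 * 2 powr (- a * n) * (real n + 1) powr (D * b)" unfolding B_def by (rule C1(2))
    also have "\<dots> \<le> C1 * 2 powr (- a * n) * (M * 2 powr (a / 2 * n))" using M C1(1) by (intro mult_left_mono) auto
    also have "\<dots> = C1 * M * (2 powr (- a * n) * 2 powr (a / 2 * n))" by (simp only: mult_ac)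
    also have "2 powr (- a * n) * 2 powr (a / 2 * n) = 2 powr (- (a / 2) * n)"
      unfolding powr_add[symmetric] by (rule arg_cong[of _ _ "\<lambda>e. 2 powr e"]) (simp add: field_simps)
    also have "\<dots> \<le> 2 powr (l * (1 - 1 / \<beta> - a) - 2 * real l)"
    proof (intro powr_mono)
      have "2 * (1 / \<beta> + a + 1) / a \<le> real A" unfolding A_def by (rule real_nat_ceiling_ge)
      then have w: "1 / \<beta> + a + 1 \<le> a / 2 * real A" using assms(1) by (simp add: field_simps)
      have "(1 / \<beta> + a + 1) * real l \<le> (a / 2 * real A) * (real L + 1)"
        using w l assms by (intro mult_mono) auto
      moreover have "real l * (1 - 1 / \<beta> - a) - 2 * real l = - ((1 / \<beta> + a + 1) * real l)"
        by (simp add: algebra_simps)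
      moreover have "- (a / 2) * real n = - ((a / 2 * real A) * (real L + 1))" by (simp add: n_def algebra_simps)
      ultimately show "- (a / 2) * real n \<le> real l * (1 - 1 / \<beta> - a) - 2 * real l" by linarith
    qed simp
    finally have 1: "(\<Sum>k\<in>F. norm (u k)) \<le> c * (C1 * M * 2 powr (l * (1 - 1 / \<beta> - a) - 2 * real l))"
      using c C1 M by (simp add: mult_left_mono)
    have "1 \<le> M' * 2 powr l * (real l + 1) powr (D * (a + b))"
    proof -
      have "(real l + 1) powr (- (D * (a + b))) * (real l + 1) powr (D * (a + b)) = 1" by (simp flip: powr_add)
      then show ?thesis using mult_right_mono[OF M'(2)[of l], of "(real l + 1) powr (D * (a + b))"]
        by (simp only: powr_ge_zero mult_1)
    qed
    then have "2 powr (l * (1 - 1 / \<beta> - a) - 2 * real l) * 1 \<le> 2 powr (l * (1 - 1 / \<beta> - a) - 2 * real l) * (M' * 2 powr l * (real l + 1) powr (D * (a + b)))"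
      by (intro mult_left_mono) auto
    also have "\<dots> = M' * (real l + 1) powr (D * (a + b)) * (2 powr (l * (1 - 1 / \<beta> - a) - 2 * real l) * 2 powr l)"
      by (simp only: mult_ac)
    also have "2 powr (l * (1 - 1 / \<beta> - a) - 2 * real l) * 2 powr l = 2 powr (l * (1 - 1 / \<beta> - a)) / 2 powr l"
      unfolding powr_add[symmetric] powr_diff[symmetric] by simp
    finally have 2: "2 powr (l * (1 - 1 / \<beta> - a) - 2 * real l) \<le> M' * (coeff_rate D a b \<beta> l / 2 ^ l)"
      by (simp add: coeff_rate_def powr_realpow mult_ac)
    have "c * (C1 * M * 2 powr (l * (1 - 1 / \<beta> - a) - 2 * real l)) \<le> c * (C1 * M * (M' * (coeff_rate D a b \<beta> l / 2 ^ l)))"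
      using 2 c C1 M by (intro mult_left_mono) auto
    with 1 show ?thesis by (simp add: C_def mult_ac)
  qed
  ultimately show ?thesis unfolding D_def by (intro exI[of _ C] exI[of _ A] conjI allI impI) auto
qed

lemma W_class_coeffs:
  assumes "f \<in> (W_class a b \<beta> :: (real ^ 'd::finite \<Rightarrow> complex) set)" "0 < \<beta>"
  obtains u :: "int ^ 'd \<Rightarrow> complex" where "(\<lambda>k. norm (u k)) summable_on UNIV"
    "\<And>x. f x = (\<Sum>\<^sub>\<infinity>k. u k * trig k x)" "layer_bounds a b \<beta> u"
proof -
  obtain u :: "int ^ 'd \<Rightarrow> complex" where u: "(\<lambda>k. norm (u k)) summable_on UNIV"
    "\<And>x. f x = (\<Sum>\<^sub>\<infinity>k. u k * trig k x)"
    "\<And>j. layer_quasinorm \<beta> j u \<le> 2 powr (- a * real j) * real (max j 1) powr ((real CARD('d) - 1) * b)"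
    using assms(1) by (auto simp: W_class_def)
  have D: "real (CARD('d) - 1) = real CARD('d) - 1" by (simp add: of_nat_diff Suc_leI)
  have "(\<Sum>k\<in>hyperbolic_layer j. norm (u k) powr \<beta>)
     \<le> (2 powr (- a * j) * real (max j 1) powr ((real CARD('d) - 1) * b)) powr \<beta>" for j
  proof -
    have nn: "0 \<le> (\<Sum>k\<in>hyperbolic_layer j. norm (u k) powr \<beta>)" by (intro sum_nonneg) auto
    then have "(\<Sum>k\<in>hyperbolic_layer j. norm (u k) powr \<beta>) = layer_quasinorm \<beta> j u powr \<beta>"
      using assms(2) by (simp add: layer_quasinorm_def powr_powr)
    also have "\<dots> \<le> (2 powr (- a * j) * real (max j 1) powr ((real CARD('d) - 1) * b)) powr \<beta>"
      using u(3) assms(2) by (intro powr_mono2) (auto simp: layer_quasinorm_def)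
    finally show ?thesis .
  qed
  then have "layer_bounds a b \<beta> u" unfolding layer_bounds_def D by blast
  with u(1,2) show ?thesis by (rule that)
qed

section \<open>The trigonometric system on the torus and on grids\<close>

lemma norm_trig [simp]: "norm (trig k x) = 1"
  unfolding trig_def by (simp only: norm_exp_i_times)

lemma trig_mult_cnj: "trig k x * cnj (trig l x) = trig (k - l) x"
proof -
  have "cnj (trig l x) = exp (- (\<i> * complex_of_real (\<Sum>j\<in>UNIV. real_of_int (l $ j) * x $ j)))"
    unfolding trig_def exp_cnj by simp
  then show ?thesis unfolding trig_def
    by (simp add: exp_add[symmetric] sum_subtractf left_diff_distrib right_diff_distrib)
qed

lemma trig_series_approx:
  fixes u :: "int ^ 'd::finite \<Rightarrow> complex"
  assumes u: "(\<lambda>k. norm (u k)) summable_on UNIV" and Q: "finite Q"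
    and tail: "\<And>F. finite F \<Longrightarrow> F \<inter> Q = {} \<Longrightarrow> (\<Sum>k\<in>F. norm (u k)) \<le> \<tau>"
  shows "norm ((\<Sum>\<^sub>\<infinity>k. u k * trig k x) - (\<Sum>k\<in>Q. u k * trig k x)) \<le> \<tau>"
proof -
  have ab: "(\<lambda>k. norm (u k * trig k x)) summable_on S" for S
    using summable_on_subset_banach[OF u, of S] by (simp add: norm_mult)
  then have s: "(\<lambda>k. u k * trig k x) summable_on S" for S by (rule abs_summable_summable)
  have "(\<Sum>\<^sub>\<infinity>k\<in>Q \<union> - Q. u k * trig k x) = (\<Sum>\<^sub>\<infinity>k\<in>Q. u k * trig k x) + (\<Sum>\<^sub>\<infinity>k\<in>-Q. u k * trig k x)"
    by (rule infsum_Un_disjoint) (use s in auto)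
  then have "(\<Sum>\<^sub>\<infinity>k. u k * trig k x) - (\<Sum>k\<in>Q. u k * trig k x) = (\<Sum>\<^sub>\<infinity>k\<in>-Q. u k * trig k x)"
    using Q by (simp add: Compl_partition)
  also have "norm \<dots> \<le> (\<Sum>\<^sub>\<infinity>k\<in>-Q. norm (u k * trig k x))" by (rule norm_infsum_bound[OF ab])
  also have "\<dots> \<le> \<tau>"
    by (rule infsum_le_finite_sums[OF ab]) (use tail in \<open>auto simp: norm_mult\<close>)
  finally show ?thesis .
qed

text \<open>Fubini's theorem in coordinates. \<open>lborel\<close> on \<open>real ^ 'd\<close> is
  the image of a product measure indexed by \<open>Basis\<close>, so most of the proof translates
  the basis vectors \<open>axis j 1\<close> into the indices \<open>j\<close>.\<close>

lemma integral_lborel_vec_prod: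
  fixes f :: "'d::finite \<Rightarrow> real \<Rightarrow> complex"
  assumes int: "\<And>j. integrable lborel (f j)"
  shows "(\<integral>x. (\<Prod>j\<in>UNIV. f j (x $ j)) \<partial>(lborel :: (real ^ 'd) measure)) = (\<Prod>j\<in>UNIV. \<integral>x. f j x \<partial>lborel)"
proof -
  interpret product_sigma_finite "\<lambda>_ :: real ^ 'd. lborel :: real measure" ..
  define idx where "idx b = (SOME j. b = axis j (1::real))" for b :: "real ^ 'd"
  have idx: "idx (axis j 1) = j" for j unfolding idx_def by (rule some_equality) (auto simp: axis_eq_axis)
  have Basis: "(Basis :: (real ^ 'd) set) = (\<lambda>j. axis j 1) ` UNIV" by (auto simp: Basis_vec_def)
  have inj: "inj (\<lambda>j::'d. axis j (1::real))" by (auto simp: inj_on_def axis_eq_axis)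
  have [measurable]: "f j \<in> borel_measurable borel" for j
    using borel_measurable_integrable[OF int] by simp
  have [measurable]: "(\<lambda>x :: real ^ 'd. x $ j) \<in> borel_measurable borel" for j
    by (intro borel_measurable_continuous_onI continuous_intros)
  have T: "(\<Sum>b\<in>Basis. h b *\<^sub>R b) $ j = h (axis j 1)" for h :: "real ^ 'd \<Rightarrow> real" and j
  proof -
    have "(\<Sum>b\<in>Basis. h b *\<^sub>R b) $ j = (\<Sum>i\<in>UNIV. h (axis i 1) * (axis i 1 :: real ^ 'd) $ j)"
      unfolding Basis by (subst sum.reindex[OF inj]) (simp add: sum_component)
    also have "\<dots> = (\<Sum>i\<in>UNIV. if i = j then h (axis i 1) else 0)" by (intro sum.cong) (auto simp: axis_def)
    finally show ?thesis by simp
  qed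
  have "(\<integral>x. (\<Prod>j\<in>UNIV. f j (x $ j)) \<partial>(lborel :: (real ^ 'd) measure))
    = (\<integral>h. (\<Prod>j\<in>UNIV. f j ((\<Sum>b\<in>Basis. h b *\<^sub>R b) $ j)) \<partial>(\<Pi>\<^sub>M b\<in>(Basis :: (real ^ 'd) set). lborel))"
    by (subst lborel_eq, rule integral_distr) measurable
  also have "\<dots> = (\<integral>h. (\<Prod>b\<in>Basis. f (idx b) (h b)) \<partial>(\<Pi>\<^sub>M b\<in>(Basis :: (real ^ 'd) set). lborel))"
    unfolding T unfolding Basis prod.reindex[OF inj] by (simp add: idx comp_def)
  also have "\<dots> = (\<Prod>b\<in>Basis. \<integral>x. f (idx b) x \<partial>lborel)"
    by (rule product_integral_prod) (auto intro: int)
  also have "\<dots> = (\<Prod>j\<in>UNIV. \<integral>x. f j x \<partial>lborel)"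
    unfolding Basis prod.reindex[OF inj] by (simp add: idx comp_def)
  finally show ?thesis .
qed

lemma integral_exp_period:
  fixes n :: int
  defines "h \<equiv> \<lambda>x. indicator {0..<2 * pi} x *\<^sub>R exp (\<i> * of_int n * complex_of_real x)"
  shows "integrable lborel h" "(\<integral>x. h x \<partial>lborel) = (if n = 0 then 2 * pi else 0)"
proof -
  let ?e = "\<lambda>x. exp (\<i> * of_int n * complex_of_real x)"
  \<comment> \<open>The fundamental theorem of calculus is applied on the closed interval, whereas
    the torus is half open; the two differ by one point.\<close>
  have ae: "AE x in lborel. indicator {0..2 * pi} x *\<^sub>R ?e x = h x"
    using AE_lborel_singleton[of "2 * pi"] by eventually_elim (auto simp: h_def indicator_def)
  have h_meas: "h \<in> borel_measurable lborel" unfolding h_def by measurable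
  define G where "G x = (if n = 0 then complex_of_real x else ?e x / (\<i> * of_int n))" for x
  have deriv: "(G has_vector_derivative ?e x) (at x within {0..2 * pi})" for x
  proof (cases "n = 0")
    case True
    then show ?thesis unfolding G_def by (auto intro!: derivative_eq_intros simp: has_vector_derivative_of_real)
  next
    case False
    have "((\<lambda>x. exp (\<i> * of_int n * x) / (\<i> * of_int n)) has_field_derivative ?e x) (at (complex_of_real x))"
      using False by (auto intro!: derivative_eq_intros)
    from has_vector_derivative_real_field[OF this] show ?thesis
      using False by (simp add: G_def[abs_def])
  qed
  have cont: "continuous_on {0..2 * pi} ?e" by (intro continuous_intros)
  note FTC = has_bochner_integral_FTC_Icc[OF _ deriv cont]
  have hb: "has_bochner_integral lborel (\<lambda>x. indicator {0..2 * pi} x *\<^sub>R ?e x) (G (2 * pi) - G 0)"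
    using FTC by simp
  have G: "G (2 * pi) - G 0 = (if n = 0 then 2 * pi else 0)"
  proof (cases "n = 0")
    case False
    have "exp (\<i> * of_int n * complex_of_real (2 * pi)) = 1"
      using exp_integer_2pi[of "of_int n"] by (simp add: mult_ac)
    then show ?thesis using False by (simp add: G_def)
  qed (simp add: G_def)
  have "has_bochner_integral lborel h (G (2 * pi) - G 0)"
    by (rule has_bochner_integral_cong_AE[OF borel_measurable_has_bochner_integral[OF hb] h_meas ae, THEN iffD1, OF hb])
  then show "integrable lborel h" "(\<integral>x. h x \<partial>lborel) = (if n = 0 then 2 * pi else 0)"
    unfolding G by (auto simp: has_bochner_integral_iff)
qed

lemma borel_measurable_trig [measurable]: "trig k \<in> borel_measurable borel"
  unfolding trig_def[abs_def] by (intro borel_measurable_continuous_onI continuous_intros)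

lemma sets_torus [measurable]: "torus \<in> sets (borel :: (real ^ 'd::finite) measure)"
proof -
  have eq: "torus = (\<Inter>j\<in>UNIV. {x :: real ^ 'd. 0 \<le> x $ j} \<inter> {x. x $ j < 2 * pi})" by (auto simp: torus_def)
  have "closed {x :: real ^ 'd. 0 \<le> x $ j}" "open {x :: real ^ 'd. x $ j < 2 * pi}" for j
    by (intro closed_Collect_le open_Collect_less continuous_intros)+
  then show ?thesis unfolding eq by (intro sets.finite_INT sets.Int borel_closed borel_open) auto
qed

lemma integral_torus_trig:
  "(\<integral>x. indicator torus x *\<^sub>R trig k x \<partial>(lborel :: (real ^ 'd::finite) measure))
    = (if k = 0 then (2 * pi) ^ CARD('d) else 0)"
proof -
  let ?h = "\<lambda>j x. indicator {0..<2 * pi} x *\<^sub>R exp (\<i> * of_int (k $ j) * complex_of_real x)"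
  have ind: "indicator torus x = (\<Prod>j\<in>UNIV. indicator {0..<2 * pi} (x $ j) :: real)" for x :: "real ^ 'd"
    by (auto simp: torus_def indicator_def prod_zero_iff)
  have tr: "trig k x = (\<Prod>j\<in>UNIV. exp (\<i> * of_int (k $ j) * complex_of_real (x $ j)))" for x :: "real ^ 'd"
    by (simp add: trig_def sum_distrib_left exp_sum mult.assoc)
  have "(\<integral>x. indicator torus x *\<^sub>R trig k x \<partial>(lborel :: (real ^ 'd::finite) measure))
    = (\<integral>x. (\<Prod>j\<in>UNIV. ?h j (x $ j)) \<partial>(lborel :: (real ^ 'd::finite) measure))"
    unfolding ind tr by (simp add: scaleR_conv_of_real prod.distrib)
  also have "\<dots> = (\<Prod>j\<in>UNIV. \<integral>x. ?h j x \<partial>lborel)"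
    by (rule integral_lborel_vec_prod) (rule integral_exp_period(1))
  also have "\<dots> = (\<Prod>j\<in>UNIV. if k $ j = 0 then 2 * pi else 0)"
    by (simp add: integral_exp_period(2) of_real_prod)
  also have "\<dots> = (if k = 0 then (2 * pi) ^ CARD('d) else 0)"
    by (auto simp: vec_eq_iff prod_zero_iff)
  finally show ?thesis by (simp only: of_real_prod[symmetric] of_real_power[symmetric])
qed

lemma measure_torus:
  shows "emeasure lborel (torus :: (real ^ 'd::finite) set) = ennreal ((2 * pi) ^ CARD('d))"
proof -
  have "torus \<subseteq> cbox 0 ((\<chi> j. 2 * pi) :: real ^ 'd)" by (auto simp: torus_def mem_box_cart less_imp_le)
  then have "bounded (torus :: (real ^ 'd) set)" using bounded_cbox bounded_subset by blast
  then have fin: "emeasure lborel (torus :: (real ^ 'd) set) < \<infinity>" by (rule emeasure_bounded_finite)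
  \<comment> \<open>The volume is read off from the case \<open>k = 0\<close> of the orthogonality
    relation, since \<open>trig 0\<close> is constantly 1.\<close>
  have "complex_of_real (measure lborel (torus :: (real ^ 'd) set)) = (\<integral>x. indicator torus x *\<^sub>R trig 0 x \<partial>(lborel :: (real ^ 'd) measure))"
    using fin by (simp add: trig_def scaleR_conv_of_real integral_complex_of_real)
  also have "\<dots> = complex_of_real ((2 * pi) ^ CARD('d))" by (subst integral_torus_trig) simp
  finally have "measure lborel (torus :: (real ^ 'd) set) = (2 * pi) ^ CARD('d)" by (simp only: of_real_eq_iff)
  then show ?thesis using fin by (simp add: emeasure_eq_ennreal_measure)
qed

lemma emeasure_torus_measure_space: "emeasure (torus_measure :: (real ^ 'd::finite) measure) UNIV = 1"
  unfolding torus_measure_def by (simp add: measure_torus ennreal_divide_self)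

lemma finite_measure_torus: "finite_measure (torus_measure :: (real ^ 'd::finite) measure)"
  by (rule finite_measureI) (simp add: torus_measure_def emeasure_torus_measure_space[unfolded torus_measure_def])

lemma sets_torus_measure [simp, measurable_cong]: "sets torus_measure = sets borel"
  by (simp add: torus_measure_def)

lemma integral_torus_measure:
  fixes f :: "real ^ 'd::finite \<Rightarrow> complex"
  assumes [measurable]: "f \<in> borel_measurable borel"
  shows "(\<integral>x. f x \<partial>torus_measure) = (\<integral>x. indicator torus x *\<^sub>R f x \<partial>lborel) / (2 * pi) ^ CARD('d)"
proof -
  have eq: "torus_measure = density lborel (\<lambda>x :: real ^ 'd. ennreal (indicator torus x / (2 * pi) ^ CARD('d)))"
    unfolding torus_measure_def uniform_measure_def measure_torus
    by (intro arg_cong[of _ _ "density lborel"] ext)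
       (auto simp: indicator_def divide_ennreal[symmetric] simp del: ennreal_1 simp flip: ennreal_1)
  have "(\<integral>x. f x \<partial>torus_measure) = (\<integral>x. (indicator torus x / (2 * pi) ^ CARD('d)) *\<^sub>R f x \<partial>lborel)"
    unfolding eq by (rule integral_density) auto
  also have "\<dots> = (\<integral>x. (indicator torus x *\<^sub>R f x) / (2 * pi) ^ CARD('d) \<partial>lborel)"
    by (intro Bochner_Integration.integral_cong refl) (simp add: scaleR_conv_of_real)
  finally show ?thesis by simp
qed

lemma integral_trig: "(\<integral>x. trig k x \<partial>torus_measure) = (if k = 0 then 1 else 0)"
  by (subst integral_torus_measure) (auto simp: integral_torus_trig)

lemma integral_trig_poly_sq:
  fixes x :: "int ^ 'd::finite \<Rightarrow> complex"
  assumes "finite Q"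
  shows "(\<integral>y. (norm (\<Sum>k\<in>Q. x k * trig k y))\<^sup>2 \<partial>torus_measure) = (\<Sum>k\<in>Q. (norm (x k))\<^sup>2)"
proof -
  interpret finite_measure "torus_measure :: (real ^ 'd) measure" by (rule finite_measure_torus)
  have int: "integrable torus_measure (trig k)" for k :: "int ^ 'd"
    by (rule integrable_const_bound[where B = 1]) auto
  have "complex_of_real (\<integral>y. (norm (\<Sum>k\<in>Q. x k * trig k y))\<^sup>2 \<partial>torus_measure)
    = (\<integral>y. (\<Sum>k\<in>Q. \<Sum>l\<in>Q. x k * cnj (x l) * trig (k - l) y) \<partial>torus_measure)"
  proof (subst integral_complex_of_real[symmetric], intro Bochner_Integration.integral_cong refl)
    fix y :: "real ^ 'd"
    show "complex_of_real ((norm (\<Sum>k\<in>Q. x k * trig k y))\<^sup>2) = (\<Sum>k\<in>Q. \<Sum>l\<in>Q. x k * cnj (x l) * trig (k - l) y)"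
      by (simp only: complex_norm_square cnj_sum complex_cnj_mult sum_product flip: trig_mult_cnj) (simp add: mult_ac)
  qed
  also have "\<dots> = (\<Sum>k\<in>Q. \<Sum>l\<in>Q. x k * cnj (x l) * (if k - l = 0 then 1 else 0))"
    using int by (simp add: integral_trig)
  also have "\<dots> = (\<Sum>k\<in>Q. complex_of_real ((norm (x k))\<^sup>2))"
  proof (intro sum.cong refl)
    fix k assume "k \<in> Q"
    have "(\<Sum>l\<in>Q. x k * cnj (x l) * (if k - l = 0 then 1 else 0)) = (\<Sum>l\<in>Q. if k = l then x k * cnj (x l) else 0)"
      by (intro sum.cong) auto
    then show "(\<Sum>l\<in>Q. x k * cnj (x l) * (if k - l = 0 then 1 else 0)) = complex_of_real ((norm (x k))\<^sup>2)"
      using \<open>k \<in> Q\<close> assms by (simp only: sum.delta' complex_norm_square if_True)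
  qed
  finally show ?thesis by (simp only: of_real_sum[symmetric] of_real_eq_iff)
qed

lemma trig_series_tail:
  fixes u :: "'k \<Rightarrow> complex"
  assumes u: "(\<lambda>k. norm (u k)) summable_on UNIV" and "0 < \<epsilon>"
  shows "\<exists>Q. finite Q \<and> (\<forall>F. finite F \<and> F \<inter> Q = {} \<longrightarrow> (\<Sum>k\<in>F. norm (u k)) \<le> \<epsilon>)"
proof -
  let ?s = "\<Sum>\<^sub>\<infinity>k. norm (u k)"
  have "((\<lambda>k. norm (u k)) has_sum ?s) UNIV" using u by (rule has_sum_infsum)
  then have "\<forall>\<^sub>F Q in finite_subsets_at_top UNIV. dist (\<Sum>k\<in>Q. norm (u k)) ?s < \<epsilon>"
    unfolding has_sum_def using assms(2) by (rule tendstoD)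
  then obtain Q where Q: "finite Q" "dist (\<Sum>k\<in>Q. norm (u k)) ?s < \<epsilon>"
    by (auto simp: eventually_finite_subsets_at_top)
  have "(\<Sum>k\<in>F. norm (u k)) \<le> \<epsilon>" if "finite F" "F \<inter> Q = {}" for F
  proof -
    have "(\<Sum>k\<in>F. norm (u k)) + (\<Sum>k\<in>Q. norm (u k)) = (\<Sum>k\<in>F \<union> Q. norm (u k))"
      using that Q(1) by (simp add: sum.union_disjoint)
    also have "\<dots> \<le> ?s" using that(1) Q(1) u by (intro finite_sum_le_infsum) auto
    finally show ?thesis using Q(2) by (simp add: dist_real_def abs_less_iff)
  qed
  then show ?thesis using Q(1) by blast
qed

lemma borel_measurable_trig_series:
  fixes u :: "int ^ 'd::finite \<Rightarrow> complex"
  assumes u: "(\<lambda>k. norm (u k)) summable_on UNIV"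
  shows "(\<lambda>x. \<Sum>\<^sub>\<infinity>k. u k * trig k x) \<in> borel_measurable borel"
proof -
  have "\<exists>Q. finite Q \<and> (\<forall>F. finite F \<and> F \<inter> Q = {} \<longrightarrow> (\<Sum>k\<in>F. norm (u k)) \<le> inverse (real (Suc n)))" for n
    by (rule trig_series_tail[OF u]) simp
  then obtain Q where Q: "\<And>n. finite (Q n)"
    "\<And>n F. finite F \<Longrightarrow> F \<inter> Q n = {} \<Longrightarrow> (\<Sum>k\<in>F. norm (u k)) \<le> inverse (real (Suc n))" by metis
  let ?P = "\<lambda>n x. \<Sum>k\<in>Q n. u k * trig k x" let ?f = "\<lambda>x. \<Sum>\<^sub>\<infinity>k. u k * trig k x"
  have lim: "(\<lambda>n. ?P n x) \<longlonglongrightarrow> ?f x" for x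
  proof (rule LIMSEQ_I)
    have bnd: "norm (?P n x - ?f x) \<le> inverse (real (Suc n))" for n
      using trig_series_approx[of u "Q n" _ x, OF u Q(1) Q(2)] by (simp add: norm_minus_commute)
    fix r :: real assume "0 < r"
    then obtain N where N: "inverse (real (Suc N)) < r" using reals_Archimedean by blast
    have "norm (?P n x - ?f x) < r" if "N \<le> n" for n
    proof -
      have "inverse (real (Suc n)) \<le> inverse (real (Suc N))" using that by (intro le_imp_inverse_le) auto
      then show ?thesis using bnd[of n] N by linarith
    qed
    then show "\<exists>no. \<forall>n\<ge>no. norm (?P n x - ?f x) < r" by blast
  qed
  show ?thesis
  proof (rule borel_measurable_LIMSEQ_metric[where f = ?P])
    show "?P n \<in> borel_measurable borel" for n by measurable
  qed (rule lim)
qed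

text \<open>For \<open>p >= 2\<close> the \<open>p\<close>-th power of the modulus of
  \<open>F\<close> is at most \<open>S powr (p - 2)\<close> times its square, and the mean of the
  square is at most \<open>4 * S ^ 2 / N\<close>. As \<open>F\<close> need not be a polynomial,
  Parseval's identity is applied to a polynomial uniformly within \<tau> of it. The constant 2
  bounds \<open>4 powr (1 / p)\<close>.\<close>

lemma Lp_norm_torus_le:
  fixes F :: "real ^ 'd::finite \<Rightarrow> complex"
  assumes F: "F \<in> borel_measurable borel" "\<And>y. norm (F y) \<le> S"
    and Q: "finite Q" "\<And>y. norm (F y - (\<Sum>k\<in>Q. x k * trig k y)) \<le> \<tau>"
    and x: "(\<Sum>k\<in>Q. (norm (x k))\<^sup>2) \<le> S\<^sup>2 / N" and \<tau>: "\<tau>\<^sup>2 \<le> S\<^sup>2 / N" "0 < N" "0 < S" and p: "2 \<le> p"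
  shows "Lp_norm torus_measure p F \<le> ennreal (2 * S * N powr (- 1 / p))"
proof -
  interpret finite_measure "torus_measure :: (real ^ 'd) measure" by (rule finite_measure_torus)
  let ?P = "\<lambda>y. \<Sum>k\<in>Q. x k * trig k y"
  note [measurable] = F(1)
  have "measure (torus_measure :: (real ^ 'd) measure) UNIV = 1"
    by (simp add: measure_def emeasure_torus_measure_space)
  moreover have sp: "space (torus_measure :: (real ^ 'd) measure) = UNIV" by (simp add: torus_measure_def)
  ultimately have prob: "measure (torus_measure :: (real ^ 'd) measure) (space torus_measure) = 1" by simp
  have ptw: "norm (F y) powr p \<le> S powr (p - 2) * (2 * (norm (?P y))\<^sup>2 + 2 * \<tau>\<^sup>2)" for y
  proof -
    have "norm (F y) powr p = norm (F y) powr (p - 2) * norm (F y) powr 2"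
      by (simp only: powr_add[symmetric] diff_add_cancel)
    also have "\<dots> \<le> S powr (p - 2) * (norm (F y))\<^sup>2" using F(2) p by (intro mult_mono powr_mono2) auto
    also have "(norm (F y))\<^sup>2 \<le> (norm (?P y) + \<tau>)\<^sup>2"
      using Q(2)[of y] norm_triangle_sub[of "F y" "?P y"] by (intro power_mono) auto
    also have "\<dots> \<le> 2 * (norm (?P y))\<^sup>2 + 2 * \<tau>\<^sup>2"
      using sum_squares_bound[of "norm (?P y)" \<tau>] by (simp add: power2_sum)
    finally show ?thesis by (simp add: mult_left_mono)
  qed
  have "(\<lambda>y. norm (F y) powr p) \<in> borel_measurable torus_measure" by measurable
  moreover have "norm (F y) powr p \<le> S powr p" for y using F(2) p by (intro powr_mono2) auto
  ultimately have int: "integrable torus_measure (\<lambda>y. norm (F y) powr p)"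
    by (intro integrable_const_bound[where B = "S powr p"]) auto
  have "norm (?P y) \<le> (\<Sum>k\<in>Q. norm (x k))" for y by (intro sum_norm_le) (simp add: norm_mult)
  then have "(norm (?P y))\<^sup>2 \<le> (\<Sum>k\<in>Q. norm (x k))\<^sup>2" for y by (intro power_mono) auto
  then have intP: "integrable torus_measure (\<lambda>y. (norm (?P y))\<^sup>2)"
    by (intro integrable_const_bound[where B = "(\<Sum>k\<in>Q. norm (x k))\<^sup>2"]) auto
  have "(\<integral>y. norm (F y) powr p \<partial>torus_measure)
    \<le> (\<integral>y. S powr (p - 2) * (2 * (norm (?P y))\<^sup>2 + 2 * \<tau>\<^sup>2) \<partial>torus_measure)"
    using int intP ptw by (intro integral_mono) auto
  also have "\<dots> = S powr (p - 2) * (2 * (\<Sum>k\<in>Q. (norm (x k))\<^sup>2) + 2 * \<tau>\<^sup>2)"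
    using intP prob by (simp add: integral_trig_poly_sq[OF Q(1)] sp)
  also have "\<dots> \<le> S powr (p - 2) * (4 * (S\<^sup>2 / N))" using x \<tau>(1) by (intro mult_left_mono) auto
  also have "\<dots> = (S powr (p - 2) * S powr 2) * (4 / N)" using \<tau> by simp
  also have "\<dots> = S powr p * (4 / N)" unfolding powr_add[symmetric] by simp
  finally have "(\<integral>y. norm (F y) powr p \<partial>torus_measure) powr (1 / p) \<le> (S powr p * (4 / N)) powr (1 / p)"
    using p by (intro powr_mono2 integral_nonneg_AE) auto
  also have "\<dots> = 4 powr (1 / p) * S * N powr (- 1 / p)"
    using p \<tau> by (simp add: powr_mult powr_divide powr_powr powr_minus_divide)
  also have "\<dots> \<le> 2 * S * N powr (- 1 / p)"
  proof (intro mult_right_mono)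
    have "(4::real) powr (1 / p) \<le> 4 powr (1 / 2)" using p by (intro powr_mono) (auto simp: field_simps)
    then show "(4::real) powr (1 / p) \<le> 2" by (simp add: powr_half_sqrt)
  qed (use \<tau> in auto)
  finally show ?thesis using int by (simp add: Lp_norm_def Lp_space_def ennreal_leI)
qed

section \<open>Regular grids and discrete orthogonality\<close>

definition grid :: "nat \<Rightarrow> (real ^ 'd::finite) set" where
  "grid M = (\<lambda>g. \<chi> j. 2 * pi * real (g j) / real M) ` (PiE UNIV (\<lambda>_. {..<M}))"

lemma inj_grid: "0 < M \<Longrightarrow> inj_on (\<lambda>g. (\<chi> j. 2 * pi * real (g j) / real M) :: real ^ 'd::finite) A"
  by (auto simp: inj_on_def vec_eq_iff fun_eq_iff)

lemma grid_props:
  assumes "0 < M"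
  shows "finite (grid M :: (real ^ 'd::finite) set)" "card (grid M :: (real ^ 'd::finite) set) = M ^ CARD('d)"
    "(grid M :: (real ^ 'd::finite) set) \<subseteq> torus"
  using assms by (auto simp: grid_def card_image[OF inj_grid] card_PiE finite_PiE torus_def PiE_iff divide_simps)

text \<open>A geometric sum over a root of unity: the base \<open>w\<close> satisfies
  \<open>w ^ M = 1\<close>, and \<open>w = 1\<close> would make \<open>n\<close> a nonzero multiple
  of \<open>M\<close>.\<close>

lemma sum_exp_roots:
  assumes "\<bar>n\<bar> < int M" "n \<noteq> 0"
  shows "(\<Sum>t<M. exp (\<i> * complex_of_real (of_int n * (2 * pi * real t / real M)))) = 0"
proof -
  have M: "real M > 0" using assms by (cases M) auto
  define w where "w = exp (\<i> * complex_of_real (of_int n * (2 * pi / real M)))"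
  have "exp (\<i> * complex_of_real (of_int n * (2 * pi * real t / real M))) = w ^ t" for t
    unfolding w_def exp_of_nat_mult[symmetric] by (rule arg_cong[of _ _ exp]) (simp add: mult_ac)
  then have "(\<Sum>t<M. exp (\<i> * complex_of_real (of_int n * (2 * pi * real t / real M)))) = (\<Sum>t<M. w ^ t)" by simp
  moreover have "w ^ M = 1"
  proof -
    have "w ^ M = exp (2 * pi * \<i> * of_int n)"
      unfolding w_def exp_of_nat_mult[symmetric] using M by (intro arg_cong[of _ _ exp]) (simp add: field_simps)
    then show ?thesis using exp_integer_2pi[of "of_int n"] by (simp add: mult_ac)
  qed
  moreover have "w \<noteq> 1"
  proof
    assume "w = 1"
    then obtain j :: int where "of_int n * (2 * pi / real M) = of_int (2 * j) * pi"
      unfolding w_def exp_eq_1 by auto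
    then have "real_of_int n = real_of_int (j * int M)" using M by (simp add: field_simps)
    then have nj: "n = j * int M" by linarith
    then have "j \<noteq> 0" using assms(2) by auto
    then have "1 \<le> \<bar>j\<bar>" by linarith
    then have "1 * int M \<le> \<bar>j\<bar> * int M" by (intro mult_right_mono) auto
    then show False using assms(1) by (simp add: nj abs_mult)
  qed
  ultimately show ?thesis by (simp add: geometric_sum)
qed

lemma sum_grid_trig:
  fixes n :: "int ^ 'd::finite"
  assumes "\<And>j. \<bar>n $ j\<bar> < int M" "0 < M"
  shows "(\<Sum>y\<in>grid M. trig n y) = (if n = 0 then of_nat (card (grid M :: (real ^ 'd) set)) else 0)"
proof -
  have "(\<Sum>y\<in>grid M. trig n y) = (\<Sum>g\<in>PiE UNIV (\<lambda>_. {..<M}). \<Prod>j\<in>UNIV. exp (\<i> * complex_of_real (of_int (n $ j) * (2 * pi * real (g j) / real M))))"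
    unfolding grid_def sum.reindex[OF inj_grid[OF assms(2)]] by (simp add: trig_def exp_sum sum_distrib_left)
  also have "\<dots> = (\<Prod>j\<in>UNIV. \<Sum>t<M. exp (\<i> * complex_of_real (of_int (n $ j) * (2 * pi * real t / real M))))"
    by (rule prod_sum_PiE[symmetric]) auto
  also have "\<dots> = (if n = 0 then of_nat (card (grid M :: (real ^ 'd) set)) else 0)"
  proof (cases "n = 0")
    case True
    then show ?thesis by (simp add: grid_props[OF assms(2)])
  next
    case False
    then obtain j where "n $ j \<noteq> 0" by (auto simp: vec_eq_iff)
    then show ?thesis using False sum_exp_roots[OF assms(1)[of j]] by (auto simp: prod_zero_iff intro!: exI[of _ j])
  qed
  finally show ?thesis .
qed

text \<open>Components of frequencies of level at most \<open>J\<close> are below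
  \<open>2 ^ J\<close> in modulus, so differences stay below \<open>2 ^ (J + 1) <= M\<close>. Hence
  no aliasing occurs and the exponentials remain orthogonal on the grid.\<close>

lemma grid_parseval:
  fixes x :: "int ^ 'd::finite \<Rightarrow> complex"
  assumes Q: "finite Q" "\<And>k. k \<in> Q \<Longrightarrow> freq_level k \<le> J" and M: "2 ^ (J + 1) \<le> M"
  shows "(\<Sum>y\<in>grid M. (norm (\<Sum>k\<in>Q. x k * trig k y))\<^sup>2)
    = real (card (grid M :: (real ^ 'd) set)) * (\<Sum>k\<in>Q. (norm (x k))\<^sup>2)"
proof -
  have M0: "0 < M" using M by (meson less_le_trans zero_less_numeral zero_less_power)
  let ?n = "of_nat (card (grid M :: (real ^ 'd) set)) :: complex"
  have orth: "(\<Sum>y\<in>grid M. trig (k - l) y) = (if k = l then ?n else 0)" if "k \<in> Q" "l \<in> Q" for k l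
  proof -
    have comp: "\<bar>k $ j\<bar> < 2 ^ J" if "k \<in> Q" for k j
      using bit_length_le_iff[of "k $ j" J] bit_length_component_le[of k j] Q(2)[OF that] by simp
    have "int (2 ^ (J + 1)) \<le> int M" using M by (simp only: of_nat_le_iff)
    then have "\<bar>(k - l) $ j\<bar> < int M" for j using comp[OF that(1), of j] comp[OF that(2), of j] by simp
    then show ?thesis by (subst sum_grid_trig[OF _ M0]) auto
  qed
  have "complex_of_real (\<Sum>y\<in>grid M. (norm (\<Sum>k\<in>Q. x k * trig k y))\<^sup>2)
    = (\<Sum>y\<in>grid M. \<Sum>k\<in>Q. \<Sum>l\<in>Q. x k * cnj (x l) * trig (k - l) y)"
    unfolding of_real_sum
    by (simp only: complex_norm_square cnj_sum complex_cnj_mult sum_product flip: trig_mult_cnj) (simp add: mult_ac)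
  also have "\<dots> = (\<Sum>k\<in>Q. \<Sum>y\<in>grid M. \<Sum>l\<in>Q. x k * cnj (x l) * trig (k - l) y)" by (rule sum.swap)
  also have "\<dots> = (\<Sum>k\<in>Q. \<Sum>l\<in>Q. \<Sum>y\<in>grid M. x k * cnj (x l) * trig (k - l) y)"
    by (intro sum.cong refl sum.swap)
  also have "\<dots> = (\<Sum>k\<in>Q. \<Sum>l\<in>Q. if k = l then x k * cnj (x l) * ?n else 0)"
    unfolding sum_distrib_left[symmetric] by (intro sum.cong refl) (auto simp: orth)
  also have "\<dots> = (\<Sum>k\<in>Q. x k * cnj (x k) * ?n)" using Q(1) by (simp only: sum.delta' cong: sum.cong) simp
  also have "\<dots> = complex_of_real (real (card (grid M :: (real ^ 'd) set)) * (\<Sum>k\<in>Q. (norm (x k))\<^sup>2))"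
    by (simp only: of_real_mult of_real_sum complex_norm_square sum_distrib_left of_real_of_nat_eq mult_ac)
  finally show ?thesis by (simp only: of_real_eq_iff)
qed

section \<open>Weak orthogonal matching pursuit\<close>

definition sample_norm :: "nat \<Rightarrow> (nat \<Rightarrow> 'a) \<Rightarrow> ('a \<Rightarrow> complex) \<Rightarrow> real" where
  "sample_norm m \<xi> f = sqrt ((\<Sum>j<m. (norm (f (\<xi> j)))\<^sup>2) / real m)"

lemma sample_norm_nonneg [simp]: "0 \<le> sample_norm m \<xi> f"
  by (simp add: sample_norm_def sum_nonneg)

lemma sample_norm_sq: "(sample_norm m \<xi> f)\<^sup>2 = (\<Sum>j<m. (norm (f (\<xi> j)))\<^sup>2) / real m"
  by (simp add: sample_norm_def sum_nonneg)

lemma sample_norm_L2_set: "sample_norm m \<xi> f = L2_set (\<lambda>j. norm (f (\<xi> j))) {..<m} / sqrt (real m)"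
  by (simp add: sample_norm_def L2_set_def real_sqrt_divide)

lemma sample_inner_self: "sample_inner m \<xi> f f = of_real ((sample_norm m \<xi> f)\<^sup>2)"
  unfolding sample_norm_sq sample_inner_def by (simp add: complex_norm_square[symmetric])

lemma sample_inner_diff_right: "sample_inner m \<xi> h (\<lambda>x. f x - g x) = sample_inner m \<xi> h f - sample_inner m \<xi> h g"
  by (simp add: sample_inner_def right_diff_distrib sum_subtractf diff_divide_distrib)

lemma sample_inner_sum_right:
  "sample_inner m \<xi> h (\<lambda>x. \<Sum>i\<in>T. c i * \<phi> i x) = (\<Sum>i\<in>T. cnj (c i) * sample_inner m \<xi> h (\<phi> i))"
proof -
  have "(\<Sum>j<m. h (\<xi> j) * cnj (\<Sum>i\<in>T. c i * \<phi> i (\<xi> j))) = (\<Sum>j<m. \<Sum>i\<in>T. cnj (c i) * (h (\<xi> j) * cnj (\<phi> i (\<xi> j))))"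
    by (simp add: sum_distrib_left mult_ac)
  also have "\<dots> = (\<Sum>i\<in>T. cnj (c i) * (\<Sum>j<m. h (\<xi> j) * cnj (\<phi> i (\<xi> j))))"
    by (subst sum.swap) (simp add: sum_distrib_left)
  finally show ?thesis by (simp only: sample_inner_def times_divide_eq_right sum_divide_distrib[symmetric])
qed

lemma norm_sample_inner_le: "norm (sample_inner m \<xi> f g) \<le> sample_norm m \<xi> f * sample_norm m \<xi> g"
proof -
  have "norm (\<Sum>j<m. f (\<xi> j) * cnj (g (\<xi> j))) \<le> (\<Sum>j<m. \<bar>norm (f (\<xi> j))\<bar> * \<bar>norm (g (\<xi> j))\<bar>)"
    by (intro sum_norm_le) (simp add: norm_mult)
  also have "\<dots> \<le> L2_set (\<lambda>j. norm (f (\<xi> j))) {..<m} * L2_set (\<lambda>j. norm (g (\<xi> j))) {..<m}"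
    by (rule L2_set_mult_ineq)
  finally have "norm (\<Sum>j<m. f (\<xi> j) * cnj (g (\<xi> j))) / real m
    \<le> L2_set (\<lambda>j. norm (f (\<xi> j))) {..<m} * L2_set (\<lambda>j. norm (g (\<xi> j))) {..<m} / real m"
    by (intro divide_right_mono) auto
  then show ?thesis by (simp add: sample_inner_def norm_divide sample_norm_L2_set)
qed

lemma sample_norm_cong: "(\<And>j. j < m \<Longrightarrow> f (\<xi> j) = g (\<xi> j)) \<Longrightarrow> sample_norm m \<xi> f = sample_norm m \<xi> g"
  by (simp add: sample_norm_def)

lemma sample_norm_triangle: "sample_norm m \<xi> (\<lambda>x. f x + g x) \<le> sample_norm m \<xi> f + sample_norm m \<xi> g"
proof -
  have "L2_set (\<lambda>j. norm (f (\<xi> j) + g (\<xi> j))) {..<m} \<le> L2_set (\<lambda>j. norm (f (\<xi> j)) + norm (g (\<xi> j))) {..<m}"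
    by (intro L2_set_mono norm_triangle_ineq) auto
  also have "\<dots> \<le> L2_set (\<lambda>j. norm (f (\<xi> j))) {..<m} + L2_set (\<lambda>j. norm (g (\<xi> j))) {..<m}"
    by (rule L2_set_triangle_ineq)
  finally show ?thesis unfolding sample_norm_L2_set add_divide_distrib[symmetric] by (intro divide_right_mono) auto
qed

lemma sample_norm_diff_triangle: "sample_norm m \<xi> (\<lambda>x. f x - g x) \<le> sample_norm m \<xi> f + sample_norm m \<xi> g"
  using sample_norm_triangle[of m \<xi> f "\<lambda>x. - g x"] by (simp add: sample_norm_def)

lemma sample_norm_le:
  assumes "\<And>j. j < m \<Longrightarrow> norm (f (\<xi> j)) \<le> B" "0 < m" "0 \<le> B"
  shows "sample_norm m \<xi> f \<le> B"
proof -
  have "(\<Sum>j<m. (norm (f (\<xi> j)))\<^sup>2) \<le> (\<Sum>j<m. B\<^sup>2)" using assms(1) by (intro sum_mono power_mono) auto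
  then have "(\<Sum>j<m. (norm (f (\<xi> j)))\<^sup>2) / real m \<le> B\<^sup>2" using assms(2) by (simp add: pos_divide_le_eq mult.commute)
  then show ?thesis unfolding sample_norm_def using assms(3) by (intro real_le_lsqrt) auto
qed

text \<open>Pythagoras. With \<open>h\<close> from the span of the chosen functions it expresses
  that the projection is a best approximation.\<close>

lemma sample_norm_le_orth:
  assumes "sample_inner m \<xi> f h = 0"
  shows "(sample_norm m \<xi> f)\<^sup>2 \<le> (sample_norm m \<xi> (\<lambda>x. f x - h x))\<^sup>2"
proof (cases "m = 0")
  case False
  have "(\<Sum>j<m. f (\<xi> j) * cnj (h (\<xi> j))) = 0" using assms False by (simp add: sample_inner_def)
  then have 0: "(\<Sum>j<m. Re (f (\<xi> j) * cnj (h (\<xi> j)))) = 0" by (simp only: Re_sum[symmetric] zero_complex.sel)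
  have "(norm (f (\<xi> j) - h (\<xi> j)))\<^sup>2 = (norm (f (\<xi> j)))\<^sup>2 + (norm (h (\<xi> j)))\<^sup>2 - 2 * Re (f (\<xi> j) * cnj (h (\<xi> j)))" for j
    by (simp add: cmod_power2) (simp add: power2_eq_square algebra_simps)
  then have "(\<Sum>j<m. (norm (f (\<xi> j) - h (\<xi> j)))\<^sup>2)
      = (\<Sum>j<m. (norm (f (\<xi> j)))\<^sup>2) + (\<Sum>j<m. (norm (h (\<xi> j)))\<^sup>2) - 2 * (\<Sum>j<m. Re (f (\<xi> j) * cnj (h (\<xi> j))))"
    by (simp add: sum.distrib sum_subtractf sum_distrib_left)
  then have "(\<Sum>j<m. (norm (f (\<xi> j)))\<^sup>2) \<le> (\<Sum>j<m. (norm (f (\<xi> j) - h (\<xi> j)))\<^sup>2)"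
    using 0 sum_nonneg[of "{..<m}" "\<lambda>j. (norm (h (\<xi> j)))\<^sup>2"] by simp
  then show ?thesis unfolding sample_norm_sq by (intro divide_right_mono) auto
qed (simp add: sample_norm_def)

lemma lin_span_add_scaled:
  assumes "h1 \<in> lin_span S" "h2 \<in> lin_span S"
  shows "(\<lambda>x. h1 x + a * h2 x) \<in> lin_span S"
proof -
  obtain T1 c1 where 1: "finite T1" "T1 \<subseteq> S" "h1 = (\<lambda>x. \<Sum>g\<in>T1. c1 g * g x)" using assms(1) by (auto simp: lin_span_def)
  obtain T2 c2 where 2: "finite T2" "T2 \<subseteq> S" "h2 = (\<lambda>x. \<Sum>g\<in>T2. c2 g * g x)" using assms(2) by (auto simp: lin_span_def)
  define c where "c g = (if g \<in> T1 then c1 g else 0) + a * (if g \<in> T2 then c2 g else 0)" for g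
  have "h1 x + a * h2 x = (\<Sum>g\<in>T1 \<union> T2. c g * g x)" for x
  proof -
    have "h1 x = (\<Sum>g\<in>T1 \<union> T2. (if g \<in> T1 then c1 g else 0) * g x)"
      unfolding 1(3) using 1(1) 2(1) by (intro sum.mono_neutral_cong_left) auto
    moreover have "h2 x = (\<Sum>g\<in>T1 \<union> T2. (if g \<in> T2 then c2 g else 0) * g x)"
      unfolding 2(3) using 1(1) 2(1) by (intro sum.mono_neutral_cong_left) auto
    ultimately show ?thesis by (simp add: c_def sum_distrib_left sum.distrib[symmetric] distrib_right mult.assoc)
  qed
  then show ?thesis using 1(1,2) 2(1,2) unfolding lin_span_def by (intro CollectI exI[of _ "T1 \<union> T2"] exI[of _ c]) auto
qed

lemma lin_span_base: "g \<in> S \<Longrightarrow> g \<in> lin_span S"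
  unfolding lin_span_def by (intro CollectI exI[of _ "{g}"] exI[of _ "\<lambda>_. 1"]) auto

lemma lin_span_mono: "S \<subseteq> S' \<Longrightarrow> lin_span S \<subseteq> lin_span S'"
  unfolding lin_span_def by blast

text \<open>An element of the span is a combination of functions, while the comparison with a target
  needs frequencies. One index is picked for each function that occurs, so repeated choices count
  once and at most \<open>k\<close> indices arise.\<close>

lemma lin_span_image_indexed:
  assumes "h \<in> lin_span (g ` {1..k::nat})" "g ` {1..k} \<subseteq> \<phi> ` Q"
  obtains \<Lambda> c where "\<Lambda> \<subseteq> Q" "finite \<Lambda>" "card \<Lambda> \<le> k" "\<phi> ` \<Lambda> \<subseteq> g ` {1..k}" "h = (\<lambda>x. \<Sum>i\<in>\<Lambda>. c i * \<phi> i x)"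
proof -
  obtain T c where T: "finite T" "T \<subseteq> g ` {1..k}" "h = (\<lambda>x. \<Sum>\<gamma>\<in>T. c \<gamma> * \<gamma> x)"
    using assms(1) by (auto simp: lin_span_def)
  have "\<exists>i. i \<in> Q \<and> \<phi> i = \<gamma>" if "\<gamma> \<in> T" for \<gamma>
  proof -
    have "\<gamma> \<in> \<phi> ` Q" using that T(2) assms(2) by (meson subsetD)
    then show ?thesis by (elim imageE) auto
  qed
  then have "\<forall>\<gamma>\<in>T. \<exists>i. i \<in> Q \<and> \<phi> i = \<gamma>" by (rule ballI)
  then obtain idx where "\<forall>\<gamma>\<in>T. idx \<gamma> \<in> Q \<and> \<phi> (idx \<gamma>) = \<gamma>" by (rule bchoice[THEN exE])
  then have idx: "idx \<gamma> \<in> Q" "\<phi> (idx \<gamma>) = \<gamma>" if "\<gamma> \<in> T" for \<gamma> using that by auto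
  have inj: "inj_on idx T" using idx by (metis inj_onI)
  show ?thesis
  proof (rule that[of "idx ` T" "\<lambda>i. c (\<phi> i)"])
    have "card T \<le> card (g ` {1..k})" using T(2) by (intro card_mono) auto
    also have "\<dots> \<le> k" using card_image_le[of "{1..k}" g] by simp
    finally show "card (idx ` T) \<le> k" using inj by (simp add: card_image)
    show "h = (\<lambda>x. \<Sum>i\<in>idx ` T. c (\<phi> i) * \<phi> i x)"
      unfolding T(3) sum.reindex[OF inj] using idx by (intro ext) (simp cong: sum.cong)
  qed (use T idx in auto)
qed

section \<open>Progress of a single run of the algorithm\<close>

text \<open>The assumption \<open>sparse\<close> is the lower half of a restricted isometry for at
  most \<kappa> frequencies. Besides the sampled size of the remainders, it is all that the analysis
  of a run knows of the sample points.\<close>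

context
  fixes m :: nat and \<xi> :: "nat \<Rightarrow> 'a" and \<phi> :: "'k \<Rightarrow> 'a \<Rightarrow> complex" and Q :: "'k set"
    and t :: real and f0 :: "'a \<Rightarrow> complex" and s :: nat and g G :: "nat \<Rightarrow> 'a \<Rightarrow> complex" and \<kappa> :: real
  assumes m: "0 < m" and Q: "finite Q" "Q \<noteq> {}" and t: "0 < t" "t \<le> 1"
    and \<phi>: "\<And>k x. norm (\<phi> k x) = 1"
    and run: "womp_run (sample_inner m \<xi>) t (\<phi> ` Q) f0 s g G"
    and sparse: "\<And>x R. R \<subseteq> Q \<Longrightarrow> real (card R) \<le> \<kappa> \<Longrightarrow>
      (\<Sum>k\<in>R. (norm (x k))\<^sup>2) \<le> 128 * (sample_norm m \<xi> (\<lambda>y. \<Sum>k\<in>R. x k * \<phi> k y))\<^sup>2"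
begin

abbreviation (input) res :: "nat \<Rightarrow> 'a \<Rightarrow> complex" where "res k \<equiv> \<lambda>x. f0 x - G k x"
abbreviation (input) N :: "nat \<Rightarrow> real" where "N k \<equiv> sample_norm m \<xi> (res k)"

lemma womp_proj: "k \<le> s \<Longrightarrow> G k \<in> lin_span (g ` {1..k})"
  "k \<le> s \<Longrightarrow> w \<in> lin_span (g ` {1..k}) \<Longrightarrow> sample_inner m \<xi> (res k) w = 0"
  using run by (auto simp: womp_run_def is_orth_proj_def)

lemma womp_choice: "k < s \<Longrightarrow> g (Suc k) \<in> \<phi> ` Q"
  "k < s \<Longrightarrow> i \<in> Q \<Longrightarrow> t * norm (sample_inner m \<xi> (res k) (\<phi> i)) \<le> norm (sample_inner m \<xi> (res k) (g (Suc k)))"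
proof -
  assume k: "k < s"
  have *: "g (Suc k) \<in> \<phi> ` Q \<and> norm (sample_inner m \<xi> (res k) (g (Suc k)))
     \<ge> t * (SUP h\<in>\<phi> ` Q. norm (sample_inner m \<xi> (res k) h))"
  proof -
    have "Suc k \<in> {1..s}" using k by simp
    with run show ?thesis unfolding womp_run_def by (auto dest!: bspec[of _ _ "Suc k"])
  qed
  then show "g (Suc k) \<in> \<phi> ` Q" by blast
  assume i: "i \<in> Q"
  have "norm (sample_inner m \<xi> (res k) (\<phi> i)) \<le> (SUP h\<in>\<phi> ` Q. norm (sample_inner m \<xi> (res k) h))"
    using Q i by (intro cSUP_upper2[of _ _ "\<phi> i"]) (auto intro!: bdd_above_finite)
  then have "t * norm (sample_inner m \<xi> (res k) (\<phi> i)) \<le> t * (SUP h\<in>\<phi> ` Q. norm (sample_inner m \<xi> (res k) h))"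
    using t by (intro mult_left_mono) auto
  then show "t * norm (sample_inner m \<xi> (res k) (\<phi> i)) \<le> norm (sample_inner m \<xi> (res k) (g (Suc k)))"
    using * by linarith
qed

lemma womp_chosen: "k \<le> s \<Longrightarrow> g ` {1..k} \<subseteq> \<phi> ` Q"
proof
  fix h assume "k \<le> s" "h \<in> g ` {1..k}"
  then obtain i where "h = g i" "1 \<le> i" "i \<le> s" by auto
  then obtain j where "h = g (Suc j)" "j < s" by (cases i) auto
  then show "h \<in> \<phi> ` Q" using womp_choice(1) by simp
qed

text \<open>The new projection is at least as good as the competitor
  \<open>G k + c * g (Suc k)\<close> with the optimal coefficient \<open>c\<close>. As the new
  function has modulus 1 at every point, the competitor already lowers the square of the norm by
  \<open>(norm c) ^ 2\<close>.\<close>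

lemma womp_step_decrease:
  assumes k: "k < s"
  shows "(N (Suc k))\<^sup>2 \<le> (N k)\<^sup>2 - (norm (sample_inner m \<xi> (res k) (g (Suc k))))\<^sup>2"
proof -
  define c where "c = sample_inner m \<xi> (res k) (g (Suc k))"
  define w where "w = (\<lambda>x. G k x + c * g (Suc k) x)"
  have gk: "norm (g (Suc k) x) = 1" for x using womp_choice(1)[OF k] \<phi> by auto
  have "G k \<in> lin_span (g ` {1..Suc k})"
    by (rule subsetD[OF lin_span_mono womp_proj(1)]) (use k in auto)
  then have w: "w \<in> lin_span (g ` {1..Suc k})" unfolding w_def
  proof (rule lin_span_add_scaled)
    show "g (Suc k) \<in> lin_span (g ` {1..Suc k})" by (rule lin_span_base) auto
  qed
  have "(\<lambda>x. w x + (-1) * G (Suc k) x) \<in> lin_span (g ` {1..Suc k})"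
    using w womp_proj(1)[of "Suc k"] k by (intro lin_span_add_scaled) auto
  from womp_proj(2)[OF _ this] k have "sample_inner m \<xi> (res (Suc k)) (\<lambda>x. w x + (-1) * G (Suc k) x) = 0" by simp
  from sample_norm_le_orth[OF this]
  have "(N (Suc k))\<^sup>2 \<le> (sample_norm m \<xi> (\<lambda>x. res k x - c * g (Suc k) x))\<^sup>2"
    by (simp add: w_def diff_diff_eq)
  also have "\<dots> = (N k)\<^sup>2 - (norm c)\<^sup>2"
  proof -
    have pt: "(norm (res k x - c * g (Suc k) x))\<^sup>2 = (norm (res k x))\<^sup>2 + (norm c)\<^sup>2 - 2 * Re (cnj c * (res k x * cnj (g (Suc k) x)))" for x
    proof -
      have "(norm (a - b))\<^sup>2 = (norm a)\<^sup>2 + (norm b)\<^sup>2 - 2 * Re (a * cnj b)" for a b :: complex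
        by (simp add: cmod_power2) (simp add: power2_eq_square algebra_simps)
      from this[of "res k x" "c * g (Suc k) x"] show ?thesis using gk[of x] by (simp add: norm_mult mult_ac)
    qed
    have "(\<Sum>j<m. Re (cnj c * (res k (\<xi> j) * cnj (g (Suc k) (\<xi> j))))) = Re (cnj c * (\<Sum>j<m. res k (\<xi> j) * cnj (g (Suc k) (\<xi> j))))"
      by (simp only: Re_sum sum_distrib_left)
    also have "(\<Sum>j<m. res k (\<xi> j) * cnj (g (Suc k) (\<xi> j))) = of_nat m * c"
      using m by (simp add: c_def sample_inner_def)
    also have "Re (cnj c * (of_nat m * c)) = real m * (norm c)\<^sup>2"
      unfolding cmod_power2 by (simp add: power2_eq_square algebra_simps)
    finally show ?thesis unfolding sample_norm_sq pt using m
      by (simp add: sum.distrib sum_subtractf sum_distrib_left[symmetric] field_simps)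
  qed
  finally show ?thesis by (simp add: c_def)
qed

lemma womp_norm_mono: "k \<le> k' \<Longrightarrow> k' \<le> s \<Longrightarrow> N k' \<le> N k"
proof (induction k' rule: dec_induct)
  case (step n)
  have "(N (Suc n))\<^sup>2 \<le> (N n)\<^sup>2" using womp_step_decrease[of n] step.prems by (smt (verit) Suc_le_eq zero_le_power2)
  then have "N (Suc n) \<le> N n" by (rule power2_le_imp_le) simp
  then show ?case using step by linarith
qed simp

text \<open>The polynomial \<open>H\<close> is the sparse target. The square of the residual norm is
  the inner product of the residual with \<open>H - G k\<close> plus that with the remainder, and
  the latter is at most half of it because \<open>2 * \<omega> <= N k\<close>. In the former the
  frequencies already chosen drop out by orthogonality; Cauchy-Schwarz over the at most
  \<open>q\<close> others and the lower isometry bound give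
  \<open>N k <= 3 * sqrt (128 * q) * M\<close>. Hence the constant
  \<open>9 * 128 = 1152\<close>.\<close>

lemma womp_geometric_step:
  assumes k: "k < s" and T: "T \<subseteq> Q" "real (card T) \<le> q" "q + real k \<le> \<kappa>" "0 < q"
    and \<omega>: "sample_norm m \<xi> (\<lambda>x. f0 x - (\<Sum>i\<in>T. u i * \<phi> i x)) \<le> \<omega>" "2 * \<omega> \<le> N k" "0 < \<omega>"
  shows "(N (Suc k))\<^sup>2 \<le> (1 - t\<^sup>2 / (1152 * q)) * (N k)\<^sup>2"
proof -
  let ?ip = "sample_inner m \<xi>"
  define H where "H = (\<lambda>x. \<Sum>i\<in>T. u i * \<phi> i x)"
  define w where "w = (\<lambda>x. f0 x - H x)"
  define M where "M = norm (?ip (res k) (g (Suc k))) / t"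
  have M: "norm (?ip (res k) (\<phi> i)) \<le> M" if "i \<in> Q" for i
    using womp_choice(2)[OF k that] t by (simp add: M_def pos_le_divide_eq mult.commute)
  have M0: "0 \<le> M" using t by (simp add: M_def)
  have finT: "finite T" using T(1) Q(1) finite_subset by blast
  have ks: "k \<le> s" using k by simp
  obtain \<Lambda> c where \<Lambda>: "\<Lambda> \<subseteq> Q" "finite \<Lambda>" "card \<Lambda> \<le> k" "\<phi> ` \<Lambda> \<subseteq> g ` {1..k}" "G k = (\<lambda>x. \<Sum>i\<in>\<Lambda>. c i * \<phi> i x)"
    using lin_span_image_indexed[OF womp_proj(1)[OF ks] womp_chosen[OF ks]] by blast
  have orth: "?ip (res k) (\<phi> i) = 0" if "i \<in> \<Lambda>" for i
    using \<Lambda>(4) that by (intro womp_proj(2)[OF ks] lin_span_base) auto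
  define x where "x i = (if i \<in> T then u i else 0) - (if i \<in> \<Lambda> then c i else 0)" for i
  have HG: "H y - G k y = (\<Sum>i\<in>T \<union> \<Lambda>. x i * \<phi> i y)" for y
  proof -
    have "H y = (\<Sum>i\<in>T \<union> \<Lambda>. (if i \<in> T then u i else 0) * \<phi> i y)"
      unfolding H_def using finT \<Lambda>(2) by (intro sum.mono_neutral_cong_left) auto
    moreover have "G k y = (\<Sum>i\<in>T \<union> \<Lambda>. (if i \<in> \<Lambda> then c i else 0) * \<phi> i y)"
      unfolding \<Lambda>(5) using finT \<Lambda>(2) by (intro sum.mono_neutral_cong_left) auto
    ultimately show ?thesis by (simp add: x_def sum_subtractf[symmetric] left_diff_distrib)
  qed
  have x2: "(\<Sum>i\<in>T \<union> \<Lambda>. (norm (x i))\<^sup>2) \<le> 128 * (sample_norm m \<xi> (\<lambda>y. H y - G k y))\<^sup>2"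
    unfolding HG
  proof (rule sparse)
    have "real (card (T \<union> \<Lambda>)) \<le> real (card T) + real (card \<Lambda>)" using card_Un_le[of T \<Lambda>] by linarith
    also have "\<dots> \<le> \<kappa>" using T(2,3) \<Lambda>(3) by linarith
    finally show "real (card (T \<union> \<Lambda>)) \<le> \<kappa>" .
  qed (use T \<Lambda> in auto)
  have HGN: "sample_norm m \<xi> (\<lambda>y. H y - G k y) \<le> 3/2 * N k"
  proof -
    have "sample_norm m \<xi> (\<lambda>y. res k y - w y) \<le> N k + sample_norm m \<xi> w" by (rule sample_norm_diff_triangle)
    moreover have "(\<lambda>y. res k y - w y) = (\<lambda>y. H y - G k y)" by (simp add: w_def)
    ultimately show ?thesis using \<omega> by (simp add: w_def H_def)
  qed
  have "norm (?ip (res k) (\<lambda>y. H y - G k y)) \<le> M * (sqrt q * (sqrt 128 * (3/2 * N k)))"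
  proof -
    have "norm (?ip (res k) (\<lambda>y. H y - G k y)) = norm (\<Sum>i\<in>T \<union> \<Lambda>. cnj (x i) * ?ip (res k) (\<phi> i))"
      unfolding HG sample_inner_sum_right ..
    \<comment> \<open>Here the number \<open>k\<close> of earlier choices disappears: only the
      sparsity \<open>q\<close> of the target enters, so the rate does not deteriorate during the
      run.\<close>
    also have "(\<Sum>i\<in>T \<union> \<Lambda>. cnj (x i) * ?ip (res k) (\<phi> i)) = (\<Sum>i\<in>T - \<Lambda>. cnj (x i) * ?ip (res k) (\<phi> i))"
      using finT \<Lambda>(2) orth by (intro sum.mono_neutral_right) auto
    also have "norm \<dots> \<le> (\<Sum>i\<in>T - \<Lambda>. M * (\<bar>norm (x i)\<bar> * \<bar>1\<bar>))"
    proof (rule sum_norm_le)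
      fix i assume "i \<in> T - \<Lambda>"
      then have "norm (x i) * norm (?ip (res k) (\<phi> i)) \<le> norm (x i) * M" using M T(1) by (intro mult_left_mono) auto
      then show "norm (cnj (x i) * ?ip (res k) (\<phi> i)) \<le> M * (\<bar>norm (x i)\<bar> * \<bar>1\<bar>)"
        by (simp add: norm_mult mult.commute)
    qed
    also have "\<dots> \<le> M * (L2_set (\<lambda>i. norm (x i)) (T - \<Lambda>) * L2_set (\<lambda>_. 1) (T - \<Lambda>))"
      unfolding sum_distrib_left[symmetric] using M0 by (intro mult_left_mono L2_set_mult_ineq) auto
    also have "\<dots> \<le> M * ((sqrt 128 * (3/2 * N k)) * sqrt q)"
    proof (intro mult_left_mono mult_mono)
      have "L2_set (\<lambda>i. norm (x i)) (T - \<Lambda>) \<le> sqrt (\<Sum>i\<in>T \<union> \<Lambda>. (norm (x i))\<^sup>2)"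
        unfolding L2_set_def using finT \<Lambda>(2) by (intro real_sqrt_le_mono sum_mono2) auto
      also have "\<dots> \<le> sqrt (128 * (sample_norm m \<xi> (\<lambda>y. H y - G k y))\<^sup>2)" using x2 by (rule real_sqrt_le_mono)
      also have "\<dots> = sqrt 128 * sample_norm m \<xi> (\<lambda>y. H y - G k y)" by (simp add: real_sqrt_mult)
      also have "\<dots> \<le> sqrt 128 * (3/2 * N k)" using HGN by (intro mult_left_mono) auto
      finally show "L2_set (\<lambda>i. norm (x i)) (T - \<Lambda>) \<le> sqrt 128 * (3/2 * N k)" .
      have "card (T - \<Lambda>) \<le> card T" using finT by (intro card_mono) auto
      then show "L2_set (\<lambda>_. 1) (T - \<Lambda>) \<le> sqrt q" using T(2) by (simp add: L2_set_def)
    qed (use M0 in auto)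
    finally show ?thesis by (simp add: mult_ac)
  qed
  moreover have "norm (?ip (res k) w) \<le> N k * (N k / 2)"
  proof -
    have "norm (?ip (res k) w) \<le> N k * sample_norm m \<xi> w" by (rule norm_sample_inner_le)
    also have "\<dots> \<le> N k * (N k / 2)" using \<omega> by (intro mult_left_mono) (auto simp: w_def H_def)
    finally show ?thesis .
  qed
  moreover have "complex_of_real ((N k)\<^sup>2) = ?ip (res k) (\<lambda>y. H y - G k y) + ?ip (res k) w"
  proof -
    have "complex_of_real ((N k)\<^sup>2) = ?ip (res k) (res k)" by (rule sample_inner_self[symmetric])
    also have "\<dots> = ?ip (res k) (\<lambda>y. (H y - G k y) - (H y - f0 y))" by (rule arg_cong[of _ _ "?ip (res k)"]) auto
    also have "\<dots> = ?ip (res k) (\<lambda>y. H y - G k y) + ?ip (res k) w"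
      by (simp add: sample_inner_diff_right w_def)
    finally show ?thesis .
  qed
  then have "(N k)\<^sup>2 \<le> norm (?ip (res k) (\<lambda>y. H y - G k y)) + norm (?ip (res k) w)"
    by (metis norm_of_real abs_of_nonneg norm_triangle_ineq zero_le_power2)
  ultimately have "(N k)\<^sup>2 \<le> M * (sqrt q * (sqrt 128 * (3/2 * N k))) + N k * (N k / 2)" by linarith
  moreover have "M * (sqrt q * (sqrt 128 * (3/2 * N k))) = N k * (3 * (sqrt q * sqrt 128) * M) / 2" by simp
  moreover have "N k * (N k / 2) = N k * N k / 2" by simp
  ultimately have "N k * N k \<le> N k * (3 * (sqrt q * sqrt 128) * M)"
    unfolding power2_eq_square by linarith
  moreover have Npos: "0 < N k" using \<omega> by linarith
  ultimately have "N k \<le> 3 * (sqrt q * sqrt 128) * M" by simp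
  then have "(N k)\<^sup>2 \<le> (3 * (sqrt q * sqrt 128) * M)\<^sup>2" using Npos by (intro power_mono) auto
  also have "\<dots> = 1152 * q * M\<^sup>2" using T(4) by (simp add: power_mult_distrib)
  finally have "t\<^sup>2 / (1152 * q) * (N k)\<^sup>2 \<le> t\<^sup>2 * M\<^sup>2" using T(4) t by (simp add: field_simps)
  also have "\<dots> = (norm (?ip (res k) (g (Suc k))))\<^sup>2" using t by (simp add: M_def power_divide)
  finally show ?thesis using womp_step_decrease[OF k] by (simp add: algebra_simps)
qed

text \<open>The geometric step applies as long as the residual is at least
  \<open>2 * \<omega>\<close>; once it is below, monotonicity keeps it there. The induction carries
  this alternative.\<close>

lemma womp_phase:
  assumes "k0 + \<tau> \<le> s" and T: "T \<subseteq> Q" "real (card T) \<le> q" "q + real s \<le> \<kappa>" "1 \<le> q"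
    and \<omega>: "sample_norm m \<xi> (\<lambda>x. f0 x - (\<Sum>i\<in>T. u i * \<phi> i x)) \<le> \<omega>" "0 < \<omega>"
    and start: "(N k0)\<^sup>2 * (1 - t\<^sup>2 / (1152 * q)) ^ \<tau> \<le> (2 * \<omega>)\<^sup>2"
  shows "N (k0 + \<tau>) \<le> 2 * \<omega>"
proof -
  let ?\<theta> = "1 - t\<^sup>2 / (1152 * q)"
  have "t\<^sup>2 \<le> 1" using t by (simp add: power_le_one)
  then have \<theta>: "0 \<le> ?\<theta>" using T(4) by (simp add: field_simps)
  have "N (k0 + i) \<le> 2 * \<omega> \<or> (N (k0 + i))\<^sup>2 \<le> (N k0)\<^sup>2 * ?\<theta> ^ i" if "i \<le> \<tau>" for i
    using that
  proof (induction i)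
    case (Suc i)
    have k: "k0 + i < s" using Suc.prems assms(1) by simp
    show ?case
    proof (cases "2 * \<omega> \<le> N (k0 + i)")
      case True
      then have "(N (Suc (k0 + i)))\<^sup>2 \<le> ?\<theta> * (N (k0 + i))\<^sup>2"
        using k T \<omega> by (intro womp_geometric_step) auto
      moreover have "(N (k0 + i))\<^sup>2 \<le> (N k0)\<^sup>2 * ?\<theta> ^ i \<or> N (k0 + i) = 2 * \<omega>" using Suc True by auto
      ultimately show ?thesis
      proof (elim disjE)
        assume a: "(N (Suc (k0 + i)))\<^sup>2 \<le> ?\<theta> * (N (k0 + i))\<^sup>2" "(N (k0 + i))\<^sup>2 \<le> (N k0)\<^sup>2 * ?\<theta> ^ i"
        have "?\<theta> * (N (k0 + i))\<^sup>2 \<le> ?\<theta> * ((N k0)\<^sup>2 * ?\<theta> ^ i)" using a(2) \<theta> by (rule mult_left_mono)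
        then show ?thesis using a(1) by (simp add: mult_ac)
      next
        assume "N (k0 + i) = 2 * \<omega>"
        then show ?thesis using womp_norm_mono[of "k0 + i" "k0 + Suc i"] k by simp
      qed
    next
      case False
      then show ?thesis using womp_norm_mono[of "k0 + i" "k0 + Suc i"] k by simp
    qed
  qed simp
  from this[of \<tau>] start have "N (k0 + \<tau>) \<le> 2 * \<omega> \<or> (N (k0 + \<tau>))\<^sup>2 \<le> (2 * \<omega>)\<^sup>2" by auto
  then show ?thesis using \<omega>(2) by (auto intro: power2_le_imp_le)
qed

text \<open>At scale \<open>l\<close>, a number of steps proportional to \<open>2 ^ l\<close> brings the residual down from the noise
  level \<open>\<omega> (l - 1)\<close> to \<open>\<omega> l\<close>; the geometric sum over the scales avoids a logarithmic factor.\<close>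

lemma womp_scales:
  fixes \<omega> :: "nat \<Rightarrow> real" and \<tau> :: nat
  assumes s: "s = (\<Sum>l\<le>L. \<tau> * 2 ^ l)" and C1: "1 \<le> C1" "C1 * 2 ^ L + real s \<le> \<kappa>"
    and T: "\<And>l. l \<le> L \<Longrightarrow> T l \<subseteq> Q" "\<And>l. l \<le> L \<Longrightarrow> real (card (T l)) \<le> C1 * 2 ^ l"
    and \<omega>: "\<And>l. l \<le> L \<Longrightarrow> sample_norm m \<xi> (\<lambda>x. f0 x - (\<Sum>i\<in>T l. u i * \<phi> i x)) \<le> \<omega> l" "\<And>l. 0 < \<omega> l"
      "\<And>l. \<omega> l \<le> \<rho> * \<omega> (Suc l)"
    and \<rho>: "1 \<le> \<rho>" "N 0 \<le> 2 * (\<rho> * \<omega> 0)" and \<tau>: "1152 * C1 * (2 * ln \<rho>) / t\<^sup>2 \<le> real \<tau>"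
  shows "N s \<le> 2 * \<omega> L"
proof -
  \<comment> \<open>Since \<open>1 - x <= exp (- x)\<close>, a number \<open>\<tau> * 2 ^ l\<close>
    of steps at the rate \<open>t ^ 2 / (1152 * C1 * 2 ^ l)\<close> yields a factor independent of
    \<open>l\<close>. The bound on \<tau> makes it at most \<open>1 / \<rho> ^ 2\<close>, which is
    what the passage from \<open>\<omega> l\<close> to \<open>\<omega> (Suc l)\<close> may
    lose.\<close>
  have decay: "(1 - t\<^sup>2 / (1152 * (C1 * 2 ^ l))) ^ (\<tau> * 2 ^ l) \<le> 1 / \<rho>\<^sup>2" for l
  proof -
    let ?x = "t\<^sup>2 / (1152 * (C1 * 2 ^ l))"
    have "1 \<le> C1 * 2 ^ l" using mult_mono[of 1 C1 1 "2 ^ l"] C1(1) by simp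
    moreover have "t\<^sup>2 \<le> 1" using t by (simp add: power_le_one)
    ultimately have "0 \<le> 1 - ?x" by (simp add: field_simps)
    then have "(1 - ?x) ^ (\<tau> * 2 ^ l) \<le> exp (- ?x) ^ (\<tau> * 2 ^ l)"
      using exp_ge_add_one_self[of "- ?x"] by (intro power_mono) auto
    also have "\<dots> = exp (- (t\<^sup>2 * real \<tau> / (1152 * C1)))" by (simp flip: exp_of_nat_mult)
    also have "\<dots> \<le> exp (- (2 * ln \<rho>))" using \<tau> t C1(1) by (simp add: field_simps)
    also have "\<dots> = 1 / \<rho>\<^sup>2" using \<rho>(1) by (simp add: exp_minus exp_double ln_realpow[symmetric] inverse_eq_divide)
    finally show ?thesis .
  qed
  have "N (\<Sum>i\<le>l. \<tau> * 2 ^ i) \<le> 2 * \<omega> l" if "l \<le> L" for l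
    using that
  proof (induction l)
    case 0
    have "N (0 + \<tau> * 2 ^ 0) \<le> 2 * \<omega> 0"
    proof (rule womp_phase[where T = "T 0" and q = "C1 * 2 ^ 0" and u = u])
      show "0 + \<tau> * 2 ^ 0 \<le> s" unfolding s add_0 by (rule member_le_sum) auto
      have "C1 * 2 ^ 0 \<le> C1 * 2 ^ L" using C1(1) by (intro mult_left_mono power_increasing) auto
      then show "C1 * 2 ^ 0 + real s \<le> \<kappa>" using C1(2) by linarith
      have "(N 0)\<^sup>2 * (1 - t\<^sup>2 / (1152 * (C1 * 2 ^ 0))) ^ (\<tau> * 2 ^ 0) \<le> (N 0)\<^sup>2 * (1 / \<rho>\<^sup>2)"
        by (intro mult_left_mono decay) auto
      also have "\<dots> \<le> (2 * (\<rho> * \<omega> 0))\<^sup>2 * (1 / \<rho>\<^sup>2)" using \<rho> by (intro mult_right_mono power_mono) auto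
      also have "\<dots> = (2 * \<omega> 0)\<^sup>2" using \<rho> by (simp add: power_mult_distrib)
      finally show "(N 0)\<^sup>2 * (1 - t\<^sup>2 / (1152 * (C1 * 2 ^ 0))) ^ (\<tau> * 2 ^ 0) \<le> (2 * \<omega> 0)\<^sup>2" .
    qed (use T[of 0] \<omega>(1)[of 0] \<omega>(2) C1 in auto)
    then show ?case by simp
  next
    case (Suc l)
    define k0 where "k0 = (\<Sum>i\<le>l. \<tau> * 2 ^ i)"
    have Nk0: "N k0 \<le> 2 * (\<rho> * \<omega> (Suc l))" using Suc \<omega>(3)[of l] by (simp add: k0_def)
    have "N (k0 + \<tau> * 2 ^ Suc l) \<le> 2 * \<omega> (Suc l)"
    proof (rule womp_phase[where T = "T (Suc l)" and q = "C1 * 2 ^ Suc l" and u = u])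
      have "k0 + \<tau> * 2 ^ Suc l = (\<Sum>i\<le>Suc l. \<tau> * 2 ^ i)" by (simp add: k0_def)
      also have "\<dots> \<le> s" unfolding s using Suc.prems by (intro sum_mono2) auto
      finally show "k0 + \<tau> * 2 ^ Suc l \<le> s" .
      have "C1 * 2 ^ Suc l \<le> C1 * 2 ^ L" using C1(1) Suc.prems by (intro mult_left_mono power_increasing) auto
      then show "C1 * 2 ^ Suc l + real s \<le> \<kappa>" using C1(2) by linarith
      have "(N k0)\<^sup>2 * (1 - t\<^sup>2 / (1152 * (C1 * 2 ^ Suc l))) ^ (\<tau> * 2 ^ Suc l) \<le> (N k0)\<^sup>2 * (1 / \<rho>\<^sup>2)"
        by (intro mult_left_mono decay) auto
      also have "\<dots> \<le> (2 * (\<rho> * \<omega> (Suc l)))\<^sup>2 * (1 / \<rho>\<^sup>2)" using Nk0 by (intro mult_right_mono power_mono) auto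
      also have "\<dots> = (2 * \<omega> (Suc l))\<^sup>2" using \<rho> by (simp add: power_mult_distrib)
      finally show "(N k0)\<^sup>2 * (1 - t\<^sup>2 / (1152 * (C1 * 2 ^ Suc l))) ^ (\<tau> * 2 ^ Suc l) \<le> (2 * \<omega> (Suc l))\<^sup>2" .
      show "1 \<le> C1 * 2 ^ Suc l" using mult_mono[OF C1(1) one_le_power[of "2 :: real" "Suc l"]] C1(1) by simp
    qed (use T[of "Suc l"] \<omega>(1)[of "Suc l"] \<omega>(2) Suc.prems in auto)
    then show ?case by (simp add: k0_def)
  qed
  from this[of L] show ?thesis by (simp add: s)
qed

end

section \<open>Recovery from samples\<close>

definition sample_isometry :: "nat \<Rightarrow> (nat \<Rightarrow> 'a) \<Rightarrow> ('k \<Rightarrow> 'a \<Rightarrow> complex) \<Rightarrow> 'k set \<Rightarrow> real \<Rightarrow> bool" where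
  "sample_isometry m \<xi> \<phi> Q K \<longleftrightarrow> (\<forall>x.
    (sample_norm m \<xi> (\<lambda>y. \<Sum>k\<in>Q. x k * \<phi> k y))\<^sup>2
      \<le> 64 * (\<Sum>k\<in>Q. (norm (x k))\<^sup>2) + 20 * (\<Sum>k\<in>Q. norm (x k))\<^sup>2 / K \<and>
    (\<Sum>k\<in>Q. (norm (x k))\<^sup>2)
      \<le> 64 * (sample_norm m \<xi> (\<lambda>y. \<Sum>k\<in>Q. x k * \<phi> k y))\<^sup>2 + 20 * (\<Sum>k\<in>Q. norm (x k))\<^sup>2 / K)"

lemma sample_isometry_subset:
  fixes \<phi> :: "'k \<Rightarrow> 'a \<Rightarrow> complex"
  assumes "sample_isometry m \<xi> \<phi> Q K" "finite Q" "R \<subseteq> Q"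
  shows "sample_isometry m \<xi> \<phi> R K"
  unfolding sample_isometry_def
proof (rule allI)
  fix x :: "'k \<Rightarrow> complex"
  let ?x = "\<lambda>k. if k \<in> R then x k else 0"
  have 1: "(\<Sum>k\<in>Q. ?x k * \<phi> k y) = (\<Sum>k\<in>R. x k * \<phi> k y)" for y
    using assms(2,3) by (intro sum.mono_neutral_cong_right) auto
  have 2: "(\<Sum>k\<in>Q. (norm (?x k))\<^sup>2) = (\<Sum>k\<in>R. (norm (x k))\<^sup>2)" "(\<Sum>k\<in>Q. norm (?x k)) = (\<Sum>k\<in>R. norm (x k))"
    using assms(2,3) by (intro sum.mono_neutral_cong_right; auto)+
  show "(sample_norm m \<xi> (\<lambda>y. \<Sum>k\<in>R. x k * \<phi> k y))\<^sup>2
      \<le> 64 * (\<Sum>k\<in>R. (norm (x k))\<^sup>2) + 20 * (\<Sum>k\<in>R. norm (x k))\<^sup>2 / K \<and>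
    (\<Sum>k\<in>R. (norm (x k))\<^sup>2)
      \<le> 64 * (sample_norm m \<xi> (\<lambda>y. \<Sum>k\<in>R. x k * \<phi> k y))\<^sup>2 + 20 * (\<Sum>k\<in>R. norm (x k))\<^sup>2 / K"
    using assms(1)[unfolded sample_isometry_def, rule_format, of ?x] unfolding 1 2 .
qed

lemma sum_sq_le_card: "(\<Sum>k\<in>R. norm (x k))\<^sup>2 \<le> real (card R) * (\<Sum>k\<in>R. (norm (x k))\<^sup>2)"
proof -
  have "(\<Sum>k\<in>R. \<bar>1\<bar> * \<bar>norm (x k)\<bar>) \<le> L2_set (\<lambda>_. 1) R * L2_set (\<lambda>k. norm (x k)) R"
    by (rule L2_set_mult_ineq)
  then have "(\<Sum>k\<in>R. norm (x k))\<^sup>2 \<le> (L2_set (\<lambda>_. 1) R * L2_set (\<lambda>k. norm (x k)) R)\<^sup>2"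
    by (intro power_mono sum_nonneg) auto
  also have "\<dots> = real (card R) * (\<Sum>k\<in>R. (norm (x k))\<^sup>2)"
    by (simp add: power_mult_distrib L2_set_def sum_nonneg)
  finally show ?thesis .
qed

text \<open>By Cauchy-Schwarz the squared \<open>l_1\<close> norm is at most \<open>K / 40\<close>
  times the squared \<open>l_2\<close> norm, so the additive error is at most half of the left side;
  moving it there doubles 64 to 128.\<close>

lemma sample_isometry_sparse:
  assumes "sample_isometry m \<xi> \<phi> Q K" "finite Q" "R \<subseteq> Q" "real (card R) \<le> K / 40" "0 < K"
  shows "(\<Sum>k\<in>R. (norm (x k))\<^sup>2) \<le> 128 * (sample_norm m \<xi> (\<lambda>y. \<Sum>k\<in>R. x k * \<phi> k y))\<^sup>2"
proof -
  have "sample_isometry m \<xi> \<phi> R K" using assms sample_isometry_subset by blast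
  then have "(\<Sum>k\<in>R. (norm (x k))\<^sup>2)
      \<le> 64 * (sample_norm m \<xi> (\<lambda>y. \<Sum>k\<in>R. x k * \<phi> k y))\<^sup>2 + 20 * (\<Sum>k\<in>R. norm (x k))\<^sup>2 / K"
    by (simp add: sample_isometry_def)
  moreover have "20 * (\<Sum>k\<in>R. norm (x k))\<^sup>2 / K \<le> (\<Sum>k\<in>R. (norm (x k))\<^sup>2) / 2"
  proof -
    have "(\<Sum>k\<in>R. norm (x k))\<^sup>2 \<le> K / 40 * (\<Sum>k\<in>R. (norm (x k))\<^sup>2)"
      using sum_sq_le_card[of x R] mult_right_mono[OF assms(4), of "\<Sum>k\<in>R. (norm (x k))\<^sup>2"]
      by (meson order_trans sum_nonneg zero_le_power2)
    then show ?thesis using assms(5) by (simp add: field_simps)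
  qed
  ultimately show ?thesis by linarith
qed

text \<open>Made for remainders, which have many frequencies but a small \<open>l_1\<close> norm:
  both terms of the upper bound are multiples of \<open>B ^ 2 / n\<close>, and
  \<open>64 + 20 <= 10 ^ 2\<close>.\<close>

lemma sample_isometry_compressible:
  assumes "sample_isometry m \<xi> \<phi> Q K" "finite Q" "R \<subseteq> Q" "n \<le> K" "1 \<le> n" "0 \<le> B"
    and "(\<Sum>k\<in>R. norm (x k)) \<le> B" "(\<Sum>k\<in>R. (norm (x k))\<^sup>2) \<le> B\<^sup>2 / n"
  shows "sample_norm m \<xi> (\<lambda>y. \<Sum>k\<in>R. x k * \<phi> k y) \<le> 10 * B / sqrt n"
proof -
  have "sample_isometry m \<xi> \<phi> R K" using assms sample_isometry_subset by blast
  then have "(sample_norm m \<xi> (\<lambda>y. \<Sum>k\<in>R. x k * \<phi> k y))\<^sup>2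
      \<le> 64 * (\<Sum>k\<in>R. (norm (x k))\<^sup>2) + 20 * (\<Sum>k\<in>R. norm (x k))\<^sup>2 / K" by (simp add: sample_isometry_def)
  also have "\<dots> \<le> 64 * (B\<^sup>2 / n) + 20 * B\<^sup>2 / n"
    using assms by (intro add_mono mult_left_mono frac_le power_mono sum_nonneg) auto
  also have "\<dots> \<le> (10 * B / sqrt n)\<^sup>2"
  proof -
    have "(10 * B / sqrt n)\<^sup>2 = 100 * (B\<^sup>2 / n)" using assms(5) by (simp add: power_divide power_mult_distrib)
    moreover have "0 \<le> B\<^sup>2 / n" using assms(5) by simp
    ultimately show ?thesis by simp
  qed
  finally show ?thesis by (rule power2_le_imp_le) (use assms in simp)
qed

section \<open>Existence and number of sample points\<close>

text \<open>The two lower bounds on \<open>M\<close> have different purposes: the first excludes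
  aliasing on the grid, the second leaves room for \<open>m\<close> distinct points. Since
  \<open>M\<close> enters the condition on \<open>m\<close> only through its logarithm, both are
  cheap.\<close>

lemma exists_sample_isometry:
  assumes J: "Q = {k :: int ^ 'd::finite. freq_level k \<le> J}" and M: "2 ^ (J + 1) \<le> M" "2 * m\<^sup>2 \<le> M"
    and K: "0 < K" "K \<le> 4 ^ I"
    and mK: "3200 * K * (real I + 1) * ln (4 * real (M ^ CARD('d))) * ln (4 * real (card Q)) \<le> real m"
  shows "\<exists>\<xi> :: nat \<Rightarrow> real ^ 'd. inj_on \<xi> {..<m} \<and> \<xi> ` {..<m} \<subseteq> torus \<and> sample_isometry m \<xi> trig Q K"
proof -
  have M0: "0 < M" using M(1) by (meson less_le_trans zero_less_numeral zero_less_power)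
  let ?Y = "grid M :: (real ^ 'd) set"
  note grid = grid_props[OF M0, where 'd = 'd]
  have cYpos: "0 < card ?Y" using M0 by (simp add: grid(2))
  have Q: "finite Q" unfolding J by (rule finite_freq_level_le)
  have "freq_level (0 :: int ^ 'd) = 0" using bit_length_le_iff[of 0 0] by (simp add: freq_level_def)
  then have "0 \<in> Q" by (simp add: J)
  then have Q_ne: "Q \<noteq> {}" by auto
  have "M ^ 1 \<le> M ^ CARD('d)" using M0 by (intro power_increasing) (auto simp: Suc_leI)
  then have m2: "2 * m\<^sup>2 \<le> card ?Y" using M(2) by (simp add: grid(2))
  have "\<exists>ys. length ys = m \<and> distinct ys \<and> set ys \<subseteq> ?Y \<and> (\<forall>x.
      (\<Sum>y\<in>set ys. (norm (\<Sum>k\<in>Q. x k * trig k y))\<^sup>2) / m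
        \<le> 64 * (\<Sum>k\<in>Q. (norm (x k))\<^sup>2) + 20 * (\<Sum>k\<in>Q. norm (x k))\<^sup>2 / K \<and>
      (\<Sum>k\<in>Q. (norm (x k))\<^sup>2)
        \<le> 64 * ((\<Sum>y\<in>set ys. (norm (\<Sum>k\<in>Q. x k * trig k y))\<^sup>2) / m) + 20 * (\<Sum>k\<in>Q. norm (x k))\<^sup>2 / K)"
  proof (rule sampled_isometry[OF Q Q_ne grid(1) _ _ _ K m2])
    show "?Y \<noteq> {}" using cYpos by auto
    show "(\<Sum>y\<in>?Y. (norm (\<Sum>k\<in>Q. x k * trig k y))\<^sup>2) = real (card ?Y) * (\<Sum>k\<in>Q. (norm (x k))\<^sup>2)" for x
      by (rule grid_parseval[OF Q _ M(1)]) (simp add: J)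
    show "3200 * K * (real I + 1) * ln (4 * real (card ?Y)) * ln (4 * real (card Q)) \<le> real m"
      using mK by (simp add: grid(2))
  qed simp
  then obtain ys :: "(real ^ 'd) list" where ys: "length ys = m" "distinct ys" "set ys \<subseteq> ?Y"
    and iso: "\<And>x. (\<Sum>y\<in>set ys. (norm (\<Sum>k\<in>Q. x k * trig k y))\<^sup>2) / m
        \<le> 64 * (\<Sum>k\<in>Q. (norm (x k))\<^sup>2) + 20 * (\<Sum>k\<in>Q. norm (x k))\<^sup>2 / K \<and>
      (\<Sum>k\<in>Q. (norm (x k))\<^sup>2)
        \<le> 64 * ((\<Sum>y\<in>set ys. (norm (\<Sum>k\<in>Q. x k * trig k y))\<^sup>2) / m) + 20 * (\<Sum>k\<in>Q. norm (x k))\<^sup>2 / K"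
    by blast
  have bij: "bij_betw (\<lambda>j. ys ! j) {..<m} (set ys)" using ys by (simp add: bij_betw_nth)
  have "(sample_norm m (\<lambda>j. ys ! j) (\<lambda>y. \<Sum>k\<in>Q. x k * trig k y))\<^sup>2
     = (\<Sum>y\<in>set ys. (norm (\<Sum>k\<in>Q. x k * trig k y))\<^sup>2) / m" for x
    unfolding sample_norm_sq by (simp only: sum.reindex_bij_betw[OF bij, of "\<lambda>y. (norm (\<Sum>k\<in>Q. x k * trig k y))\<^sup>2"])
  then have "sample_isometry m (\<lambda>j. ys ! j) trig Q K" using iso by (simp add: sample_isometry_def)
  then show ?thesis using bij ys(3) grid(3)
    by (intro exI[of _ "\<lambda>j. ys ! j"]) (auto simp: bij_betw_def)
qed

text \<open>A count of the enclosing cube, far from sharp for a hyperbolic cross; only its logarithm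
  is used, which has the right order \<open>J\<close> all the same.\<close>

lemma card_freq_level_le: "real (card {k :: int ^ 'd::finite. freq_level k \<le> J}) \<le> (2 ^ (J + 1)) ^ CARD('d)"
proof -
  let ?P = "PiE (UNIV :: 'd set) (\<lambda>_. {- (2 ^ J) <..< 2 ^ J :: int})"
  have inj: "inj_on vec_nth {k :: int ^ 'd. freq_level k \<le> J}" by (simp add: inj_on_def vec_nth_inject)
  have "vec_nth ` {k :: int ^ 'd. freq_level k \<le> J} \<subseteq> ?P"
  proof -
    have "\<bar>k $ i\<bar> < 2 ^ J" if "freq_level k \<le> J" for k :: "int ^ 'd" and i
      using that bit_length_component_le[of k i] bit_length_le_iff[of "k $ i" J] by simp
    then show ?thesis by (auto simp: abs_less_iff minus_less_iff)
  qed
  moreover have "finite ?P" by (intro finite_PiE) auto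
  ultimately have "card {k :: int ^ 'd. freq_level k \<le> J} \<le> card ?P"
    using inj by (metis card_image card_mono)
  also have "\<dots> = (card {- (2 ^ J) <..< 2 ^ J :: int}) ^ CARD('d)" by (simp add: card_PiE)
  also have "\<dots> \<le> (2 ^ (J + 1)) ^ CARD('d)" by (intro power_mono) (auto simp: nat_le_iff)
  finally have "real (card {k :: int ^ 'd. freq_level k \<le> J}) \<le> real ((2 ^ (J + 1)) ^ CARD('d))"
    by (simp only: of_nat_le_iff)
  then show ?thesis by simp
qed

text \<open>The grid grows with \<open>m\<close>, so \<open>ln m\<close> appears in the requirement
  on \<open>m\<close> itself, and \<open>m\<close> is not bounded in terms of \<open>L\<close>.
  Writing \<open>m = r * X\<close> with \<open>X = 2 ^ L * (L + 1) ^ 3\<close>, the part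
  \<open>ln X\<close> is of order \<open>L + 1\<close>, and \<open>ln r <= 2 * sqrt r\<close> is
  outweighed by \<open>r\<close>.\<close>

lemma sample_size_bound:
  fixes C :: real assumes "0 < C"
  shows "\<exists>c>0. \<forall>L m::nat. c * 2 ^ L * (real L + 1) ^ 3 \<le> real m \<longrightarrow>
    1 \<le> m \<and> C * 2 ^ L * (real L + 1)\<^sup>2 * ((real L + 1) + ln (real m)) \<le> real m"
proof -
  \<comment> \<open>The bounds \<open>16 * C <= r\<close> and \<open>64 * C ^ 2 <= r\<close> give
    \<open>5 * C <= 5 / 16 * r\<close> and \<open>2 * C * sqrt r <= r / 4\<close>, which are the two
    terms left at the end.\<close>
  define c where "c = 1 + 16 * C + 64 * C\<^sup>2"
  have c: "1 \<le> c" "16 * C \<le> c" "64 * C\<^sup>2 \<le> c" using assms by (auto simp: c_def)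
  have "1 \<le> m \<and> C * 2 ^ L * (real L + 1)\<^sup>2 * ((real L + 1) + ln (real m)) \<le> real m"
    if m: "c * 2 ^ L * (real L + 1) ^ 3 \<le> real m" for L m :: nat
  proof -
    define \<Lambda> where "\<Lambda> = real L + 1"
    define X where "X = 2 ^ L * \<Lambda> ^ 3"
    define r where "r = real m / X"
    have \<Lambda>: "1 \<le> \<Lambda>" by (simp add: \<Lambda>_def)
    have "(1::real) * 1 \<le> 2 ^ L * \<Lambda> ^ 3" using \<Lambda> by (intro mult_mono) (auto simp: one_le_power)
    then have X: "1 \<le> X" by (simp add: X_def)
    have cX: "c * X \<le> real m" using m by (simp add: X_def \<Lambda>_def mult.assoc)
    then have rc: "c \<le> r" using X by (simp add: r_def pos_le_divide_eq)
    have r: "1 \<le> r" using rc c by linarith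
    have mr: "real m = r * X" using X by (simp add: r_def)
    have "1 * 1 \<le> c * X" using c X by (intro mult_mono) auto
    then have m1: "1 \<le> m" using cX by simp
    have "ln X = real L * ln 2 + 3 * ln \<Lambda>" using \<Lambda> by (simp add: X_def ln_mult ln_realpow)
    also have "\<dots> \<le> real L * 1 + 3 * (\<Lambda> - 1)"
      using \<Lambda> ln_2_less_1 by (intro add_mono mult_left_mono ln_le_minus_one) auto
    also have "\<dots> \<le> 4 * \<Lambda>" by (simp add: \<Lambda>_def)
    finally have lnX: "ln X \<le> 4 * \<Lambda>" .
    have "ln r = 2 * ln (sqrt r)" using r by (simp add: ln_sqrt)
    also have "\<dots> \<le> 2 * sqrt r" using ln_le_minus_one[of "sqrt r"] r by simp
    finally have lnr: "ln r \<le> 2 * sqrt r" .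
    have sq: "8 * C * sqrt r \<le> r"
    proof -
      have "sqrt (64 * C\<^sup>2) \<le> sqrt r" using c(3) rc by (intro real_sqrt_le_mono) linarith
      then have "8 * C \<le> sqrt r" using assms by (simp add: real_sqrt_mult)
      then have "8 * C * sqrt r \<le> sqrt r * sqrt r" using r by (intro mult_right_mono) auto
      then show ?thesis using r by simp
    qed
    have "ln (real m) = ln r + ln X" using r X by (simp add: mr ln_mult)
    then have "\<Lambda> + ln (real m) \<le> \<Lambda> * (5 + 2 * sqrt r)"
    proof -
      have "2 * sqrt r * 1 \<le> 2 * sqrt r * \<Lambda>" using \<Lambda> r by (intro mult_left_mono) auto
      then show ?thesis using lnX lnr \<open>ln (real m) = ln r + ln X\<close> by (simp add: algebra_simps)
    qed
    then have "C * 2 ^ L * \<Lambda>\<^sup>2 * (\<Lambda> + ln (real m)) \<le> C * 2 ^ L * \<Lambda>\<^sup>2 * (\<Lambda> * (5 + 2 * sqrt r))"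
      using assms by (intro mult_left_mono) auto
    also have "\<dots> = X * (5 * C + 2 * C * sqrt r)"
      by (simp add: X_def power2_eq_square power3_eq_cube algebra_simps)
    also have "\<dots> \<le> X * r"
    proof (intro mult_left_mono)
      show "5 * C + 2 * C * sqrt r \<le> r" using c(2) rc sq assms by linarith
    qed (use X in auto)
    finally show ?thesis using m1 by (simp add: mr \<Lambda>_def mult.commute)
  qed
  then show ?thesis using c(1) by (intro exI[of _ c]) auto
qed

lemma exists_sample_isometry_log_cubed:
  fixes A :: nat and \<kappa>0 :: real
  assumes "1 \<le> \<kappa>0"
  shows "\<exists>c>0. \<forall>L m::nat. c * 2 ^ L * (real L + 1) ^ 3 \<le> real m \<longrightarrow> 1 \<le> m \<and>
    (\<exists>\<xi> :: nat \<Rightarrow> real ^ 'd::finite. inj_on \<xi> {..<m} \<and> \<xi> ` {..<m} \<subseteq> torus \<and>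
      sample_isometry m \<xi> trig {k. freq_level k \<le> A * (L + 1)} (\<kappa>0 * 2 ^ L))"
proof -
  define d where "d = real CARD('d)"
  have d: "1 \<le> d" by (simp add: d_def Suc_leI)
  obtain I0 :: nat where I0: "\<kappa>0 < 4 ^ I0" using real_arch_pow[of 4 \<kappa>0] by auto
  define c1 where "c1 = 2 + d * (real A + 1)"
  define c2 where "c2 = 2 + d * (real A + 2) + 2 * d"
  have c12: "0 < c1" "0 < c2" using d by (simp_all add: c1_def c2_def add_pos_nonneg)
  define C where "C = 3200 * \<kappa>0 * (real I0 + 1) * c1 * c2"
  have "0 < C" using assms c12 by (simp add: C_def)
  then obtain c where c: "c > 0" "\<And>L m::nat. c * 2 ^ L * (real L + 1) ^ 3 \<le> real m \<Longrightarrow>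
    1 \<le> m \<and> C * 2 ^ L * (real L + 1)\<^sup>2 * ((real L + 1) + ln (real m)) \<le> real m"
    using sample_size_bound by blast
  have "1 \<le> m \<and> (\<exists>\<xi> :: nat \<Rightarrow> real ^ 'd. inj_on \<xi> {..<m} \<and> \<xi> ` {..<m} \<subseteq> torus \<and>
      sample_isometry m \<xi> trig {k. freq_level k \<le> A * (L + 1)} (\<kappa>0 * 2 ^ L))"
    if m: "c * 2 ^ L * (real L + 1) ^ 3 \<le> real m" for L m :: nat
  proof
    show m1: "1 \<le> m" using c(2)[OF m] by blast
    define J where "J = A * (L + 1)"
    define \<Lambda> where "\<Lambda> = real L + 1"
    have \<Lambda>: "1 \<le> \<Lambda>" by (simp add: \<Lambda>_def)
    \<comment> \<open>The product meets both lower bounds on the grid at once, and its logarithm is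
      a sum of terms of order \<open>ln m\<close> and \<open>L + 1\<close>.\<close>
    define M where "M = 2 * m\<^sup>2 * 2 ^ (J + 1)"
    let ?Q = "{k :: int ^ 'd. freq_level k \<le> J}"
    have J1: "real J + 1 \<le> (real A + 1) * \<Lambda>" by (simp add: J_def \<Lambda>_def algebra_simps)
    have lnJ: "ln ((2::real) ^ (J + 1)) \<le> (real A + 1) * \<Lambda>"
    proof -
      have "ln ((2::real) ^ (J + 1)) = (real J + 1) * ln 2" by (simp add: ln_realpow distrib_right ln_mult)
      also have "\<dots> \<le> (real J + 1) * 1" using ln_2_less_1 by (intro mult_left_mono) auto
      finally show ?thesis using J1 by simp
    qed
    have ln4: "ln (4::real) \<le> 2"
    proof -
      have four: "(4::real) = 2 ^ 2" by simp
      have "ln (4::real) = real 2 * ln 2" unfolding four by (rule ln_realpow)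
      then show ?thesis using ln_2_less_1 by simp
    qed
    have "0 \<in> ?Q" using bit_length_le_iff[of 0 0] by (simp add: freq_level_def)
    then have cQ: "1 \<le> real (card ?Q)" using finite_freq_level_le[of J, where 'd = 'd]
      by (metis (no_types, lifting) One_nat_def Suc_leI card_gt_0_iff empty_iff of_nat_1 of_nat_le_iff)
    have lnQ: "ln (4 * real (card ?Q)) \<le> c1 * \<Lambda>"
    proof -
      have "ln (4 * real (card ?Q)) = ln 4 + ln (real (card ?Q))" using cQ by (simp add: ln_mult)
      also have "ln (real (card ?Q)) \<le> ln ((2 ^ (J + 1)) ^ CARD('d))"
        using cQ card_freq_level_le[of J, where 'd = 'd] by (intro ln_mono) auto
      also have "\<dots> = d * ln (2 ^ (J + 1))" unfolding d_def by (rule ln_realpow)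
      also have "\<dots> \<le> d * ((real A + 1) * \<Lambda>)" using lnJ d by (intro mult_left_mono) auto
      finally have "ln (4 * real (card ?Q)) \<le> 2 + d * ((real A + 1) * \<Lambda>)" using ln4 by simp
      then show ?thesis using \<Lambda> by (simp add: c1_def algebra_simps)
    qed
    have lnY: "ln (4 * real (M ^ CARD('d))) \<le> c2 * (\<Lambda> + ln (real m))"
    proof -
      have M_eq: "real M = 2 * (real m)\<^sup>2 * 2 ^ (J + 1)" by (simp add: M_def)
      have M_pos: "0 < real M" using m1 by (simp add: M_def)
      have lnm: "0 \<le> ln (real m)" using m1 by simp
      have "ln (real M) = ln 2 + 2 * ln (real m) + ln (2 ^ (J + 1))"
      proof -
        have "ln (real M) = ln (2 * (real m)\<^sup>2) + ln (2 ^ (J + 1))"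
          unfolding M_eq by (rule ln_mult_pos) (use m1 in auto)
        also have "ln (2 * (real m)\<^sup>2) = ln 2 + ln ((real m)\<^sup>2)" by (rule ln_mult_pos) (use m1 in auto)
        also have "ln ((real m)\<^sup>2) = real 2 * ln (real m)" by (rule ln_realpow)
        finally show ?thesis by (simp only: of_nat_numeral)
      qed
      also have "\<dots> \<le> 1 + 2 * ln (real m) + (real A + 1) * \<Lambda>" using lnJ ln_2_less_1 by linarith
      finally have lnM: "ln (real M) \<le> (real A + 2) * \<Lambda> + 2 * ln (real m)" using \<Lambda> by (simp add: algebra_simps)
      have "ln (4 * real (M ^ CARD('d))) = ln 4 + ln (real M ^ CARD('d))" using M_pos by (simp add: ln_mult)
      also have "ln (real M ^ CARD('d)) = d * ln (real M)" unfolding d_def by (rule ln_realpow)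
      also have "ln 4 + d * ln (real M) \<le> 2 * \<Lambda> + d * ((real A + 2) * \<Lambda> + 2 * ln (real m))"
        using ln4 lnM d \<Lambda> by (intro add_mono mult_left_mono) auto
      also have "\<dots> \<le> c2 * (\<Lambda> + ln (real m))"
      proof -
        have "0 \<le> (2 + d * (real A + 2)) * ln (real m)" "0 \<le> 2 * d * \<Lambda>" using lnm d \<Lambda> by auto
        then show ?thesis by (simp add: c2_def algebra_simps)
      qed
      finally show ?thesis .
    qed
    have "\<exists>\<xi> :: nat \<Rightarrow> real ^ 'd. inj_on \<xi> {..<m} \<and> \<xi> ` {..<m} \<subseteq> torus \<and> sample_isometry m \<xi> trig ?Q (\<kappa>0 * 2 ^ L)"
    proof (rule exists_sample_isometry[OF refl, where I = "I0 + L"])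
      show "2 ^ (J + 1) \<le> M" "2 * m\<^sup>2 \<le> M" using m1 by (auto simp: M_def)
      show "0 < \<kappa>0 * 2 ^ L" using assms by simp
      have "\<kappa>0 * 2 ^ L \<le> 4 ^ I0 * 4 ^ L" using I0 assms by (intro mult_mono power_mono) auto
      then show "\<kappa>0 * 2 ^ L \<le> 4 ^ (I0 + L)" by (simp add: power_add)
      have I: "real (I0 + L) + 1 \<le> (real I0 + 1) * \<Lambda>" by (simp add: \<Lambda>_def algebra_simps)
      have Y0: "0 \<le> ln (4 * real (M ^ CARD('d)))"
      proof -
        have "1 \<le> M ^ CARD('d)" using m1 by (simp add: M_def)
        then have "1 \<le> 4 * real (M ^ CARD('d))" by linarith
        then show ?thesis by (rule ln_ge_zero)
      qed
      have "3200 * (\<kappa>0 * 2 ^ L) * (real (I0 + L) + 1) * ln (4 * real (M ^ CARD('d))) * ln (4 * real (card ?Q))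
        \<le> 3200 * (\<kappa>0 * 2 ^ L) * ((real I0 + 1) * \<Lambda>) * (c2 * (\<Lambda> + ln (real m))) * (c1 * \<Lambda>)"
        using assms I Y0 lnY lnQ cQ \<Lambda> by (intro mult_mono) auto
      also have "\<dots> = C * 2 ^ L * \<Lambda>\<^sup>2 * (\<Lambda> + ln (real m))" by (simp add: C_def power2_eq_square mult_ac)
      also have "\<dots> \<le> real m" using c(2)[OF m] by (simp add: \<Lambda>_def)
      finally show "3200 * (\<kappa>0 * 2 ^ L) * (real (I0 + L) + 1) * ln (4 * real (M ^ CARD('d))) * ln (4 * real (card ?Q)) \<le> real m" .
    qed
    then show "\<exists>\<xi> :: nat \<Rightarrow> real ^ 'd. inj_on \<xi> {..<m} \<and> \<xi> ` {..<m} \<subseteq> torus \<and>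
      sample_isometry m \<xi> trig {k. freq_level k \<le> A * (L + 1)} (\<kappa>0 * 2 ^ L)" by (simp only: J_def)
  qed
  then show ?thesis using c(1) by (intro exI[of _ c]) blast
qed

section \<open>From small samples to a small norm on the torus\<close>

text \<open>After the remainder is subtracted from \<open>F\<close>, the polynomial on
  \<open>R\<close> still has small samples. The sparse lower bound then controls its coefficients in
  \<open>l_2\<close>, with 12 rounding up \<open>sqrt 128\<close>, and in \<open>l_1\<close> because
  \<open>R\<close> has at most \<open>\<nu> * n\<close> elements. The \<open>l_1\<close> norm bounds
  \<open>F\<close> uniformly and the squared \<open>l_2\<close> norm gains the factor
  \<open>1 / n\<close>, as the interpolation needs. The form of the statement fits residuals of the
  algorithm as well as differences of two functions of the class.\<close>

lemma recovery_error_bound: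
  fixes F :: "real ^ 'd::finite \<Rightarrow> complex"
  assumes iso: "sample_isometry m \<xi> trig Q K" "finite Q" "R \<subseteq> Q" "0 < m"
    and n: "1 \<le> n" "n \<le> K" "0 \<le> \<nu>" "real (card R) \<le> \<nu> * n" "\<nu> * n \<le> K / 40"
    and p: "2 \<le> p" and E: "0 < E" "0 \<le> a1" "0 \<le> a2" "0 < a3"
    and F: "F \<in> borel_measurable borel" "\<And>y. norm (F y - (\<Sum>k\<in>Q. x k * trig k y)) \<le> a2 * E / n"
    and small: "(\<Sum>k\<in>Q - R. norm (x k)) \<le> a1 * E" "(\<Sum>k\<in>Q - R. (norm (x k))\<^sup>2) \<le> (a1 * E)\<^sup>2 / n"
    and samples: "sample_norm m \<xi> F \<le> a3 * E / sqrt n"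
  shows "Lp_norm torus_measure p F
    \<le> ennreal (2 * ((a1 + a2 + 12 * (sqrt \<nu> + 1) * (10 * a1 + a2 + a3)) * E) * n powr (- 1 / p))"
proof -
  let ?P = "\<lambda>S y. \<Sum>k\<in>S. x k * trig k y"
  let ?sn = "sample_norm m \<xi>"
  define a4 where "a4 = 10 * a1 + a2 + a3"
  have a4: "0 < a4" using E by (simp add: a4_def)
  have finR: "finite R" using iso finite_subset by blast
  have sqn: "1 \<le> sqrt n" "sqrt n \<le> n" using n(1) real_sqrt_le_mono[of 1 n] sqrt_le_D
    by (auto intro!: real_le_lsqrt simp: power2_eq_square)
  have split: "?P Q y = ?P R y + ?P (Q - R) y" for y
    using iso(2,3) by (simp add: sum.subset_diff add.commute)
  have "?sn (?P R) \<le> a4 * E / sqrt n"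
  proof -
    have e: "?sn (\<lambda>y. F y - ?P Q y) \<le> a2 * E / n"
      by (rule sample_norm_le) (use F(2) iso(4) E n(1) in auto)
    also have "\<dots> \<le> a2 * E / sqrt n" using sqn E n(1) by (intro divide_left_mono) auto
    finally have 1: "?sn (\<lambda>y. F y - ?P Q y) \<le> a2 * E / sqrt n" .
    have 2: "?sn (?P (Q - R)) \<le> 10 * (a1 * E) / sqrt n"
      using iso n E small by (intro sample_isometry_compressible[OF iso(1,2)]) auto
    have "?P R = (\<lambda>y. F y - ((F y - ?P Q y) + ?P (Q - R) y))" by (simp add: split)
    then have "?sn (?P R) = ?sn (\<lambda>y. F y - ((F y - ?P Q y) + ?P (Q - R) y))" by simp
    also have "\<dots> \<le> ?sn F + ?sn (\<lambda>y. (F y - ?P Q y) + ?P (Q - R) y)" by (rule sample_norm_diff_triangle)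
    also have "?sn (\<lambda>y. (F y - ?P Q y) + ?P (Q - R) y) \<le> ?sn (\<lambda>y. F y - ?P Q y) + ?sn (?P (Q - R))"
      by (rule sample_norm_triangle)
    finally have "?sn (?P R) \<le> a3 * E / sqrt n + (a2 * E / sqrt n + 10 * (a1 * E) / sqrt n)"
      using 1 2 samples by linarith
    also have "\<dots> = a4 * E / sqrt n" by (simp add: a4_def add_divide_distrib[symmetric] algebra_simps)
    finally show ?thesis .
  qed
  then have "(?sn (?P R))\<^sup>2 \<le> (a4 * E / sqrt n)\<^sup>2" by (intro power_mono) auto
  also have "\<dots> = (a4 * E)\<^sup>2 / n" using n(1) by (simp add: power_divide)
  finally have "128 * (?sn (?P R))\<^sup>2 \<le> 128 * ((a4 * E)\<^sup>2 / n)" by simp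
  moreover have "(\<Sum>k\<in>R. (norm (x k))\<^sup>2) \<le> 128 * (?sn (?P R))\<^sup>2"
    using iso n by (intro sample_isometry_sparse[OF iso(1,2,3)]) auto
  ultimately have R2: "(\<Sum>k\<in>R. (norm (x k))\<^sup>2) \<le> (12 * (a4 * E))\<^sup>2 / n"
  proof -
    assume a: "128 * (?sn (?P R))\<^sup>2 \<le> 128 * ((a4 * E)\<^sup>2 / n)" "(\<Sum>k\<in>R. (norm (x k))\<^sup>2) \<le> 128 * (?sn (?P R))\<^sup>2"
    have "0 \<le> (a4 * E)\<^sup>2 / n" using n(1) by simp
    moreover have "(12 * (a4 * E))\<^sup>2 / n = 144 * ((a4 * E)\<^sup>2 / n)" by (simp add: power_mult_distrib)
    ultimately show ?thesis using a by linarith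
  qed
  have R1: "(\<Sum>k\<in>R. norm (x k)) \<le> sqrt \<nu> * (12 * (a4 * E))"
  proof (rule power2_le_imp_le)
    have "(\<Sum>k\<in>R. norm (x k))\<^sup>2 \<le> real (card R) * (\<Sum>k\<in>R. (norm (x k))\<^sup>2)" by (rule sum_sq_le_card)
    also have "\<dots> \<le> (\<nu> * n) * ((12 * (a4 * E))\<^sup>2 / n)" using n R2 by (intro mult_mono sum_nonneg) auto
    also have "\<dots> = (sqrt \<nu> * (12 * (a4 * E)))\<^sup>2" using n by (simp add: power_mult_distrib)
    finally show "(\<Sum>k\<in>R. norm (x k))\<^sup>2 \<le> (sqrt \<nu> * (12 * (a4 * E)))\<^sup>2" .
  qed (use n a4 E in auto)
  define S where "S = (a1 + a2 + 12 * (sqrt \<nu> + 1) * a4) * E"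
  have nu: "0 \<le> sqrt \<nu>" using n by simp
  have parts: "0 \<le> a1 * E" "0 \<le> a2 * E" "0 < 12 * (a4 * E)" "0 \<le> sqrt \<nu> * (12 * (a4 * E))"
    using E a4 nu by auto
  have S_eq: "S = a1 * E + a2 * E + 12 * (a4 * E) + sqrt \<nu> * (12 * (a4 * E))"
    by (simp add: S_def algebra_simps)
  have S0: "0 < S" using parts unfolding S_eq by linarith
  have sum_split: "sum h Q = sum h R + sum h (Q - R)" for h :: "_ \<Rightarrow> real"
    using iso(2,3) by (simp add: sum.subset_diff add.commute)
  have "Lp_norm torus_measure p F \<le> ennreal (2 * S * n powr (- 1 / p))"
  proof (rule Lp_norm_torus_le[OF F(1) _ iso(2) F(2) _ _ _ S0 p])
    show "0 < n" using n by simp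
    show "(a2 * E / n)\<^sup>2 \<le> S\<^sup>2 / n"
    proof -
      have "(a2 * E / n)\<^sup>2 = (a2 * E)\<^sup>2 / (n * n)" by (simp add: power2_eq_square)
      also have "\<dots> \<le> S\<^sup>2 / n"
        using n(1) parts mult_mono[of 1 n 1 n] by (intro frac_le power_mono) (auto simp: S_eq)
      finally show ?thesis .
    qed
    show "norm (F y) \<le> S" for y
    proof -
      have "norm (F y) \<le> norm (?P Q y) + norm (F y - ?P Q y)" by (rule norm_triangle_sub)
      also have "norm (?P Q y) \<le> (\<Sum>k\<in>Q. norm (x k))" by (intro sum_norm_le) (simp add: norm_mult)
      also have "\<dots> \<le> sqrt \<nu> * (12 * (a4 * E)) + a1 * E" using R1 small(1) unfolding sum_split by linarith
      also have "norm (F y - ?P Q y) \<le> a2 * E / n" by (rule F(2))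
      also have "a2 * E / n \<le> a2 * E" using n(1) parts(2) by (simp add: divide_le_eq mult_left_mono mult.commute[of _ n] mult_le_cancel_right1)
      finally show ?thesis using parts unfolding S_eq by linarith
    qed
    show "(\<Sum>k\<in>Q. (norm (x k))\<^sup>2) \<le> S\<^sup>2 / n"
    proof -
      have "(\<Sum>k\<in>Q. (norm (x k))\<^sup>2) \<le> (12 * (a4 * E))\<^sup>2 / n + (a1 * E)\<^sup>2 / n"
        using R2 small(2) unfolding sum_split by linarith
      also have "\<dots> = ((12 * (a4 * E))\<^sup>2 + (a1 * E)\<^sup>2) / n" by (simp add: add_divide_distrib)
      also have "\<dots> \<le> (12 * (a4 * E) + a1 * E)\<^sup>2 / n"
        using parts n(1) by (intro divide_right_mono) (simp_all add: power2_sum)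
      also have "\<dots> \<le> S\<^sup>2 / n" using parts n(1) by (intro divide_right_mono power_mono) (auto simp: S_eq)
      finally show ?thesis .
    qed
  qed
  then show ?thesis by (simp only: S_def a4_def)
qed

lemma powr_le_of_ratio_le_2:
  fixes x y g :: real
  assumes "0 < x" "0 < y" "x \<le> 2 * y" "y \<le> 2 * x"
  shows "x powr g \<le> 2 powr \<bar>g\<bar> * y powr g"
proof (cases "0 \<le> g")
  case True
  then have "x powr g \<le> (2 * y) powr g" using assms by (intro powr_mono2) auto
  then show ?thesis using assms True by (simp add: powr_mult)
next
  case False
  then have "(2 * x) powr g \<le> y powr g" using assms by (intro powr_mono2') auto
  then have "2 powr (- g) * (2 powr g * x powr g) \<le> 2 powr (- g) * y powr g"
    using assms by (simp add: powr_mult)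
  moreover have "2 powr (- g) * (2 powr g * x powr g) = x powr g"
    by (simp add: mult.assoc[symmetric] powr_add[symmetric])
  ultimately show ?thesis using False by simp
qed

lemma coeff_rate_Suc: "\<exists>\<rho>\<ge>1. \<forall>l. coeff_rate D a b \<beta> l \<le> \<rho> * coeff_rate D a b \<beta> (Suc l)"
proof -
  define \<theta> where "\<theta> = 1 - 1 / \<beta> - a"
  define g where "g = D * (a + b)"
  define \<rho> where "\<rho> = 2 powr \<bar>\<theta>\<bar> * 2 powr \<bar>g\<bar>"
  have "coeff_rate D a b \<beta> l \<le> \<rho> * coeff_rate D a b \<beta> (Suc l)" for l
  proof -
    have "2 powr (l * \<theta>) \<le> 2 powr (\<bar>\<theta>\<bar> + Suc l * \<theta>)" by (intro powr_mono) (auto simp: algebra_simps)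
    then have "2 powr (l * \<theta>) \<le> 2 powr \<bar>\<theta>\<bar> * 2 powr (Suc l * \<theta>)" by (simp only: powr_add)
    moreover have "(real l + 1) powr g \<le> 2 powr \<bar>g\<bar> * (real (Suc l) + 1) powr g"
      by (rule powr_le_of_ratio_le_2) auto
    ultimately have "2 powr (l * \<theta>) * (real l + 1) powr g
      \<le> (2 powr \<bar>\<theta>\<bar> * 2 powr (Suc l * \<theta>)) * (2 powr \<bar>g\<bar> * (real (Suc l) + 1) powr g)"
      by (intro mult_mono) auto
    then show ?thesis by (simp add: coeff_rate_def \<rho>_def \<theta>_def g_def mult_ac)
  qed
  moreover have "1 * 1 \<le> \<rho>" unfolding \<rho>_def by (intro mult_mono ge_one_powr_ge_zero) auto
  ultimately show ?thesis by auto
qed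

text \<open>With \<open>A\<close> the larger of the two level constants, one hyperbolic cross
  carries the sparse parts at all scales \<open>l <= L\<close>, and what lies outside it is a
  uniformly small error. The uniform bound on \<open>f\<close> comes from the approximation at
  \<open>L = l = 0\<close> and the \<open>l_1\<close> norms of finitely many layers.\<close>

lemma W_class_decomposition:
  fixes a b \<beta> :: real
  assumes "0 < a" "0 < \<beta>" "\<beta> \<le> 1"
  shows "\<exists>C\<ge>1. \<exists>A::nat. \<forall>f \<in> (W_class a b \<beta> :: (real ^ 'd::finite \<Rightarrow> complex) set). \<exists>u.
    f \<in> borel_measurable borel \<and> (\<forall>x. norm (f x) \<le> C) \<and>
    (\<forall>L l x. l \<le> L \<longrightarrow> norm (f x - (\<Sum>k | freq_level k \<le> A * (L + 1). u k * trig k x))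
      \<le> C * coeff_rate (CARD('d) - 1) a b \<beta> l / 2 ^ l) \<and>
    (\<forall>L l. l \<le> L \<longrightarrow> (\<exists>T \<subseteq> {k. freq_level k \<le> A * (L + 1)}. sparse_part C (coeff_rate (CARD('d) - 1) a b \<beta> l) l u T))"
proof -
  let ?E = "coeff_rate (CARD('d) - 1) a b \<beta>"
  obtain C1 and A1 :: nat where C1: "1 \<le> C1" and sparse: "\<forall>u :: int ^ 'd \<Rightarrow> complex. layer_bounds a b \<beta> u \<longrightarrow>
    (\<forall>l. \<exists>T \<subseteq> {k. freq_level k \<le> A1 * l}. sparse_part C1 (?E l) l u T)"
    using sparse_approximation[OF assms, of b, where 'd = 'd] by (elim exE conjE) (rule that)
  obtain C2 and A2 :: nat where C2: "0 < C2" and tail: "\<forall>u :: int ^ 'd \<Rightarrow> complex. layer_bounds a b \<beta> u \<longrightarrow>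
    (\<forall>L l F. l \<le> L \<and> finite F \<and> (\<forall>k\<in>F. A2 * (L + 1) < freq_level k) \<longrightarrow> (\<Sum>k\<in>F. norm (u k)) \<le> C2 * ?E l / 2 ^ l)"
    using high_frequency_tail[OF assms, of b, where 'd = 'd] by (elim exE conjE) (rule that)
  define A where "A = max A1 A2"
  define B where "B j = (1/2) powr (1 - 1 / \<beta>) * (2 powr (- a * j) * real (max j 1) powr (real (CARD('d) - 1) * b))" for j :: nat
  define C0 where "C0 = (\<Sum>j\<le>A. B j)"
  have C0: "0 \<le> C0" unfolding C0_def by (intro sum_nonneg) (simp add: B_def)
  define C where "C = C0 + C1 + C2"
  have C: "1 \<le> C" "C1 \<le> C" "C2 \<le> C" "C0 + C2 \<le> C" using C0 C1 C2 by (auto simp: C_def)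
  have E: "0 < ?E l" for l by (rule coeff_rate_pos)
  have "\<exists>u. f \<in> borel_measurable borel \<and> (\<forall>x. norm (f x) \<le> C) \<and>
    (\<forall>L l x. l \<le> L \<longrightarrow> norm (f x - (\<Sum>k | freq_level k \<le> A * (L + 1). u k * trig k x)) \<le> C * ?E l / 2 ^ l) \<and>
    (\<forall>L l. l \<le> L \<longrightarrow> (\<exists>T \<subseteq> {k. freq_level k \<le> A * (L + 1)}. sparse_part C (?E l) l u T))"
    if f: "f \<in> W_class a b \<beta>" for f :: "real ^ 'd \<Rightarrow> complex"
  proof -
    obtain u :: "int ^ 'd \<Rightarrow> complex" where u: "(\<lambda>k. norm (u k)) summable_on UNIV"
      "\<And>x. f x = (\<Sum>\<^sub>\<infinity>k. u k * trig k x)" "layer_bounds a b \<beta> u"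
      by (rule W_class_coeffs[OF f assms(2)]) (rule that)
    have f_eq: "f = (\<lambda>x. \<Sum>\<^sub>\<infinity>k. u k * trig k x)" using u(2) by auto
    have approx: "norm (f x - (\<Sum>k | freq_level k \<le> A * (L + 1). u k * trig k x)) \<le> C2 * ?E l / 2 ^ l" if "l \<le> L" for L l x
      unfolding u(2)
    proof (rule trig_series_approx[OF u(1) finite_freq_level_le])
      fix F :: "(int ^ 'd) set" assume F: "finite F" "F \<inter> {k. freq_level k \<le> A * (L + 1)} = {}"
      have "A2 * (L + 1) \<le> A * (L + 1)" by (intro mult_right_mono) (auto simp: A_def)
      then have "\<forall>k\<in>F. A2 * (L + 1) < freq_level k" using F(2) by (fastforce simp: disjoint_iff)
      then show "(\<Sum>k\<in>F. norm (u k)) \<le> C2 * ?E l / 2 ^ l" using tail[rule_format, OF u(3), of l L F] that F(1) by simp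
    qed
    have "norm (f x) \<le> C" for x
    proof -
      let ?P = "\<Sum>k | freq_level k \<le> A * (0 + 1). u k * trig k x"
      have E0: "?E 0 = 1" by (simp add: coeff_rate_def)
      have "norm (f x) \<le> norm ?P + norm (f x - ?P)" by (rule norm_triangle_sub)
      also have "norm (f x - ?P) \<le> C2" using approx[of 0 0 x] E0 by simp
      also have "norm ?P \<le> (\<Sum>k | freq_level k \<le> A. norm (u k))"
        by (simp, intro sum_norm_le) (simp add: norm_mult)
      also have "\<dots> = (\<Sum>j\<le>A. \<Sum>k\<in>hyperbolic_layer j. norm (u k))"
      proof -
        have "(\<Sum>k | freq_level k \<le> A. norm (u k)) = (\<Sum>j\<le>A. \<Sum>k\<in>{k \<in> {k. freq_level k \<le> A}. freq_level k = j}. norm (u k))"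
          by (rule sum.group[symmetric, OF finite_freq_level_le]) auto
        also have "\<dots> = (\<Sum>j\<le>A. \<Sum>k\<in>hyperbolic_layer j. norm (u k))"
          by (intro sum.cong) (auto simp: hyperbolic_layer_eq)
        finally show ?thesis .
      qed
      also have "\<dots> \<le> C0" unfolding C0_def B_def
        by (intro sum_mono layer_l1_le[OF u(3) assms(2,3)])
      finally show ?thesis using C(4) by simp
    qed
    moreover have "f \<in> borel_measurable borel" unfolding f_eq by (rule borel_measurable_trig_series[OF u(1)])
    moreover have "norm (f x - (\<Sum>k | freq_level k \<le> A * (L + 1). u k * trig k x)) \<le> C * ?E l / 2 ^ l" if "l \<le> L" for L l x
    proof -
      have "C2 * ?E l / 2 ^ l \<le> C * ?E l / 2 ^ l" using C(3) E[of l] by (intro divide_right_mono mult_right_mono) auto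
      then show ?thesis using approx[OF that, of x] by linarith
    qed
    moreover have "\<exists>T \<subseteq> {k. freq_level k \<le> A * (L + 1)}. sparse_part C (?E l) l u T" if "l \<le> L" for L l
    proof -
      obtain T where T: "T \<subseteq> {k. freq_level k \<le> A1 * l}" "sparse_part C1 (?E l) l u T"
        using sparse[rule_format, OF u(3), of l] by auto
      have "A1 * l \<le> A * (L + 1)" using that by (intro mult_mono) (auto simp: A_def)
      then have sub: "T \<subseteq> {k. freq_level k \<le> A * (L + 1)}" using T(1) by fastforce
      have "sparse_part C (?E l) l u T" by (rule sparse_part_mono[OF T(2)]) (use C C1 E[of l] in auto)
      with sub show ?thesis by blast
    qed
    ultimately show ?thesis by (intro exI[of _ u] conjI allI impI) assumption+
  qed
  then show ?thesis using C(1) by (intro exI[of _ C]) blast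
qed

text \<open>The last clause bounds the diameter of the set of functions in \<open>W\<close> with
  given samples, which is what optimal recovery needs. It is stated for the same points as the
  clause on the algorithm because both rest on the same comparison.\<close>

definition sampling_recovers :: "(real ^ 'd::finite \<Rightarrow> complex) set \<Rightarrow> real \<Rightarrow> real \<Rightarrow> nat \<Rightarrow> real \<Rightarrow> bool" where
  "sampling_recovers W p t m \<epsilon> \<longleftrightarrow>
    (\<exists>(\<xi> :: nat \<Rightarrow> real ^ 'd) Q s. inj_on \<xi> {..<m} \<and> \<xi> ` {..<m} \<subseteq> torus \<and> finite Q \<and> Q \<noteq> {} \<and>
      (\<forall>f0\<in>W. \<forall>g G. womp_run (sample_inner m \<xi>) t (trig ` Q) f0 s g G \<longrightarrow>
        Lp_norm torus_measure p (\<lambda>x. f0 x - G s x) \<le> ennreal \<epsilon>) \<and>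
      (\<forall>f\<in>W. \<forall>f'\<in>W. (\<forall>i<m. f (\<xi> i) = f' (\<xi> i)) \<longrightarrow>
        Lp_norm torus_measure p (\<lambda>x. f x - f' x) \<le> ennreal \<epsilon>))"

lemma sampling_recovers_mono:
  assumes "sampling_recovers W p t m \<epsilon>" "\<epsilon> \<le> \<epsilon>'"
  shows "sampling_recovers W p t m \<epsilon>'"
proof -
  note le = order_trans[OF _ ennreal_leI[OF assms(2)]]
  obtain \<xi> Q s where *: "inj_on \<xi> {..<m}" "\<xi> ` {..<m} \<subseteq> torus" "finite Q" "Q \<noteq> {}"
      "\<forall>f0\<in>W. \<forall>g G. womp_run (sample_inner m \<xi>) t (trig ` Q) f0 s g G \<longrightarrow>
        Lp_norm torus_measure p (\<lambda>x. f0 x - G s x) \<le> ennreal \<epsilon>"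
      "\<forall>f\<in>W. \<forall>f'\<in>W. (\<forall>i<m. f (\<xi> i) = f' (\<xi> i)) \<longrightarrow>
        Lp_norm torus_measure p (\<lambda>x. f x - f' x) \<le> ennreal \<epsilon>"
    using assms(1) unfolding sampling_recovers_def by (elim exE conjE) (rule that)
  show ?thesis unfolding sampling_recovers_def
  proof (intro exI[of _ \<xi>] exI[of _ Q] exI[of _ s] conjI *(1-4) ballI allI impI)
    fix f0 g G assume "f0 \<in> W" "womp_run (sample_inner m \<xi>) t (trig ` Q) f0 s g G"
    then show "Lp_norm torus_measure p (\<lambda>x. f0 x - G s x) \<le> ennreal \<epsilon>'" using *(5) by (intro le) blast
  next
    fix f f' assume "f \<in> W" "f' \<in> W" "\<forall>i<m. f (\<xi> i) = f' (\<xi> i)"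
    then show "Lp_norm torus_measure p (\<lambda>x. f x - f' x) \<le> ennreal \<epsilon>'" using *(6) by (intro le) blast
  qed
qed

text \<open>Here \<open>C\<close> may still depend on \<open>t\<close>: the number of steps does,
  and with it the number of frequencies in the residual that are not controlled by the tail
  bounds.\<close>

lemma sample_recovery:
  fixes p a b \<beta> t :: real
  assumes "2 \<le> p" "0 < a" "0 < \<beta>" "\<beta> \<le> 1" and t: "0 < t" "t \<le> 1"
  defines "err \<equiv> \<lambda>L. coeff_rate (CARD('d::finite) - 1) a b \<beta> L * (2 ^ L) powr (- 1 / p)"
  shows "\<exists>C>0. \<exists>c>0. \<forall>L m::nat. c * 2 ^ L * (real L + 1) ^ 3 \<le> real m \<longrightarrow>
    sampling_recovers (W_class a b \<beta> :: (real ^ 'd \<Rightarrow> complex) set) p t m (C * err L)"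
proof -
  let ?E = "coeff_rate (CARD('d) - 1) a b \<beta>"
  have E: "0 < ?E l" for l by (rule coeff_rate_pos)
  obtain C and A :: nat where C: "1 \<le> C" and dec: "\<forall>f \<in> (W_class a b \<beta> :: (real ^ 'd \<Rightarrow> complex) set). \<exists>u.
    f \<in> borel_measurable borel \<and> (\<forall>x. norm (f x) \<le> C) \<and>
    (\<forall>L l x. l \<le> L \<longrightarrow> norm (f x - (\<Sum>k | freq_level k \<le> A * (L + 1). u k * trig k x)) \<le> C * ?E l / 2 ^ l) \<and>
    (\<forall>L l. l \<le> L \<longrightarrow> (\<exists>T \<subseteq> {k. freq_level k \<le> A * (L + 1)}. sparse_part C (?E l) l u T))"
    using W_class_decomposition[OF assms(2-4), of b, where 'd = 'd] by (elim exE conjE) (rule that)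
  obtain \<rho>0 where \<rho>0: "1 \<le> \<rho>0" "\<And>l. ?E l \<le> \<rho>0 * ?E (Suc l)" using coeff_rate_Suc by metis
  \<comment> \<open>The factor 2 covers the ratio \<open>sqrt 2\<close> of consecutive denominators
    \<open>sqrt (2 ^ l)\<close> in the noise levels.\<close>
  define \<rho> where "\<rho> = 2 * \<rho>0"
  define \<tau> where "\<tau> = nat \<lceil>1152 * C * (2 * ln \<rho>) / t\<^sup>2\<rceil>"
  \<comment> \<open>The sparsity budget in units of \<open>2 ^ L\<close>: one sparse part and at
    most \<open>2 * \<tau> * 2 ^ L\<close> chosen frequencies for the algorithm, two sparse parts
    for a difference of functions of the class.\<close>
  define \<nu> where "\<nu> = 2 * C + 2 * real \<tau>"
  define Cf where "Cf = 2 * (2 * C + 2 * C + 12 * (sqrt \<nu> + 1) * (10 * (2 * C) + 2 * C + 22 * C))"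
  have \<nu>: "1 \<le> \<nu>" using C by (simp add: \<nu>_def)
  have "0 < Cf" using C \<nu> by (simp add: Cf_def add_pos_pos)
  obtain c where c: "c > 0" and samples: "\<forall>L m::nat. c * 2 ^ L * (real L + 1) ^ 3 \<le> real m \<longrightarrow> 1 \<le> m \<and>
    (\<exists>\<xi> :: nat \<Rightarrow> real ^ 'd. inj_on \<xi> {..<m} \<and> \<xi> ` {..<m} \<subseteq> torus \<and>
      sample_isometry m \<xi> trig {k. freq_level k \<le> A * (L + 1)} (40 * \<nu> * 2 ^ L))"
  proof -
    have "1 \<le> 40 * \<nu>" using \<nu> by simp
    from exists_sample_isometry_log_cubed[OF this, of A, where 'd = 'd] show ?thesis
      by (elim exE conjE) (rule that)
  qed
  have main: "sampling_recovers (W_class a b \<beta> :: (real ^ 'd \<Rightarrow> complex) set) p t m (Cf * err L)"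
    if Lm: "c * 2 ^ L * (real L + 1) ^ 3 \<le> real m" for L m :: nat
  proof -
    define Q where "Q = {k :: int ^ 'd. freq_level k \<le> A * (L + 1)}"
    define K where "K = 40 * \<nu> * 2 ^ L"
    have m: "0 < m" using samples[rule_format, OF Lm] by simp
    obtain \<xi> :: "nat \<Rightarrow> real ^ 'd" where \<xi>: "inj_on \<xi> {..<m}" "\<xi> ` {..<m} \<subseteq> torus" "sample_isometry m \<xi> trig Q K"
      using samples[rule_format, OF Lm] by (elim exE conjE) (rule that, simp_all only: Q_def K_def)
    have Q: "finite Q" unfolding Q_def by (rule finite_freq_level_le)
    have "0 \<in> Q" using bit_length_le_iff[of 0 0] by (simp add: Q_def freq_level_def)
    then have Q_ne: "Q \<noteq> {}" by auto
    define s where "s = (\<Sum>l\<le>L. \<tau> * 2 ^ l)"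
    have s_le: "real s \<le> 2 * real \<tau> * 2 ^ L"
    proof -
      have "(\<Sum>l\<le>L. (2::real) ^ l) \<le> 2 * 2 ^ L"
        by (induction L) auto
      then have "real \<tau> * (\<Sum>l\<le>L. (2::real) ^ l) \<le> real \<tau> * (2 * 2 ^ L)" by (intro mult_left_mono) auto
      then show ?thesis by (simp add: s_def sum_distrib_left)
    qed
    have \<nu>K: "\<nu> * 2 ^ L \<le> K / 40" by (simp add: K_def)
    have K: "0 < K" "2 ^ L \<le> K"
    proof -
      have "1 * 2 ^ L \<le> (40 * \<nu>) * 2 ^ L" using \<nu> by (intro mult_right_mono) auto
      then show "2 ^ L \<le> K" by (simp add: K_def)
      then show "0 < K" by (rule less_le_trans[rotated]) simp
    qed
    have CL: "0 \<le> C * 2 ^ L" using C by simp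
    have L1: "(1::real) \<le> 2 ^ L" by (simp add: one_le_power)
    have bound: "Lp_norm torus_measure p F \<le> ennreal (Cf * err L)"
      if "R \<subseteq> Q" "real (card R) \<le> \<nu> * 2 ^ L" "F \<in> borel_measurable borel"
        "\<And>y. norm (F y - (\<Sum>k\<in>Q. x k * trig k y)) \<le> (2 * C) * ?E L / 2 ^ L"
        "(\<Sum>k\<in>Q - R. norm (x k)) \<le> (2 * C) * ?E L" "(\<Sum>k\<in>Q - R. (norm (x k))\<^sup>2) \<le> ((2 * C) * ?E L)\<^sup>2 / 2 ^ L"
        "sample_norm m \<xi> F \<le> (22 * C) * ?E L / sqrt (2 ^ L)"
      for F :: "real ^ 'd \<Rightarrow> complex" and R x
    proof -
      have "Lp_norm torus_measure p F \<le> ennreal (2 * ((2 * C + 2 * C + 12 * (sqrt \<nu> + 1) * (10 * (2 * C) + 2 * C + 22 * C)) * ?E L) * (2 ^ L) powr (- 1 / p))"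
        by (rule recovery_error_bound[OF \<xi>(3) Q that(1) m L1 K(2) _ that(2) \<nu>K assms(1) E _ _ _ that(3-7)])
           (use C \<nu> in auto)
      then show ?thesis unfolding Cf_def err_def by (simp only: mult_ac)
    qed
    have dec_L: "\<exists>u. h \<in> borel_measurable borel \<and> (\<forall>x. norm (h x) \<le> C) \<and>
        (\<forall>l\<le>L. \<forall>x. norm (h x - (\<Sum>k\<in>Q. u k * trig k x)) \<le> C * ?E l / 2 ^ l) \<and>
        (\<forall>l\<le>L. \<exists>T \<subseteq> Q. sparse_part C (?E l) l u T)"
      if h: "h \<in> W_class a b \<beta>" for h :: "real ^ 'd \<Rightarrow> complex"
    proof -
      obtain u where u: "h \<in> borel_measurable borel" "\<forall>x. norm (h x) \<le> C"
        "\<forall>L l x. l \<le> L \<longrightarrow> norm (h x - (\<Sum>k | freq_level k \<le> A * (L + 1). u k * trig k x)) \<le> C * ?E l / 2 ^ l"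
        "\<forall>L l. l \<le> L \<longrightarrow> (\<exists>T \<subseteq> {k. freq_level k \<le> A * (L + 1)}. sparse_part C (?E l) l u T)"
        using bspec[OF dec h] by (elim exE conjE) (rule that)
      show ?thesis
        by (intro exI[of _ u] conjI u(1,2) allI impI; unfold Q_def)
           (rule u(3)[rule_format] u(4)[rule_format], assumption)+
    qed
    have womp: "Lp_norm torus_measure p (\<lambda>x. f0 x - G s x) \<le> ennreal (Cf * err L)"
      if f0: "f0 \<in> W_class a b \<beta>" and run: "womp_run (sample_inner m \<xi>) t (trig ` Q) f0 s g G"
      for f0 :: "real ^ 'd \<Rightarrow> complex" and g G
    proof -
      obtain u where u: "f0 \<in> borel_measurable borel" "\<forall>x. norm (f0 x) \<le> C"
        and u_tail: "\<forall>l\<le>L. \<forall>x. norm (f0 x - (\<Sum>k\<in>Q. u k * trig k x)) \<le> C * ?E l / 2 ^ l"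
        and u_sparse: "\<forall>l\<le>L. \<exists>T \<subseteq> Q. sparse_part C (?E l) l u T"
        using dec_L[OF f0] by (elim exE conjE) (rule that)
      have "\<forall>l. \<exists>T. l \<le> L \<longrightarrow> T \<subseteq> Q \<and> sparse_part C (?E l) l u T" using u_sparse by auto
      then obtain T where T: "\<forall>l. l \<le> L \<longrightarrow> T l \<subseteq> Q \<and> sparse_part C (?E l) l u (T l)"
        by (rule choice[THEN exE])
      then have T_sub: "T l \<subseteq> Q" "real (card (T l)) \<le> C * 2 ^ l" if "l \<le> L" for l
        using that by (auto simp: sparse_part_def)
      have T_rest: "(\<Sum>k\<in>F. norm (u k)) \<le> C * ?E l \<and> (\<Sum>k\<in>F. (norm (u k))\<^sup>2) \<le> (C * ?E l)\<^sup>2 / 2 ^ l"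
        if "l \<le> L" "finite F" "F \<inter> T l = {}" for l F
        using T[rule_format, OF that(1)] that(2,3) unfolding sparse_part_def by blast
      \<comment> \<open>The constant is \<open>1 + 10\<close>: the uniform error of the restriction
        to \<open>Q\<close>, and the sampled norm of a compressible remainder.\<close>
      define \<omega> where "\<omega> l = 11 * C * ?E l / sqrt (2 ^ l)" for l
      have Ns: "sample_norm m \<xi> (\<lambda>x. f0 x - G s x) \<le> 2 * \<omega> L"
      proof (rule womp_scales[OF m Q Q_ne t norm_trig run _ s_def C, where T = T and u = u and \<kappa> = "K / 40" and \<rho> = \<rho>])
        show "(\<Sum>k\<in>R. (norm (x k))\<^sup>2) \<le> 128 * (sample_norm m \<xi> (\<lambda>y. \<Sum>k\<in>R. x k * trig k y))\<^sup>2"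
          if "R \<subseteq> Q" "real (card R) \<le> K / 40" for x R
          by (rule sample_isometry_sparse[OF \<xi>(3) Q that K(1)])
        have "C * 2 ^ L + real s \<le> \<nu> * 2 ^ L" using s_le CL by (simp add: \<nu>_def distrib_right)
        then show "C * 2 ^ L + real s \<le> K / 40" using \<nu>K by linarith
        show "T l \<subseteq> Q" "real (card (T l)) \<le> C * 2 ^ l" if "l \<le> L" for l using T_sub that by auto
        show "0 < \<omega> l" for l using C E[of l] by (simp add: \<omega>_def)
        show "\<omega> l \<le> \<rho> * \<omega> (Suc l)" for l
        proof -
          have "?E l / sqrt (2 ^ l) \<le> \<rho>0 * ?E (Suc l) / sqrt (2 ^ l)" using \<rho>0(2)[of l] by (intro divide_right_mono) auto
          also have "\<dots> = sqrt 2 * (\<rho>0 * ?E (Suc l) / sqrt (2 ^ Suc l))" by (simp add: real_sqrt_mult)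
          also have "\<dots> \<le> 2 * (\<rho>0 * ?E (Suc l) / sqrt (2 ^ Suc l))"
            using \<rho>0(1) E[of "Suc l"] by (intro mult_right_mono) (auto simp: real_le_lsqrt)
          finally have "11 * C * (?E l / sqrt (2 ^ l)) \<le> 11 * C * (2 * (\<rho>0 * ?E (Suc l) / sqrt (2 ^ Suc l)))"
            using C by (intro mult_left_mono) auto
          then show ?thesis by (simp add: \<omega>_def \<rho>_def mult_ac)
        qed
        show "1 \<le> \<rho>" using \<rho>0(1) by (simp add: \<rho>_def)
        show "1152 * C * (2 * ln \<rho>) / t\<^sup>2 \<le> real \<tau>" unfolding \<tau>_def by (rule real_nat_ceiling_ge)
        show "sample_norm m \<xi> (\<lambda>x. f0 x - G 0 x) \<le> 2 * (\<rho> * \<omega> 0)"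
        proof -
          have "G 0 \<in> lin_span {}" using run by (auto simp: womp_run_def is_orth_proj_def)
          then have "G 0 = (\<lambda>x. 0)" by (auto simp: lin_span_def)
          then have "sample_norm m \<xi> (\<lambda>x. f0 x - G 0 x) \<le> C" using u(2) m C by (intro sample_norm_le) auto
          also have "\<dots> = C * 1" by simp
          also have "\<dots> \<le> C * (44 * \<rho>0)" using \<rho>0(1) C by (intro mult_left_mono) auto
          also have "\<dots> = 2 * (\<rho> * \<omega> 0)" by (simp add: \<rho>_def \<omega>_def coeff_rate_def)
          finally show ?thesis .
        qed
        show "sample_norm m \<xi> (\<lambda>x. f0 x - (\<Sum>i\<in>T l. u i * trig i x)) \<le> \<omega> l" if l: "l \<le> L" for l
        proof -
          have Tl: "T l \<subseteq> Q" "(\<Sum>k\<in>Q - T l. norm (u k)) \<le> C * ?E l" "(\<Sum>k\<in>Q - T l. (norm (u k))\<^sup>2) \<le> (C * ?E l)\<^sup>2 / 2 ^ l"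
            using T_sub[OF l] T_rest[OF l, of "Q - T l"] Q by auto
          have l1: "(1::real) \<le> 2 ^ l" by (simp add: one_le_power)
          have "(2::real) ^ l \<le> 2 ^ L" using l by (intro power_increasing) auto
          then have lK: "2 ^ l \<le> K" using K(2) by linarith
          have "sample_norm m \<xi> (\<lambda>x. f0 x - (\<Sum>i\<in>T l. u i * trig i x))
            = sample_norm m \<xi> (\<lambda>x. (f0 x - (\<Sum>k\<in>Q. u k * trig k x)) + (\<Sum>k\<in>Q - T l. u k * trig k x))"
            using Tl(1) Q by (intro sample_norm_cong) (simp add: sum.subset_diff[of "T l" Q])
          also have "\<dots> \<le> sample_norm m \<xi> (\<lambda>x. f0 x - (\<Sum>k\<in>Q. u k * trig k x)) + sample_norm m \<xi> (\<lambda>x. \<Sum>k\<in>Q - T l. u k * trig k x)"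
            by (rule sample_norm_triangle)
          also have "sample_norm m \<xi> (\<lambda>x. f0 x - (\<Sum>k\<in>Q. u k * trig k x)) \<le> C * ?E l / 2 ^ l"
            using u_tail l m C E[of l] by (intro sample_norm_le) auto
          also have "C * ?E l / 2 ^ l \<le> C * ?E l / sqrt (2 ^ l)"
          proof (intro divide_left_mono)
            show "sqrt (2 ^ l) \<le> 2 ^ l" using l1 by (intro real_le_lsqrt) (auto simp: power2_eq_square)
          qed (use C E[of l] in auto)
          also have "sample_norm m \<xi> (\<lambda>x. \<Sum>k\<in>Q - T l. u k * trig k x) \<le> 10 * (C * ?E l) / sqrt (2 ^ l)"
            using C E[of l] by (intro sample_isometry_compressible[OF \<xi>(3) Q _ lK l1 _ Tl(2,3)]) auto
          finally show ?thesis by (simp add: \<omega>_def add_divide_distrib[symmetric])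
        qed
      qed
      have "G s \<in> lin_span (g ` {1..s})" using run by (auto simp: womp_run_def is_orth_proj_def)
      moreover have "g ` {1..s} \<subseteq> trig ` Q" using run by (auto simp: womp_run_def)
      ultimately obtain \<Lambda> c' where \<Lambda>: "\<Lambda> \<subseteq> Q" "finite \<Lambda>" "card \<Lambda> \<le> s" "G s = (\<lambda>x. \<Sum>i\<in>\<Lambda>. c' i * trig i x)"
        by (rule lin_span_image_indexed)
      have TL: "T L \<subseteq> Q" "real (card (T L)) \<le> C * 2 ^ L" using T_sub by auto
      \<comment> \<open>The coefficients of the residual. Outside \<open>T L\<close> and
        \<open>\<Lambda>\<close> they are those of \<open>f0\<close>, so the tail bounds apply
        whatever coefficients the algorithm has found.\<close>
      define x where "x k = u k - (if k \<in> \<Lambda> then c' k else 0)" for k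
      let ?R = "T L \<union> \<Lambda>"
      have rest: "(\<Sum>k\<in>Q - ?R. norm (u k)) \<le> C * ?E L" "(\<Sum>k\<in>Q - ?R. (norm (u k))\<^sup>2) \<le> (C * ?E L)\<^sup>2 / 2 ^ L"
      proof -
        have "finite (Q - ?R) \<and> (Q - ?R) \<inter> T L = {}" using Q by auto
        then show "(\<Sum>k\<in>Q - ?R. norm (u k)) \<le> C * ?E L" "(\<Sum>k\<in>Q - ?R. (norm (u k))\<^sup>2) \<le> (C * ?E L)\<^sup>2 / 2 ^ L"
          using T_rest[OF order_refl, of "Q - ?R"] by auto
      qed
      have CE: "0 \<le> C * ?E L" using C E[of L] by simp
      show ?thesis
      proof (rule bound[where R = ?R and x = x])
        show "?R \<subseteq> Q" using TL \<Lambda> by auto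
        have "real (card ?R) \<le> real (card (T L)) + real (card \<Lambda>)" using card_Un_le[of "T L" \<Lambda>] by linarith
        also have "\<dots> \<le> C * 2 ^ L + 2 * real \<tau> * 2 ^ L" using TL(2) \<Lambda>(3) s_le by linarith
        also have "\<dots> \<le> \<nu> * 2 ^ L" using CL by (simp add: \<nu>_def distrib_right)
        finally show "real (card ?R) \<le> \<nu> * 2 ^ L" .
        show "(\<lambda>x. f0 x - G s x) \<in> borel_measurable borel" unfolding \<Lambda>(4) using u(1) by measurable
        show "norm (f0 y - G s y - (\<Sum>k\<in>Q. x k * trig k y)) \<le> 2 * C * ?E L / 2 ^ L" for y
        proof -
          have "(\<Sum>k\<in>Q. (if k \<in> \<Lambda> then c' k else 0) * trig k y) = G s y"
            unfolding \<Lambda>(4) using \<Lambda>(1) Q by (intro sum.mono_neutral_cong_right) auto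
          then have "(\<Sum>k\<in>Q. x k * trig k y) = (\<Sum>k\<in>Q. u k * trig k y) - G s y"
            by (simp add: x_def left_diff_distrib sum_subtractf)
          then have "norm (f0 y - G s y - (\<Sum>k\<in>Q. x k * trig k y)) \<le> C * ?E L / 2 ^ L" using u_tail by simp
          also have "\<dots> \<le> 2 * C * ?E L / 2 ^ L" using CE by (intro divide_right_mono) auto
          finally show ?thesis .
        qed
        have x_rest: "x k = u k" if "k \<in> Q - ?R" for k using that by (simp add: x_def)
        have "(\<Sum>k\<in>Q - ?R. norm (x k)) = (\<Sum>k\<in>Q - ?R. norm (u k))" by (intro sum.cong refl) (simp add: x_rest)
        then show "(\<Sum>k\<in>Q - ?R. norm (x k)) \<le> 2 * C * ?E L" using rest(1) CE by linarith
        have "(\<Sum>k\<in>Q - ?R. (norm (x k))\<^sup>2) = (\<Sum>k\<in>Q - ?R. (norm (u k))\<^sup>2)" by (intro sum.cong refl) (simp add: x_rest)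
        also have "\<dots> \<le> (C * ?E L)\<^sup>2 / 2 ^ L" by (rule rest)
        also have "\<dots> \<le> (2 * C * ?E L)\<^sup>2 / 2 ^ L" using CE by (intro divide_right_mono power_mono) auto
        finally show "(\<Sum>k\<in>Q - ?R. (norm (x k))\<^sup>2) \<le> (2 * C * ?E L)\<^sup>2 / 2 ^ L" .
        show "sample_norm m \<xi> (\<lambda>x. f0 x - G s x) \<le> 22 * C * ?E L / sqrt (2 ^ L)" using Ns by (simp add: \<omega>_def)
      qed
    qed
    have recov: "Lp_norm torus_measure p (\<lambda>x. f x - f' x) \<le> ennreal (Cf * err L)"
      if f: "f \<in> W_class a b \<beta>" "f' \<in> W_class a b \<beta>" and eq: "\<forall>i<m. f (\<xi> i) = f' (\<xi> i)"
      for f f' :: "real ^ 'd \<Rightarrow> complex"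
    proof -
      have split: "\<exists>u T. h \<in> borel_measurable borel \<and> (\<forall>x. norm (h x - (\<Sum>k\<in>Q. u k * trig k x)) \<le> C * ?E L / 2 ^ L) \<and>
          T \<subseteq> Q \<and> sparse_part C (?E L) L u T"
        if h: "h \<in> W_class a b \<beta>" for h :: "real ^ 'd \<Rightarrow> complex"
        using dec_L[OF h] by blast
      obtain u T where u: "f \<in> borel_measurable borel" "\<forall>x. norm (f x - (\<Sum>k\<in>Q. u k * trig k x)) \<le> C * ?E L / 2 ^ L"
          "T \<subseteq> Q" "sparse_part C (?E L) L u T"
        using split[OF f(1)] by (elim exE conjE) (rule that)
      obtain u' T' where u': "f' \<in> borel_measurable borel" "\<forall>x. norm (f' x - (\<Sum>k\<in>Q. u' k * trig k x)) \<le> C * ?E L / 2 ^ L"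
          "T' \<subseteq> Q" "sparse_part C (?E L) L u' T'"
        using split[OF f(2)] by (elim exE conjE) (rule that)
      let ?R = "T \<union> T'" let ?x = "\<lambda>k. u k - u' k"
      have "finite (Q - ?R) \<and> (Q - ?R) \<inter> T = {}" "finite (Q - ?R) \<and> (Q - ?R) \<inter> T' = {}" using Q by auto
      then have rest: "(\<Sum>k\<in>Q - ?R. norm (u k)) \<le> C * ?E L" "(\<Sum>k\<in>Q - ?R. (norm (u k))\<^sup>2) \<le> (C * ?E L)\<^sup>2 / 2 ^ L"
        "(\<Sum>k\<in>Q - ?R. norm (u' k)) \<le> C * ?E L" "(\<Sum>k\<in>Q - ?R. (norm (u' k))\<^sup>2) \<le> (C * ?E L)\<^sup>2 / 2 ^ L"
        using u(4) u'(4) unfolding sparse_part_def by blast+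
      show ?thesis
      proof (rule bound[where R = ?R and x = ?x])
        show "?R \<subseteq> Q" using u u' by auto
        have "real (card ?R) \<le> real (card T) + real (card T')" using card_Un_le[of T T'] by linarith
        also have "\<dots> \<le> 2 * C * 2 ^ L" using u(4) u'(4) unfolding sparse_part_def by linarith
        also have "\<dots> \<le> \<nu> * 2 ^ L" by (intro mult_right_mono) (auto simp: \<nu>_def)
        finally show "real (card ?R) \<le> \<nu> * 2 ^ L" .
        show "(\<lambda>x. f x - f' x) \<in> borel_measurable borel" using u(1) u'(1) by measurable
        show "norm (f y - f' y - (\<Sum>k\<in>Q. ?x k * trig k y)) \<le> 2 * C * ?E L / 2 ^ L" for y
        proof -
          have "f y - f' y - (\<Sum>k\<in>Q. ?x k * trig k y)
            = (f y - (\<Sum>k\<in>Q. u k * trig k y)) - (f' y - (\<Sum>k\<in>Q. u' k * trig k y))"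
            by (simp add: left_diff_distrib sum_subtractf)
          then have "norm (f y - f' y - (\<Sum>k\<in>Q. ?x k * trig k y))
            \<le> norm (f y - (\<Sum>k\<in>Q. u k * trig k y)) + norm (f' y - (\<Sum>k\<in>Q. u' k * trig k y))"
            by (simp only: norm_triangle_ineq4)
          also have "\<dots> \<le> C * ?E L / 2 ^ L + C * ?E L / 2 ^ L" using u(2) u'(2) by (intro add_mono) auto
          finally show ?thesis by simp
        qed
        have "(\<Sum>k\<in>Q - ?R. norm (?x k)) \<le> (\<Sum>k\<in>Q - ?R. norm (u k) + norm (u' k))" by (intro sum_mono norm_triangle_ineq4)
        then show "(\<Sum>k\<in>Q - ?R. norm (?x k)) \<le> 2 * C * ?E L" using rest(1,3) by (simp add: sum.distrib)
        have "(\<Sum>k\<in>Q - ?R. (norm (?x k))\<^sup>2) \<le> (\<Sum>k\<in>Q - ?R. 2 * (norm (u k))\<^sup>2 + 2 * (norm (u' k))\<^sup>2)"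
        proof (rule sum_mono)
          fix k
          have "(norm (?x k))\<^sup>2 \<le> (norm (u k) + norm (u' k))\<^sup>2" by (intro power_mono norm_triangle_ineq4) auto
          also have "\<dots> \<le> 2 * (norm (u k))\<^sup>2 + 2 * (norm (u' k))\<^sup>2"
            using sum_squares_bound[of "norm (u k)" "norm (u' k)"] by (simp add: power2_sum)
          finally show "(norm (?x k))\<^sup>2 \<le> 2 * (norm (u k))\<^sup>2 + 2 * (norm (u' k))\<^sup>2" .
        qed
        also have "\<dots> = 2 * (\<Sum>k\<in>Q - ?R. (norm (u k))\<^sup>2) + 2 * (\<Sum>k\<in>Q - ?R. (norm (u' k))\<^sup>2)"
          by (simp add: sum.distrib sum_distrib_left)
        also have "\<dots> \<le> 4 * ((C * ?E L)\<^sup>2 / 2 ^ L)" using rest(2,4) by linarith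
        also have "\<dots> = (2 * C * ?E L)\<^sup>2 / 2 ^ L" by (simp add: power_mult_distrib)
        finally show "(\<Sum>k\<in>Q - ?R. (norm (?x k))\<^sup>2) \<le> (2 * C * ?E L)\<^sup>2 / 2 ^ L" .
        have "sample_norm m \<xi> (\<lambda>x. f x - f' x) = 0" using eq by (simp add: sample_norm_def)
        then show "sample_norm m \<xi> (\<lambda>x. f x - f' x) \<le> 22 * C * ?E L / sqrt (2 ^ L)" using C E[of L] by simp
      qed
    qed
    show ?thesis using \<xi>(1,2) Q Q_ne womp recov unfolding sampling_recovers_def
      by (intro exI[of _ \<xi>] exI[of _ Q] exI[of _ s]) blast
  qed
  show ?thesis using \<open>0 < Cf\<close> c main by (intro exI[of _ Cf] conjI exI[of _ c] allI impI) blast+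
qed

text \<open>Raising the level by a constant gains any prescribed factor; this makes the constant in the
  error bound independent of the weakness parameter.\<close>

lemma rate_shift:
  fixes \<sigma> g C :: real
  assumes "\<sigma> < 0" "0 < C"
  shows "\<exists>L0::nat. \<forall>l::nat. C * (2 powr ((l + L0) * \<sigma>) * (real (l + L0) + 1) powr g) \<le> 2 powr (l * \<sigma>) * (real l + 1) powr g"
proof -
  obtain M where M: "0 < M" "\<And>i::nat. (real i + 1) powr \<bar>g\<bar> \<le> M * 2 powr (- \<sigma> / 2 * i)"
    using powr_le_exp2[of "- \<sigma> / 2" "\<bar>g\<bar>"] assms(1) by auto
  \<comment> \<open>Half of the decay \<open>2 powr (L0 * \<sigma>)\<close> is spent on
    \<open>C * M\<close>, the other half on the growth of the power of
    \<open>L0 + 1\<close>.\<close>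
  define L0 where "L0 = nat \<lceil>2 * log 2 (C * M) / - \<sigma>\<rceil>"
  have "2 * log 2 (C * M) / - \<sigma> \<le> real L0" unfolding L0_def by (rule real_nat_ceiling_ge)
  then have "log 2 (C * M) \<le> - \<sigma> / 2 * real L0" using assms(1) by (simp add: field_simps)
  then have CM: "C * M \<le> 2 powr (- \<sigma> / 2 * real L0)" using assms(2) M(1) by (subst le_powr_iff) auto
  have "C * (2 powr ((l + L0) * \<sigma>) * (real (l + L0) + 1) powr g) \<le> 2 powr (l * \<sigma>) * (real l + 1) powr g" for l :: nat
  proof -
    define q where "q = (real (l + L0) + 1) / (real l + 1)"
    have q1: "1 \<le> q" by (simp add: q_def)
    have "real (l + L0) + 1 \<le> (real L0 + 1) * (real l + 1)" by (simp add: algebra_simps)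
    then have q2: "q \<le> real L0 + 1" by (simp add: q_def pos_divide_le_eq)
    have "q powr g \<le> q powr \<bar>g\<bar>" using q1 by (intro powr_mono) auto
    also have "\<dots> \<le> (real L0 + 1) powr \<bar>g\<bar>" using q1 q2 by (intro powr_mono2) auto
    also have "\<dots> \<le> M * 2 powr (- \<sigma> / 2 * L0)" by (rule M)
    finally have q: "q powr g \<le> M * 2 powr (- \<sigma> / 2 * L0)" .
    have "C * q powr g \<le> C * (M * 2 powr (- \<sigma> / 2 * L0))" using q assms(2) by (intro mult_left_mono) auto
    also have "\<dots> = (C * M) * 2 powr (- \<sigma> / 2 * L0)" by simp
    also have "\<dots> \<le> 2 powr (- \<sigma> / 2 * L0) * 2 powr (- \<sigma> / 2 * L0)" using CM by (intro mult_right_mono) auto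
    also have "\<dots> = 2 powr (- (L0 * \<sigma>))" unfolding powr_add[symmetric] by (rule arg_cong[of _ _ "\<lambda>e. 2 powr e"]) (simp add: field_simps)
    finally have Cq: "C * q powr g \<le> 2 powr (- (L0 * \<sigma>))" .
    have split: "(real (l + L0) + 1) powr g = q powr g * (real l + 1) powr g" by (simp add: q_def powr_divide)
    have "C * (2 powr ((l + L0) * \<sigma>) * (real (l + L0) + 1) powr g) = (C * q powr g) * (2 powr ((l + L0) * \<sigma>) * (real l + 1) powr g)"
      unfolding split by simp
    also have "\<dots> \<le> 2 powr (- (L0 * \<sigma>)) * (2 powr ((l + L0) * \<sigma>) * (real l + 1) powr g)"
      using Cq by (intro mult_right_mono) auto
    also have "\<dots> = (2 powr (- (L0 * \<sigma>)) * 2 powr ((l + L0) * \<sigma>)) * (real l + 1) powr g" by simp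
    also have "2 powr (- (L0 * \<sigma>)) * 2 powr ((l + L0) * \<sigma>) = 2 powr (l * \<sigma>)"
      unfolding powr_add[symmetric] by (rule arg_cong[of _ _ "\<lambda>e. 2 powr e"]) (simp add: algebra_simps)
    finally show ?thesis .
  qed
  then show ?thesis by blast
qed

section \<open>From dyadic levels to arbitrary sparsity\<close>

lemma dyadic_ln_bounds:
  fixes v l :: nat
  assumes "2 ^ l \<le> v" "v < 2 ^ (l + 1)"
  shows "real l + 1 \<le> 2 * ln (2 * real v)" "ln (2 * real v) \<le> 2 * (real l + 1)"
proof -
  have v: "(2::real) ^ l \<le> real v" "real v \<le> 2 ^ (l + 1)"
    using assms by (metis of_nat_le_iff of_nat_numeral of_nat_power less_imp_le)+
  have v0: "0 < real v" using v(1) by (rule less_le_trans[rotated]) simp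
  have "(real l + 1) * (1/2) \<le> (real l + 1) * ln 2" using ln2_ge_two_thirds by (intro mult_left_mono) auto
  also have "\<dots> = ln (2 ^ (l + 1))" by (simp only: ln_realpow of_nat_add of_nat_1)
  also have "\<dots> \<le> ln (2 * real v)" using v(1) by (intro ln_mono) auto
  finally show "real l + 1 \<le> 2 * ln (2 * real v)" by simp
  have "ln (2 * real v) \<le> ln (2 ^ (l + 2))" using v(2) v0 by (intro ln_mono) auto
  also have "\<dots> = (real l + 2) * ln 2" by (simp only: ln_realpow of_nat_add of_nat_numeral)
  also have "\<dots> \<le> (real l + 2) * 1" using ln_2_less_1 by (intro mult_left_mono) auto
  finally show "ln (2 * real v) \<le> 2 * (real l + 1)" by simp
qed

lemma W_class_Lp_space:
  assumes "0 < a" "0 < \<beta>" "\<beta> \<le> 1" "0 \<le> p" "f \<in> (W_class a b \<beta> :: (real ^ 'd::finite \<Rightarrow> complex) set)"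
  shows "f \<in> Lp_space torus_measure p"
proof -
  interpret finite_measure "torus_measure :: (real ^ 'd) measure" by (rule finite_measure_torus)
  obtain C where C: "f \<in> borel_measurable borel" "\<And>x. norm (f x) \<le> C"
    using W_class_decomposition[OF assms(1-3), of b, where 'd = 'd] assms(5) by meson
  note [measurable] = C(1)
  have "norm (f x) powr p \<le> C powr p" for x using C(2) assms(4) by (intro powr_mono2) auto
  then have "integrable torus_measure (\<lambda>x. norm (f x) powr p)"
    by (intro integrable_const_bound[where B = "C powr p"]) auto
  then show ?thesis by (simp add: Lp_space_def)
qed

text \<open>The constant \<open>C\<close> has to be fixed before \<open>t\<close>. For
  \<open>v\<close> between \<open>2 ^ l\<close> and \<open>2 ^ (l + 1)\<close>, recovery is carried
  out at the level \<open>l + L0\<close> with \<open>L0\<close> depending on \<open>t\<close>; this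
  moves the dependence into \<open>c\<close>, which grows by the factor
  \<open>2 ^ L0 * (2 * (L0 + 1)) ^ 3\<close>.\<close>

lemma recovery_bound_sampling:
  fixes p a b \<beta> :: real
  assumes "2 \<le> p" "0 < a" "0 < \<beta>" "\<beta> \<le> 1"
  defines "rb \<equiv> recovery_bound TYPE('d::finite) a b \<beta> p"
  shows "\<exists>C>0. \<forall>t. 0 < t \<and> t \<le> 1 \<longrightarrow> (\<exists>c>0. \<forall>v\<ge>1::nat. \<forall>m::nat.
    real m \<ge> c * real v * ln (2 * real v) ^ 3 \<longrightarrow> sampling_recovers (W_class a b \<beta> :: (real ^ 'd \<Rightarrow> complex) set) p t m (C * rb v))"
proof -
  define \<sigma> where "\<sigma> = 1 - 1 / p - 1 / \<beta> - a"
  define g where "g = real (CARD('d) - 1) * (a + b)"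
  define r where "r l = 2 powr (real l * \<sigma>) * (real l + 1) powr g" for l :: nat
  define C where "C = 2 powr \<bar>\<sigma>\<bar> * 2 powr \<bar>g\<bar>"
  \<comment> \<open>The exponent of \<open>v\<close> must be negative: only then does raising the
    level gain a factor.\<close>
  have "1 \<le> 1 / \<beta>" using assms by (simp add: field_simps)
  moreover have "0 < 1 / p" using assms by simp
  ultimately have \<sigma>: "\<sigma> < 0" using assms(2) unfolding \<sigma>_def by linarith
  have r_eq: "coeff_rate (CARD('d) - 1) a b \<beta> l * (2 ^ l) powr (- 1 / p) = r l" for l
  proof -
    have pw: "(2 ^ l) powr (- 1 / p) = 2 powr (real l * (- 1 / p))" by (simp add: powr_powr flip: powr_realpow)
    have "coeff_rate (CARD('d) - 1) a b \<beta> l * (2 ^ l) powr (- 1 / p)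
      = (2 powr (real l * (1 - 1 / \<beta> - a)) * 2 powr (real l * (- 1 / p))) * (real l + 1) powr g"
      unfolding coeff_rate_def g_def pw by (simp only: mult_ac)
    also have "2 powr (real l * (1 - 1 / \<beta> - a)) * 2 powr (real l * (- 1 / p)) = 2 powr (real l * \<sigma>)"
      unfolding powr_add[symmetric] by (rule arg_cong[of _ _ "\<lambda>e. 2 powr e"]) (simp add: \<sigma>_def algebra_simps)
    finally show ?thesis by (simp only: r_def)
  qed
  have "0 < C" by (simp add: C_def)
  have main: "\<exists>c>0. \<forall>v\<ge>1::nat. \<forall>m::nat. real m \<ge> c * real v * ln (2 * real v) ^ 3 \<longrightarrow>
    sampling_recovers (W_class a b \<beta> :: (real ^ 'd \<Rightarrow> complex) set) p t m (C * rb v)"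
    if t: "0 < t" "t \<le> 1" for t
  proof -
    obtain Ct c0 where Ct: "0 < Ct" and c0: "0 < c0" and rec: "\<forall>L m::nat. c0 * 2 ^ L * (real L + 1) ^ 3 \<le> real m \<longrightarrow>
      sampling_recovers (W_class a b \<beta> :: (real ^ 'd \<Rightarrow> complex) set) p t m (Ct * r L)"
      using sample_recovery[OF assms(1-4) t, of b, where 'd = 'd, unfolded r_eq] by (elim exE conjE) (rule that)
    obtain L0 where L0: "\<And>l::nat. Ct * r (l + L0) \<le> r l"
      using rate_shift[OF \<sigma> Ct, of g] unfolding r_def by auto
    define c where "c = c0 * 2 ^ L0 * (2 * (real L0 + 1)) ^ 3"
    have "sampling_recovers (W_class a b \<beta> :: (real ^ 'd \<Rightarrow> complex) set) p t m (C * rb v)"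
      if v: "1 \<le> v" and m: "c * real v * ln (2 * real v) ^ 3 \<le> real m" for v m :: nat
    proof -
      obtain l where l: "2 ^ l \<le> v" "v < 2 ^ (l + 1)" using ex_power_ivl1[of 2 v] v by auto
      note ln = dyadic_ln_bounds[OF l]
      have v2: "(2::real) ^ l \<le> real v" "real v \<le> 2 * 2 ^ l"
        using of_nat_mono[OF l(1), where 'a = real] of_nat_mono[OF less_imp_le[OF l(2)], where 'a = real] by simp_all
      have v0: "0 < real v" using v by simp
      have ln0: "0 < ln (2 * real v)" using ln(1) by linarith
      have "c0 * 2 ^ (l + L0) * (real (l + L0) + 1) ^ 3 \<le> real m"
      proof -
        have "real (l + L0) + 1 \<le> (real L0 + 1) * (real l + 1)" by (simp add: algebra_simps)
        also have "\<dots> \<le> (real L0 + 1) * (2 * ln (2 * real v))" using ln(1) by (intro mult_left_mono) auto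
        finally have "(real (l + L0) + 1) ^ 3 \<le> ((real L0 + 1) * (2 * ln (2 * real v))) ^ 3" by (intro power_mono) auto
        moreover have "c0 * 2 ^ (l + L0) \<le> c0 * (real v * 2 ^ L0)"
          unfolding power_add using v2(1) c0 by (intro mult_left_mono mult_right_mono) auto
        ultimately have "c0 * 2 ^ (l + L0) * (real (l + L0) + 1) ^ 3
          \<le> c0 * (real v * 2 ^ L0) * ((real L0 + 1) * (2 * ln (2 * real v))) ^ 3"
          using c0 by (intro mult_mono) auto
        also have "\<dots> = c * real v * ln (2 * real v) ^ 3" by (simp only: c_def power_mult_distrib mult_ac)
        finally show ?thesis using m by linarith
      qed
      note rec_l = rec[rule_format, OF this]
      have "Ct * r (l + L0) \<le> C * rb v"
      proof -
        have "2 powr (real l * \<sigma>) = (2 ^ l) powr \<sigma>" by (simp add: powr_powr flip: powr_realpow)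
        also have "\<dots> \<le> 2 powr \<bar>\<sigma>\<bar> * real v powr \<sigma>"
        proof (rule powr_le_of_ratio_le_2)
          show "(2::real) ^ l \<le> 2 * real v" using v2(1) v0 by linarith
        qed (use v2 v0 in auto)
        finally have 1: "2 powr (real l * \<sigma>) \<le> 2 powr \<bar>\<sigma>\<bar> * real v powr \<sigma>" .
        have 2: "(real l + 1) powr g \<le> 2 powr \<bar>g\<bar> * ln (2 * real v) powr g"
          using ln ln0 by (intro powr_le_of_ratio_le_2) auto
        have D: "real (CARD('d) - 1) = real CARD('d) - 1" by (simp add: of_nat_diff Suc_leI)
        have "r l \<le> (2 powr \<bar>\<sigma>\<bar> * real v powr \<sigma>) * (2 powr \<bar>g\<bar> * ln (2 * real v) powr g)"
          unfolding r_def using 1 2 by (intro mult_mono) auto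
        also have "\<dots> = C * rb v" by (simp add: rb_def recovery_bound_def C_def \<sigma>_def g_def D mult_ac)
        finally show ?thesis using L0[of l] by linarith
      qed
      with rec_l show ?thesis by (rule sampling_recovers_mono)
    qed
    moreover have "0 < c" using c0 by (simp add: c_def)
    ultimately show ?thesis by (intro exI[of _ c] conjI allI impI)
  qed
  show ?thesis by (rule exI[of _ C], rule conjI[OF \<open>0 < C\<close>], rule allI, rule impI, rule main) auto
qed

text \<open>Any function of the class with the observed samples serves as the recovery.\<close>

lemma optimal_recovery_le:
  fixes F :: "(real ^ 'd::finite \<Rightarrow> complex) set"
  assumes \<xi>: "inj_on \<xi> {..<m}" "\<xi> ` {..<m} \<subseteq> torus" and F: "F \<subseteq> Lp_space torus_measure p" and p: "0 < p"
    and B: "\<And>f f'. f \<in> F \<Longrightarrow> f' \<in> F \<Longrightarrow> (\<forall>i<m. f (\<xi> i) = f' (\<xi> i)) \<Longrightarrow> Lp_norm torus_measure p (\<lambda>x. f x - f' x) \<le> B"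
  shows "optimal_recovery m F p \<le> B"
proof -
  \<comment> \<open>Data that no function in \<open>F\<close> produces are sent to 0, which lies in
    the space; they do not occur in the supremum over \<open>F\<close>.\<close>
  define R where "R y = (if \<exists>f\<in>F. \<forall>i<m. f (\<xi> i) = y i then SOME f. f \<in> F \<and> (\<forall>i<m. f (\<xi> i) = y i) else (\<lambda>_. 0))" for y
  have R: "R y \<in> F \<and> (\<forall>i<m. R y (\<xi> i) = y i)" if "\<exists>f\<in>F. \<forall>i<m. f (\<xi> i) = y i" for y
  proof -
    have "R y = (SOME f. f \<in> F \<and> (\<forall>i<m. f (\<xi> i) = y i))" using that by (simp add: R_def)
    then show ?thesis using someI_ex[of "\<lambda>f. f \<in> F \<and> (\<forall>i<m. f (\<xi> i) = y i)"] that by auto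
  qed
  have R_space: "R y \<in> Lp_space torus_measure p" for y
  proof (cases "\<exists>f\<in>F. \<forall>i<m. f (\<xi> i) = y i")
    case True
    then show ?thesis using R F by blast
  next
    case False
    then have "R y = (\<lambda>_. 0)" unfolding R_def by (rule if_not_P)
    then show ?thesis using p by (simp add: Lp_space_def)
  qed
  have "(SUP f\<in>F. Lp_norm torus_measure p (\<lambda>x. f x - R (\<lambda>i\<in>{..<m}. f (\<xi> i)) x)) \<le> B"
  proof (rule SUP_least)
    fix f assume f: "f \<in> F"
    let ?y = "\<lambda>i\<in>{..<m}. f (\<xi> i)"
    have "\<exists>f\<in>F. \<forall>i<m. f (\<xi> i) = ?y i" using f by auto
    note Ry = R[OF this]
    have "R ?y \<in> F" by (rule conjunct1[OF Ry])
    moreover have "\<forall>i<m. f (\<xi> i) = R ?y (\<xi> i)"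
    proof (intro allI impI)
      fix i assume "i < m"
      then have "R ?y (\<xi> i) = ?y i" using Ry by blast
      also have "?y i = f (\<xi> i)" using \<open>i < m\<close> by simp
      finally show "f (\<xi> i) = R ?y (\<xi> i)" by (rule sym)
    qed
    ultimately show "Lp_norm torus_measure p (\<lambda>x. f x - R ?y x) \<le> B" using f by (intro B)
  qed
  then show ?thesis unfolding optimal_recovery_def
    using \<xi> R_space by (intro INF_lower2[of \<xi>] INF_lower2[of R]) auto
qed

theorem theorem1p3:
  fixes p a b \<beta> :: real
  assumes "2 \<le> p" and "0 < a" and "0 < \<beta>" and "\<beta> \<le> 1"
  shows "\<exists>C>0.
    (\<exists>c>0. \<forall>v\<ge>1::nat. \<forall>m::nat. real m \<ge> c * real v * ln (2 * real v) ^ 3 \<longrightarrow>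
       optimal_recovery m (W_class a b \<beta> :: (real ^ 'd::finite \<Rightarrow> complex) set) p
         \<le> ennreal (C * recovery_bound TYPE('d) a b \<beta> p v)) \<and>
    (\<forall>t. 0 < t \<and> t \<le> 1 \<longrightarrow>
      (\<exists>c>0. \<forall>v\<ge>1::nat. \<forall>m::nat. real m \<ge> c * real v * ln (2 * real v) ^ 3 \<longrightarrow>
        (\<exists>(\<xi> :: nat \<Rightarrow> real ^ 'd) (Q :: (int ^ 'd) set) (s :: nat).
          inj_on \<xi> {..<m} \<and> \<xi> ` {..<m} \<subseteq> torus \<and> finite Q \<and> Q \<noteq> {} \<and>
          (\<forall>f0\<in>W_class a b \<beta>. \<forall>g G.
             womp_run (sample_inner m \<xi>) t (trig ` Q) f0 s g G \<longrightarrow>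
             Lp_norm torus_measure p (\<lambda>x. f0 x - G s x)
               \<le> ennreal (C * recovery_bound TYPE('d) a b \<beta> p v)))))"
proof -
  let ?rb = "recovery_bound TYPE('d) a b \<beta> p"
  obtain C where C: "0 < C" and rec: "\<forall>t. 0 < t \<and> t \<le> 1 \<longrightarrow> (\<exists>c>0. \<forall>v\<ge>1::nat. \<forall>m::nat.
    real m \<ge> c * real v * ln (2 * real v) ^ 3 \<longrightarrow> sampling_recovers (W_class a b \<beta> :: (real ^ 'd \<Rightarrow> complex) set) p t m (C * ?rb v))"
    using recovery_bound_sampling[OF assms, of b, where 'd = 'd] by (elim exE conjE) (rule that)
  have sub: "(W_class a b \<beta> :: (real ^ 'd \<Rightarrow> complex) set) \<subseteq> Lp_space torus_measure p"
    using W_class_Lp_space[OF assms(2-4), of p] assms(1) by auto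
  \<comment> \<open>Optimal recovery does not mention \<open>t\<close>; the sample points belonging
    to \<open>t = 1\<close> are used for it.\<close>
  have "0 < (1::real) \<and> (1::real) \<le> 1" by simp
  from rec[rule_format, OF this] obtain c where c: "0 < c" and rec1: "\<forall>v\<ge>1::nat. \<forall>m::nat.
    real m \<ge> c * real v * ln (2 * real v) ^ 3 \<longrightarrow> sampling_recovers (W_class a b \<beta> :: (real ^ 'd \<Rightarrow> complex) set) p 1 m (C * ?rb v)"
    by (elim exE conjE) (rule that)
  have "optimal_recovery m (W_class a b \<beta> :: (real ^ 'd \<Rightarrow> complex) set) p \<le> ennreal (C * ?rb v)"
    if v: "1 \<le> v" and m: "c * real v * ln (2 * real v) ^ 3 \<le> real m" for v m :: nat
  proof -
    obtain \<xi> :: "nat \<Rightarrow> real ^ 'd" where \<xi>: "inj_on \<xi> {..<m}" "\<xi> ` {..<m} \<subseteq> torus"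
      "\<forall>f\<in>W_class a b \<beta>. \<forall>f'\<in>W_class a b \<beta>. (\<forall>i<m. f (\<xi> i) = f' (\<xi> i)) \<longrightarrow>
        Lp_norm torus_measure p (\<lambda>x. f x - f' x) \<le> ennreal (C * ?rb v)"
      using rec1[rule_format, OF v m] unfolding sampling_recovers_def by blast
    show ?thesis by (rule optimal_recovery_le[OF \<xi>(1,2) sub]) (use assms(1) \<xi>(3) in auto)
  qed
  then have opt: "\<exists>c>0. \<forall>v\<ge>1::nat. \<forall>m::nat. real m \<ge> c * real v * ln (2 * real v) ^ 3 \<longrightarrow>
       optimal_recovery m (W_class a b \<beta> :: (real ^ 'd::finite \<Rightarrow> complex) set) p \<le> ennreal (C * ?rb v)"
    using c by (intro exI[of _ c] conjI allI impI)
  have womp: "\<exists>c>0. \<forall>v\<ge>1::nat. \<forall>m::nat. real m \<ge> c * real v * ln (2 * real v) ^ 3 \<longrightarrow>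
        (\<exists>(\<xi> :: nat \<Rightarrow> real ^ 'd) (Q :: (int ^ 'd) set) (s :: nat).
          inj_on \<xi> {..<m} \<and> \<xi> ` {..<m} \<subseteq> torus \<and> finite Q \<and> Q \<noteq> {} \<and>
          (\<forall>f0\<in>W_class a b \<beta>. \<forall>g G.
             womp_run (sample_inner m \<xi>) t (trig ` Q) f0 s g G \<longrightarrow>
             Lp_norm torus_measure p (\<lambda>x. f0 x - G s x) \<le> ennreal (C * ?rb v)))"
    if "0 < t \<and> t \<le> 1" for t
    using rec[rule_format, OF that] unfolding sampling_recovers_def by meson
  show ?thesis by (rule exI[of _ C], intro conjI allI impI C opt womp) auto
qed

end
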